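(* Let $(\mathcal{C},\mathcal{D})$ be a regular inclusion with $\mathcal{D}$ abelian which has the approximate unit property, such that $\mathcal{C}$ is not unital. Then $(\mathcal{C},\mathcal{D})$ is a pseudo-Cartan inclusion if and only if $(\tilde{\mathcal{C}},\tilde{\mathcal{D}})$ is a pseudo-Cartan inclusion. Moreover: (a) if $(\mathcal{A},\mathcal{B},\alpha)$ is a Cartan envelope for $(\mathcal{C},\mathcal{D})$, then $(\tilde{\mathcal{A}},\tilde{\mathcal{B}},\tilde\alpha)$ is a Cartan envelope for $(\tilde{\mathcal{C}},\tilde{\mathcal{D}})$; (b) if $(\mathcal{A},\mathcal{B},\pi)$ is a Cartan envelope for $(\tilde{\mathcal{C}},\tilde{\mathcal{D}})$ with conditional expectation $\Delta:\mathcal{A}\to\mathcal{B}$, and $\alpha:=\pi|_{\mathcal{C}}$, $\mathcal{D}_1:=C^*(\Delta(\pi(\mathcal{C})))$, $\mathcal{C}_1:=C^*(\pi(\mathcal{C})\cup\mathcal{D}_1)$, then $\mathcal{D}_1$ is an ideal of $\mathcal{B}$ and $\mathcal{C}_1$ is an ideal of $\mathcal{A}$, each of codimension $1$, and $(\mathcal{C}_1,\mathcal{D}_1,\alpha)$ is a Cartan envelope for $(\mathcal{C},\mathcal{D})$.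
   Context: Inclusion: C*-algebra $\mathcal{C}$ with C*-subalgebra $\mathcal{D}$. The approximate unit property: some approximate unit for $\mathcal{D}$ is an approximate unit for $\mathcal{C}$. For a non-unital C*-algebra $\mathcal{X}$, $\tilde{\mathcal{X}}=\mathcal{X}\times\mathbb{C}$ is its unitization (and $\tilde{\mathcal{X}}=\mathcal{X}$ if unital); here $\tilde{\mathcal{D}}$ is regarded as the C*-subalgebra $\mathcal{D}+\mathbb{C}I$ of $\tilde{\mathcal{C}}$, and for a $*$-homomorphism $\alpha:\mathcal{C}\to\mathcal{A}$, $\tilde\alpha:\tilde{\mathcal{C}}\to\tilde{\mathcal{A}}$ is $\tilde\alpha(c,\lambda)=\alpha(c)+\lambda I_{\tilde{\mathcal{A}}}$. $\mathcal{N}(\mathcal{C},\mathcal{D})=\{v: v\mathcal{D}v^*\cup v^*\mathcal{D}v\subseteq\mathcal{D}\}$; regular: its span is dense. $\mathcal{D}^c$: relative commutant. Ideal intersection property: every nonzero closed ideal of the big algebra meets the subalgebra. Pseudo-Cartan inclusion: regular inclusion with $\mathcal{D}$, $\mathcal{D}^c$ abelian and $(\mathcal{C},\mathcal{D}^c)$, $(\mathcal{D}^c,\mathcal{D})$ having the ideal intersection property. Regular $*$-homomorphism: maps normalizers into normalizers. Cartan inclusion $(\mathcal{A},\mathcal{B})$: regular, $\mathcal{B}$ maximal abelian, with faithful conditional expectation $\Delta:\mathcal{A}\to\mathcal{B}$. Cartan envelope for regular $(\mathcal{C},\mathcal{D})$: $(\mathcal{A},\mathcal{B},\alpha)$ with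 $(\mathcal{A},\mathcal{B})$ Cartan, $\alpha:\mathcal{C}\to\mathcal{A}$ a regular $*$-monomorphism, $\alpha(\mathcal{D})\subseteq\mathcal{B}$ with $(\mathcal{B},\alpha(\mathcal{D}))$ having the ideal intersection property, $\mathcal{B}=C^*(\Delta(\alpha(\mathcal{C})))$, $\mathcal{A}=C^*(\alpha(\mathcal{C})\cup\mathcal{B})$. *)

theory Defs
  imports "HOL-Analysis.Analysis"
begin

text \<open>An ambient unital C*-algebra: a real Banach algebra with unit carrying a complex
  scalar multiplication (extending the real one) and an involution satisfying the C*-identity.
  All C*-algebras of the paper are modelled as C*-subalgebras (sets) of such ambient types.\<close>

class cstar_algebra = real_normed_algebra_1 + banach +
  fixes cs_scale :: "complex \<Rightarrow> 'a \<Rightarrow> 'a"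
    and cs_adj :: "'a \<Rightarrow> 'a"
  assumes cs_scale_real: "cs_scale (complex_of_real r) x = scaleR r x"
    and cs_scale_add_left: "cs_scale (a + b) x = cs_scale a x + cs_scale b x"
    and cs_scale_add_right: "cs_scale a (x + y) = cs_scale a x + cs_scale a y"
    and cs_scale_scale: "cs_scale a (cs_scale b x) = cs_scale (a * b) x"
    and cs_scale_mult_left: "cs_scale a x * y = cs_scale a (x * y)"
    and cs_scale_mult_right: "x * cs_scale a y = cs_scale a (x * y)"
    and norm_cs_scale: "norm (cs_scale a x) = cmod a * norm x"
    and cs_adj_adj: "cs_adj (cs_adj x) = x"
    and cs_adj_add: "cs_adj (x + y) = cs_adj x + cs_adj y"
    and cs_adj_mult: "cs_adj (x * y) = cs_adj y * cs_adj x"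
    and cs_adj_scale: "cs_adj (cs_scale a x) = cs_scale (cnj a) (cs_adj x)"
    and cstar_identity: "norm (cs_adj x * x) = (norm x)\<^sup>2"

definition csubspace :: "'a::cstar_algebra set \<Rightarrow> bool" where
  "csubspace S \<longleftrightarrow> 0 \<in> S \<and> (\<forall>x\<in>S. \<forall>y\<in>S. x + y \<in> S) \<and> (\<forall>a. \<forall>x\<in>S. cs_scale a x \<in> S)"

definition cspan :: "'a::cstar_algebra set \<Rightarrow> 'a set" where
  "cspan X = \<Inter>{S. csubspace S \<and> X \<subseteq> S}"

definition cstar_subalg :: "'a::cstar_algebra set \<Rightarrow> bool" where
  "cstar_subalg S \<longleftrightarrow> csubspace S \<and> closed S \<and> (\<forall>x\<in>S. \<forall>y\<in>S. x * y \<in> S)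
     \<and> (\<forall>x\<in>S. cs_adj x \<in> S)"

definition cstar_gen :: "'a::cstar_algebra set \<Rightarrow> 'a set" where
  "cstar_gen X = \<Inter>{S. cstar_subalg S \<and> X \<subseteq> S}"

definition abelian :: "'a::cstar_algebra set \<Rightarrow> bool" where
  "abelian S \<longleftrightarrow> (\<forall>x\<in>S. \<forall>y\<in>S. x * y = y * x)"

definition closed_ideal :: "'a::cstar_algebra set \<Rightarrow> 'a set \<Rightarrow> bool" where
  "closed_ideal J C \<longleftrightarrow> J \<subseteq> C \<and> csubspace J \<and> closed J
     \<and> (\<forall>j\<in>J. \<forall>c\<in>C. c * j \<in> J \<and> j * c \<in> J)"

definition codim_one :: "'a::cstar_algebra set \<Rightarrow> 'a set \<Rightarrow> bool" where
  "codim_one J C \<longleftrightarrow> (\<exists>b\<in>C. b \<notin> J \<and> C = {j + cs_scale l b | j l. j \<in> J})"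

definition ideal_intersection_property :: "'a::cstar_algebra set \<Rightarrow> 'a set \<Rightarrow> bool" where
  "ideal_intersection_property C D \<longleftrightarrow>
     (\<forall>J. closed_ideal J C \<and> J \<noteq> {0} \<longrightarrow> J \<inter> D \<noteq> {0})"

definition rel_commutant :: "'a::cstar_algebra set \<Rightarrow> 'a set \<Rightarrow> 'a set" where
  "rel_commutant C D = {c \<in> C. \<forall>d\<in>D. c * d = d * c}"

definition normalizers :: "'a::cstar_algebra set \<Rightarrow> 'a set \<Rightarrow> 'a set" where
  "normalizers C D = {v \<in> C. \<forall>d\<in>D. v * d * cs_adj v \<in> D \<and> cs_adj v * d * v \<in> D}"

definition inclusion :: "'a::cstar_algebra set \<Rightarrow> 'a set \<Rightarrow> bool" where
  "inclusion C D \<longleftrightarrow> cstar_subalg C \<and> cstar_subalg D \<and> D \<subseteq> C"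

definition regular_inclusion :: "'a::cstar_algebra set \<Rightarrow> 'a set \<Rightarrow> bool" where
  "regular_inclusion C D \<longleftrightarrow> inclusion C D \<and> closure (cspan (normalizers C D)) = C"

definition pseudo_cartan :: "'a::cstar_algebra set \<Rightarrow> 'a set \<Rightarrow> bool" where
  "pseudo_cartan C D \<longleftrightarrow> regular_inclusion C D \<and> abelian D \<and> abelian (rel_commutant C D)
     \<and> ideal_intersection_property C (rel_commutant C D)
     \<and> ideal_intersection_property (rel_commutant C D) D"

definition positive_in :: "'a::cstar_algebra set \<Rightarrow> 'a \<Rightarrow> bool" where
  "positive_in D u \<longleftrightarrow> (\<exists>b\<in>D. u = cs_adj b * b)"

text \<open>Approximate unit property: some approximate unit (net of positive contractions) of D
  is an approximate unit for C.  A net is represented by its image filter on the ambient type.\<close>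
definition approx_unit_property :: "'a::cstar_algebra set \<Rightarrow> 'a set \<Rightarrow> bool" where
  "approx_unit_property C D \<longleftrightarrow>
     (\<exists>F. F \<noteq> bot \<and> eventually (\<lambda>u. u \<in> D \<and> positive_in D u \<and> norm u \<le> 1) F
        \<and> (\<forall>c\<in>C. ((\<lambda>u. u * c) \<longlongrightarrow> c) F \<and> ((\<lambda>u. c * u) \<longlongrightarrow> c) F))"

definition unital_alg :: "'a::cstar_algebra set \<Rightarrow> bool" where
  "unital_alg S \<longleftrightarrow> (\<exists>e\<in>S. \<forall>x\<in>S. e * x = x \<and> x * e = x)"

definition unit_of :: "'a::cstar_algebra set \<Rightarrow> 'a" where
  "unit_of S = (if unital_alg S then (THE e. e \<in> S \<and> (\<forall>x\<in>S. e * x = x \<and> x * e = x)) else 1)"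

definition plus_unit :: "'a::cstar_algebra set \<Rightarrow> 'a set" where
  "plus_unit S = {x + cs_scale l 1 | x l. x \<in> S}"

text \<open>X + C e for a given unit e (used for B~ = B + C I_{A~} inside A~).\<close>
definition plus_unit_of :: "'a::cstar_algebra set \<Rightarrow> 'a \<Rightarrow> 'a set" where
  "plus_unit_of S e = {x + cs_scale l e | x l. x \<in> S}"

text \<open>Unitization: X itself if unital, otherwise X + C I (which is isomorphic to X x C).\<close>
definition unitization :: "'a::cstar_algebra set \<Rightarrow> 'a set" where
  "unitization S = (if unital_alg S then S else plus_unit S)"

definition ext_hom :: "'a::cstar_algebra set \<Rightarrow> ('a \<Rightarrow> 'b::cstar_algebra) \<Rightarrow> 'b set \<Rightarrow> 'a \<Rightarrow> 'b" where
  "ext_hom C \<alpha> A x = (let p = (THE p. fst p \<in> C \<and> x = fst p + cs_scale (snd p) 1)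
      in \<alpha> (fst p) + cs_scale (snd p) (unit_of (unitization A)))"

definition star_hom :: "'a::cstar_algebra set \<Rightarrow> ('a \<Rightarrow> 'b::cstar_algebra) \<Rightarrow> 'b set \<Rightarrow> bool" where
  "star_hom C \<alpha> A \<longleftrightarrow> \<alpha> ` C \<subseteq> A \<and> (\<forall>x\<in>C. \<forall>y\<in>C. \<alpha> (x + y) = \<alpha> x + \<alpha> y \<and> \<alpha> (x * y) = \<alpha> x * \<alpha> y)
     \<and> (\<forall>a. \<forall>x\<in>C. \<alpha> (cs_scale a x) = cs_scale a (\<alpha> x)) \<and> (\<forall>x\<in>C. \<alpha> (cs_adj x) = cs_adj (\<alpha> x))"

definition regular_hom :: "'a::cstar_algebra set \<Rightarrow> 'a set \<Rightarrow> ('a \<Rightarrow> 'b::cstar_algebra) \<Rightarrow> 'b set \<Rightarrow> 'b set \<Rightarrow> bool" where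
  "regular_hom C D \<alpha> A B \<longleftrightarrow> \<alpha> ` normalizers C D \<subseteq> normalizers A B"

definition faithful_cond_exp :: "'a::cstar_algebra set \<Rightarrow> 'a set \<Rightarrow> ('a \<Rightarrow> 'a) \<Rightarrow> bool" where
  "faithful_cond_exp A B \<Delta> \<longleftrightarrow> \<Delta> ` A \<subseteq> B
     \<and> (\<forall>x\<in>A. \<forall>y\<in>A. \<Delta> (x + y) = \<Delta> x + \<Delta> y) \<and> (\<forall>a. \<forall>x\<in>A. \<Delta> (cs_scale a x) = cs_scale a (\<Delta> x))
     \<and> (\<forall>b\<in>B. \<Delta> b = b)
     \<and> (\<forall>x\<in>A. norm (\<Delta> x) \<le> norm x)
     \<and> (\<forall>x\<in>A. positive_in B (\<Delta> (cs_adj x * x)))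
     \<and> (\<forall>x\<in>A. \<forall>b1\<in>B. \<forall>b2\<in>B. \<Delta> (b1 * x * b2) = b1 * \<Delta> x * b2)
     \<and> (\<forall>x\<in>A. \<Delta> (cs_adj x * x) = 0 \<longrightarrow> x = 0)"

definition cartan :: "'a::cstar_algebra set \<Rightarrow> 'a set \<Rightarrow> bool" where
  "cartan A B \<longleftrightarrow> regular_inclusion A B \<and> abelian B \<and> rel_commutant A B = B
     \<and> (\<exists>\<Delta>. faithful_cond_exp A B \<Delta>)"

definition cartan_envelope :: "'a::cstar_algebra set \<Rightarrow> 'a set \<Rightarrow> 'b::cstar_algebra set \<Rightarrow> 'b set \<Rightarrow> ('a \<Rightarrow> 'b) \<Rightarrow> bool" where
  "cartan_envelope C D A B \<alpha> \<longleftrightarrow> cartan A B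
     \<and> star_hom C \<alpha> A \<and> inj_on \<alpha> C \<and> regular_hom C D \<alpha> A B
     \<and> \<alpha> ` D \<subseteq> B \<and> ideal_intersection_property B (\<alpha> ` D)
     \<and> (\<exists>\<Delta>. faithful_cond_exp A B \<Delta> \<and> B = cstar_gen (\<Delta> ` \<alpha> ` C))
     \<and> A = cstar_gen (\<alpha> ` C \<union> B)"

end

theory Submission
  imports Defs
begin

text \<open>The unitization adds a single dimension, and a closed ideal of the unitization that misses a
  non-unital algebra would provide it with a unit; this transfers the ideal intersection property.
  For the envelopes, the image of the approximate unit of \<open>D\<close> is an approximate unit of the whole
  envelope. In (a) the expectation is extended by $\Delta(a + \lambda) = \Delta(a) + \lambda$; it is
  contractive and positive because the norm of \<open>y\<close> in the unitization of a non-unital \<open>S\<close> is the norm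
  of multiplication by \<open>y\<close> on \<open>S\<close>. In (b) the expectation of a Cartan inclusion is unique, and the
  unit of \<open>A\<close> is not in \<open>C1\<close> because injective homomorphisms are isometric. Both this and
  contractivity of homomorphisms are obtained without spectral theory, from square roots of
  $1 - x$ for self-adjoint contractions and from the fact that the real part of a unitary is a
  contraction.\<close>

section \<open>Scalars and the involution\<close>

text \<open>All algebras are concrete closed subsets of a unital ambient algebra, and positivity is
  available only as the existence of a factorization \<open>cs_adj b * b\<close>. Order statements
  are therefore recast as norm estimates: \<open>norm (s *\<^sub>R 1 - z) \<le> s\<close> stands for
  positivity of a self-adjoint \<open>z\<close>, since this form can be tested by multiplication on
  a non-unital algebra and survives limits. Functional calculus is replaced by one clause carried
  along with each square root: it commutes with everything that commutes with the given element. An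
  approximate unit is a single filter, and its images and squares are \<open>filtermap\<close>s of
  it. Uniqueness of the expectation is forced by (b): the definition of an envelope supplies some
  expectation whose range generates \<open>B\<close>, whereas \<open>D1\<close> is built from a
  prescribed one. Isometry matters because the image of \<open>D\<close> has to be closed: a unit of
  the envelope, or in (b) a unit in \<open>C1\<close>, would be a limit of elements of that image
  and hence come from \<open>D\<close>.\<close>

lemma cs_scale_0_left [simp]: "cs_scale 0 (x::'a::cstar_algebra) = 0"
  using cs_scale_real[of 0 x] by simp

lemma cs_scale_1 [simp]: "cs_scale 1 (x::'a::cstar_algebra) = x"
  using cs_scale_real[of 1 x] by simp

lemma cs_scale_0_right [simp]: "cs_scale a (0::'a::cstar_algebra) = 0"
  using norm_cs_scale[of a "0::'a"] by simp

lemma cs_scale_minus_right [simp]: "cs_scale a (- x::'a::cstar_algebra) = - cs_scale a x"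
  using cs_scale_add_right[of a x "-x"] by (simp add: eq_neg_iff_add_eq_0 add.commute)

lemma cs_scale_minus_left [simp]: "cs_scale (- a) (x::'a::cstar_algebra) = - cs_scale a x"
  using cs_scale_add_left[of a "-a" x] by (simp add: eq_neg_iff_add_eq_0 add.commute)

lemma cs_scale_diff_right: "cs_scale a (x - y::'a::cstar_algebra) = cs_scale a x - cs_scale a y"
  using cs_scale_add_right[of a x "-y"] by simp

lemma cs_scale_diff_left: "cs_scale (a - b) (x::'a::cstar_algebra) = cs_scale a x - cs_scale b x"
  using cs_scale_add_left[of a "-b" x] by simp

lemma cs_adj_0 [simp]: "cs_adj (0::'a::cstar_algebra) = 0"
  using cs_adj_scale[of 0 "0::'a"] by simp

lemma cs_adj_minus [simp]: "cs_adj (- x::'a::cstar_algebra) = - cs_adj x"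
  using cs_adj_add[of x "-x"] by (simp add: eq_neg_iff_add_eq_0 add.commute)

lemma cs_adj_diff: "cs_adj (x - y::'a::cstar_algebra) = cs_adj x - cs_adj y"
  using cs_adj_add[of x "-y"] by simp

lemma cs_adj_1 [simp]: "cs_adj (1::'a::cstar_algebra) = 1"
  by (metis cs_adj_adj cs_adj_mult mult_1 mult.right_neutral)

lemma cs_adj_scaleR: "cs_adj (scaleR r x::'a::cstar_algebra) = scaleR r (cs_adj x)"
  using cs_adj_scale[of "complex_of_real r" x] by (simp add: cs_scale_real)

lemmas cs_ring_simps = algebra_simps cs_scale_mult_left cs_scale_mult_right cs_scale_add_left
  cs_scale_add_right cs_scale_diff_left cs_scale_diff_right cs_scale_scale

lemmas cs_adj_simps = cs_adj_adj cs_adj_add cs_adj_diff cs_adj_mult cs_adj_scale cs_adj_scaleR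

lemma norm_cs_adj [simp]: "norm (cs_adj x) = norm (x::'a::cstar_algebra)"
proof -
  have le: "norm y \<le> norm (cs_adj y)" for y :: 'a
  proof (cases "y = 0")
    case False
    have "norm y * norm y \<le> norm (cs_adj y) * norm y"
      using norm_mult_ineq[of "cs_adj y" y] by (simp add: cstar_identity power2_eq_square)
    then show ?thesis using False by simp
  qed simp
  show ?thesis using le[of x] le[of "cs_adj x"] by (simp add: cs_adj_adj)
qed

lemma cs_adj_mult_eq_0: "cs_adj x * x = 0 \<longleftrightarrow> (x::'a::cstar_algebra) = 0"
  using cstar_identity[of x] by auto

lemma bounded_linear_cs_adj: "bounded_linear (cs_adj :: 'a::cstar_algebra \<Rightarrow> 'a)"
  by (rule bounded_linear_intro[of _ 1]) (auto simp: cs_adj_add cs_adj_scaleR)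

lemma bounded_linear_cs_scale: "bounded_linear (cs_scale a :: 'a::cstar_algebra \<Rightarrow> 'a)"
proof (rule bounded_linear_intro[of _ "cmod a"])
  fix r and x :: 'a
  show "cs_scale a (scaleR r x) = scaleR r (cs_scale a x)"
    by (simp add: cs_scale_scale mult.commute flip: cs_scale_real)
qed (auto simp: cs_scale_add_right norm_cs_scale)

lemmas tendsto_cs_adj = bounded_linear.tendsto[OF bounded_linear_cs_adj]
lemmas tendsto_cs_scale = bounded_linear.tendsto[OF bounded_linear_cs_scale]

section \<open>Subspaces and subalgebras\<close>

lemma csubspaceD:
  assumes "csubspace S"
  shows csubspace_0: "0 \<in> S"
    and csubspace_add: "\<And>x y. x \<in> S \<Longrightarrow> y \<in> S \<Longrightarrow> x + y \<in> S"
    and csubspace_scale: "\<And>a x. x \<in> S \<Longrightarrow> cs_scale a x \<in> S"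
  using assms by (auto simp: csubspace_def)

lemma csubspace_minus: "csubspace S \<Longrightarrow> x \<in> S \<Longrightarrow> - x \<in> S"
  using csubspace_scale[of S x "-1"] by simp

lemma csubspace_diff: "csubspace S \<Longrightarrow> x \<in> S \<Longrightarrow> y \<in> S \<Longrightarrow> x - y \<in> S"
  using csubspace_add[of S x "-y"] csubspace_minus[of S y] by simp

lemma csubspace_scaleR: "csubspace S \<Longrightarrow> x \<in> S \<Longrightarrow> scaleR r x \<in> S"
  using csubspace_scale[of S x "complex_of_real r"] by (simp add: cs_scale_real)

lemma csubspace_scale_iff: "csubspace S \<Longrightarrow> a \<noteq> 0 \<Longrightarrow> cs_scale a x \<in> S \<longleftrightarrow> x \<in> S"
  using csubspace_scale[of S "cs_scale a x" "inverse a"] csubspace_scale[of S x a]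
  by (auto simp: cs_scale_scale)

lemma cstar_subalgD:
  assumes "cstar_subalg S"
  shows cstar_subalg_csubspace: "csubspace S"
    and cstar_subalg_closed: "closed S"
    and cstar_subalg_0: "0 \<in> S"
    and cstar_subalg_add: "\<And>x y. x \<in> S \<Longrightarrow> y \<in> S \<Longrightarrow> x + y \<in> S"
    and cstar_subalg_diff: "\<And>x y. x \<in> S \<Longrightarrow> y \<in> S \<Longrightarrow> x - y \<in> S"
    and cstar_subalg_minus: "\<And>x. x \<in> S \<Longrightarrow> - x \<in> S"
    and cstar_subalg_scale: "\<And>a x. x \<in> S \<Longrightarrow> cs_scale a x \<in> S"
    and cstar_subalg_scaleR: "\<And>r x. x \<in> S \<Longrightarrow> scaleR r x \<in> S"
    and cstar_subalg_mult: "\<And>x y. x \<in> S \<Longrightarrow> y \<in> S \<Longrightarrow> x * y \<in> S"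
    and cstar_subalg_adj: "\<And>x. x \<in> S \<Longrightarrow> cs_adj x \<in> S"
  using assms by (auto simp: cstar_subalg_def csubspaceD csubspace_diff csubspace_minus csubspace_scaleR)

lemmas cstar_subalg_ops = cstar_subalgD(3-10)

lemma csubspace_cspan: "csubspace (cspan X)"
  by (auto simp: cspan_def csubspace_def)

lemma cspan_superset: "X \<subseteq> cspan X"
  by (auto simp: cspan_def)

lemma cspan_least: "csubspace S \<Longrightarrow> X \<subseteq> S \<Longrightarrow> cspan X \<subseteq> S"
  by (auto simp: cspan_def)

lemma csubspace_closure:
  assumes S: "csubspace (S::'a::cstar_algebra set)"
  shows "csubspace (closure S)"
  unfolding csubspace_def
proof (intro conjI ballI allI)
  show "0 \<in> closure S" using csubspace_0[OF S] closure_subset by blast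
next
  fix x y assume "x \<in> closure S" "y \<in> closure S"
  then obtain f g where "\<And>n. f n \<in> S" "f \<longlonglongrightarrow> x" "\<And>n. g n \<in> S" "g \<longlonglongrightarrow> y"
    by (auto simp: closure_sequential)
  then show "x + y \<in> closure S"
    unfolding closure_sequential
    by (intro exI[of _ "\<lambda>n. f n + g n"]) (auto intro: tendsto_add csubspace_add[OF S])
next
  fix a x assume "x \<in> closure S"
  then obtain f where "\<And>n. f n \<in> S" "f \<longlonglongrightarrow> x"
    by (auto simp: closure_sequential)
  then show "cs_scale a x \<in> closure S"
    unfolding closure_sequential
    by (intro exI[of _ "\<lambda>n. cs_scale a (f n)"]) (auto intro: tendsto_cs_scale csubspace_scale[OF S])
qed

lemma closed_limit:
  assumes "closed S" "F \<noteq> bot" "eventually (\<lambda>u. f u \<in> S) F" "(f \<longlongrightarrow> x) F"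
  shows "x \<in> S"
  using Lim_in_closed_set assms by blast

lemma cstar_subalg_gen: "cstar_subalg (cstar_gen X)"
  unfolding cstar_gen_def
  by (auto simp: cstar_subalg_def csubspace_def intro!: closed_Inter)

lemma cstar_gen_superset: "X \<subseteq> cstar_gen X"
  by (auto simp: cstar_gen_def)

lemma cstar_gen_least: "cstar_subalg S \<Longrightarrow> X \<subseteq> S \<Longrightarrow> cstar_gen X \<subseteq> S"
  by (auto simp: cstar_gen_def)

section \<open>Adjoining a unit to a subspace or subalgebra\<close>

lemma plus_unit_eq: "plus_unit S = plus_unit_of S 1"
  by (simp add: plus_unit_def plus_unit_of_def)

lemma plus_unit_ofE:
  assumes "y \<in> plus_unit_of S e"
  obtains x l where "x \<in> S" "y = x + cs_scale l e"
  using assms by (auto simp: plus_unit_of_def)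

lemma plus_unit_ofI: "x \<in> S \<Longrightarrow> x + cs_scale l e \<in> plus_unit_of S e"
  by (auto simp: plus_unit_of_def)

lemma subset_plus_unit_of: "S \<subseteq> plus_unit_of S e"
proof
  fix x assume "x \<in> S"
  then have "x + cs_scale 0 e \<in> plus_unit_of S e" by (rule plus_unit_ofI)
  then show "x \<in> plus_unit_of S e" by simp
qed

lemma plus_unit_of_subset:
  assumes K: "csubspace K" and "S \<subseteq> K" "e \<in> K"
  shows "plus_unit_of S e \<subseteq> K"
proof
  fix y assume "y \<in> plus_unit_of S e"
  then obtain x l where "x \<in> S" "y = x + cs_scale l e" by (rule plus_unit_ofE)
  then show "y \<in> K" using assms csubspace_add[OF K] csubspace_scale[OF K] by blast
qed

lemma unit_in_plus_unit_of: "0 \<in> S \<Longrightarrow> e \<in> plus_unit_of S e"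
  using plus_unit_ofI[of 0 S 1 e] by simp

lemma plus_unit_of_mem_iff:
  assumes "csubspace S" "e \<notin> S" "x \<in> S"
  shows "x + cs_scale l e \<in> S \<longleftrightarrow> l = 0"
proof
  assume "x + cs_scale l e \<in> S"
  then have "(x + cs_scale l e) - x \<in> S" using assms csubspace_diff by blast
  then show "l = 0" using csubspace_scale_iff[of S l e] assms by auto
qed (use assms in simp)

lemma plus_unit_of_unique:
  assumes "csubspace S" "e \<notin> S" "x \<in> S" "y \<in> S" "x + cs_scale l e = y + cs_scale m e"
  shows "x = y \<and> l = m"
proof -
  have "(x - y) + cs_scale (l - m) e = 0"
    using assms(5) by (simp add: cs_scale_diff_left algebra_simps)
  then have "l - m = 0"
    using plus_unit_of_mem_iff[of S e "x - y" "l - m"] assms csubspace_diff csubspace_0 by metis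
  then show ?thesis using assms(5) by simp
qed

lemma csubspace_plus_unit_of:
  assumes S: "csubspace S"
  shows "csubspace (plus_unit_of S e)"
  unfolding csubspace_def
proof (intro conjI ballI allI)
  show "0 \<in> plus_unit_of S e" using csubspace_0[OF S] subset_plus_unit_of by blast
next
  fix x y assume "x \<in> plus_unit_of S e" "y \<in> plus_unit_of S e"
  then obtain a l b m where ab: "a \<in> S" "b \<in> S" "x = a + cs_scale l e" "y = b + cs_scale m e"
    by (metis plus_unit_ofE)
  then have "x + y = (a + b) + cs_scale (l + m) e" by (simp add: cs_ring_simps)
  then show "x + y \<in> plus_unit_of S e" using ab csubspace_add[OF S] plus_unit_ofI by metis
next
  fix c x assume "x \<in> plus_unit_of S e"
  then obtain a l where ab: "a \<in> S" "x = a + cs_scale l e"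
    by (metis plus_unit_ofE)
  then have "cs_scale c x = cs_scale c a + cs_scale (c * l) e" by (simp add: cs_ring_simps)
  then show "cs_scale c x \<in> plus_unit_of S e" using ab csubspace_scale[OF S] plus_unit_ofI by metis
qed

text \<open>When \<open>e\<close> lies outside \<open>S\<close>, its positive distance to
  \<open>S\<close> controls the coefficient of \<open>e\<close>. Along a convergent sequence the
  coefficients are therefore Cauchy and can be split off, leaving a convergent sequence in
  \<open>S\<close>.\<close>

lemma closed_plus_unit_of:
  assumes S: "csubspace (S::'a::cstar_algebra set)" and cl: "closed S"
  shows "closed (plus_unit_of S e)"
proof (cases "e \<in> S")
  case True
  then have "plus_unit_of S e = S"
    using subset_plus_unit_of[of S e] csubspace_add[OF S] csubspace_scale[OF S]
    by (auto simp: plus_unit_of_def)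
  then show ?thesis using cl by simp
next
  case False
  then obtain d where d: "d > 0" "\<And>s. s \<in> S \<Longrightarrow> d \<le> dist e s"
    using cl unfolding closed_def open_contains_ball by (metis ComplI ComplD mem_ball not_le subsetD)
  have lb: "cmod l * d \<le> norm (s + cs_scale l e)" if s: "s \<in> S" for s l
  proof (cases "l = 0")
    case False
    have "cs_scale (- inverse l) s \<in> S" using csubspace_scale[OF S s] .
    then have "d \<le> norm (e - cs_scale (- inverse l) s)" using d(2) by (metis dist_norm)
    then have "cmod l * d \<le> norm (cs_scale l (e - cs_scale (- inverse l) s))"
      unfolding norm_cs_scale by (rule mult_left_mono) simp
    also have "cs_scale l (e - cs_scale (- inverse l) s) = s + cs_scale l e"
      using False by (simp add: cs_scale_add_right cs_scale_scale)
    finally show ?thesis .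
  qed simp
  show ?thesis
    unfolding closed_sequential_limits
  proof (intro allI impI, elim conjE)
    fix y x assume y: "\<forall>n. y n \<in> plus_unit_of S e" and lim: "y \<longlonglongrightarrow> x"
    have "\<forall>n. \<exists>s l. s \<in> S \<and> y n = s + cs_scale l e" using y by (metis plus_unit_ofE)
    then obtain s l where sl: "\<And>n. s n \<in> S" "\<And>n. y n = s n + cs_scale (l n) e" by metis
    have C: "Cauchy y" using lim LIMSEQ_imp_Cauchy by blast
    have "Cauchy l"
    proof (rule metric_CauchyI)
      fix \<epsilon> :: real assume "\<epsilon> > 0"
      then obtain M where M: "\<And>m n. m \<ge> M \<Longrightarrow> n \<ge> M \<Longrightarrow> dist (y m) (y n) < \<epsilon> * d"
        using metric_CauchyD[OF C, of "\<epsilon> * d"] d(1) by auto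
      have "dist (l m) (l n) < \<epsilon>" if "m \<ge> M" "n \<ge> M" for m n
      proof -
        have "cmod (l m - l n) * d \<le> norm ((s m - s n) + cs_scale (l m - l n) e)"
          using lb csubspace_diff[OF S sl(1) sl(1)] by blast
        also have "(s m - s n) + cs_scale (l m - l n) e = y m - y n"
          by (simp add: sl(2) cs_ring_simps)
        finally have "cmod (l m - l n) * d < \<epsilon> * d" using M[OF that] by (simp add: dist_norm)
        then show ?thesis using d(1) by (simp add: dist_norm)
      qed
      then show "\<exists>M. \<forall>m\<ge>M. \<forall>n\<ge>M. dist (l m) (l n) < \<epsilon>" by blast
    qed
    then obtain L where L: "l \<longlonglongrightarrow> L" using Cauchy_convergent_iff convergent_def by blast
    have "(\<lambda>n. cs_scale (l n - L) e) \<longlonglongrightarrow> 0"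
    proof (rule Lim_null_comparison)
      show "\<forall>\<^sub>F n in sequentially. norm (cs_scale (l n - L) e) \<le> cmod (l n - L) * norm e"
        by (simp add: norm_cs_scale)
      show "(\<lambda>n. cmod (l n - L) * norm e) \<longlonglongrightarrow> 0"
        using L by (intro tendsto_mult_left_zero tendsto_norm_zero) (simp add: LIM_zero_iff)
    qed
    then have "(\<lambda>n. y n - (cs_scale (l n - L) e + cs_scale L e)) \<longlonglongrightarrow> x - (0 + cs_scale L e)"
      using lim by (intro tendsto_intros)
    moreover have "y n - (cs_scale (l n - L) e + cs_scale L e) = s n" for n
      by (simp add: sl(2) cs_ring_simps)
    ultimately have "s \<longlonglongrightarrow> x - cs_scale L e" by simp
    then have "x - cs_scale L e \<in> S"
      using cl sl(1) closed_sequential_limits by blast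
    then show "x \<in> plus_unit_of S e"
      using plus_unit_ofI[of "x - cs_scale L e" S L e] by simp
  qed
qed

lemma mult_plus_unit_of:
  assumes "e * e = e" "\<And>x. x \<in> S \<Longrightarrow> e * x = x \<and> x * e = x" "x \<in> S" "y \<in> S"
  shows "(x + cs_scale l e) * (y + cs_scale m e)
    = (x * y + cs_scale m x + cs_scale l y) + cs_scale (l * m) e"
  using assms by (simp add: cs_ring_simps)

text \<open>The adjoined unit is a parameter because in (b) the unit of the envelope is the
  projection \<open>\<pi> 1\<close>, which may differ from the ambient \<open>1\<close>.\<close>

lemma cstar_subalg_plus_unit_of:
  assumes S: "cstar_subalg S" and e: "e * e = e" "cs_adj e = e"
    and u: "\<And>x. x \<in> S \<Longrightarrow> e * x = x \<and> x * e = x"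
  shows "cstar_subalg (plus_unit_of S e)"
  unfolding cstar_subalg_def
proof (intro conjI ballI)
  show "csubspace (plus_unit_of S e)" using csubspace_plus_unit_of cstar_subalgD(1)[OF S] .
  show "closed (plus_unit_of S e)" using closed_plus_unit_of cstar_subalgD(1,2)[OF S] .
next
  fix x y assume "x \<in> plus_unit_of S e" "y \<in> plus_unit_of S e"
  then obtain a l b m where ab: "a \<in> S" "b \<in> S" "x = a + cs_scale l e" "y = b + cs_scale m e"
    by (metis plus_unit_ofE)
  then show "x * y \<in> plus_unit_of S e"
    using mult_plus_unit_of[of e S a b l m] e u cstar_subalg_ops[OF S] plus_unit_ofI by metis
next
  fix x assume "x \<in> plus_unit_of S e"
  then obtain a l where ab: "a \<in> S" "x = a + cs_scale l e"
    by (metis plus_unit_ofE)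
  then have "cs_adj x = cs_adj a + cs_scale (cnj l) e" using e by (simp add: cs_adj_simps)
  then show "cs_adj x \<in> plus_unit_of S e" using ab cstar_subalg_adj[OF S] plus_unit_ofI by metis
qed

lemma cstar_subalg_plus_unit: "cstar_subalg S \<Longrightarrow> cstar_subalg (plus_unit S)"
  unfolding plus_unit_eq by (rule cstar_subalg_plus_unit_of) auto

lemma abelian_plus_unit_of:
  assumes "abelian S" "\<And>x. x \<in> S \<Longrightarrow> e * x = x \<and> x * e = x"
  shows "abelian (plus_unit_of S e)"
  using assms by (auto simp: abelian_def plus_unit_of_def cs_ring_simps)

text \<open>Taking adjoints turns the left unit \<open>e\<close> into the right unit
  \<open>cs_adj e\<close>, and a left and a right unit coincide. Later contradictions with
  non-unitality can thus stop at a one-sided unit.\<close>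

lemma unital_algI:
  assumes S: "cstar_subalg S" and e: "e \<in> S" "\<And>x. x \<in> S \<Longrightarrow> e * x = x"
  shows "unital_alg S"
proof -
  have r: "x * cs_adj e = x" if "x \<in> S" for x
    using arg_cong[OF e(2)[OF cstar_subalg_adj[OF S that]], of cs_adj] by (simp add: cs_adj_simps)
  have "e = cs_adj e" using r[OF e(1)] e(2)[OF cstar_subalg_adj[OF S e(1)]] by simp
  then show ?thesis unfolding unital_alg_def using e r by metis
qed

lemma not_unital_imp_one_notin: "\<not> unital_alg S \<Longrightarrow> 1 \<notin> S"
  by (auto simp: unital_alg_def)

lemma unit_of_plus_unit: "0 \<in> S \<Longrightarrow> unit_of (plus_unit S) = 1"
proof -
  assume "0 \<in> S"
  then have 1: "1 \<in> plus_unit S" unfolding plus_unit_eq by (rule unit_in_plus_unit_of)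
  then have "unital_alg (plus_unit S)" unfolding unital_alg_def by force
  moreover have "(THE e. e \<in> plus_unit S \<and> (\<forall>x\<in>plus_unit S. e * x = x \<and> x * e = x)) = 1"
    using 1 by (intro the_equality) (simp, metis mult.right_neutral)
  ultimately show ?thesis by (simp add: unit_of_def)
qed

section \<open>Square roots and isometric homomorphisms\<close>

text \<open>The iteration $g \mapsto (x + g^2)/2$ is dominated in norm by the same iteration for $x = 1$,
  which converges; hence the boundary case \<open>norm x = 1\<close> is included.\<close>

lemma exists_one_minus_sqrt:
  fixes S :: "'a::cstar_algebra set"
  assumes S: "cstar_subalg S" and x: "x \<in> S" "cs_adj x = x" "norm x \<le> 1"
  shows "\<exists>g\<in>S. cs_adj g = g \<and> norm g \<le> 1 \<and> (1 - g) * (1 - g) = 1 - x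
    \<and> (\<forall>y. x * y = y * x \<longrightarrow> g * y = y * g)"
proof -
  define g where "g = rec_nat 0 (\<lambda>_ y. (1/2) *\<^sub>R (x + y * y))"
  define c where "c = rec_nat 0 (\<lambda>_ y::real. (1 + y * y) / 2)"
  have g0: "g 0 = 0" and gS: "g (Suc n) = (1/2) *\<^sub>R (x + g n * g n)" for n
    by (simp_all add: g_def)
  have c0: "c 0 = 0" and cS: "c (Suc n) = (1 + c n * c n) / 2" for n
    by (simp_all add: c_def)
  have c01: "0 \<le> c n \<and> c n \<le> 1" for n
    by (induction n) (auto simp: c0 cS mult_le_one)
  have ng: "norm (g n) \<le> c n" for n
  proof (induction n)
    case (Suc n)
    have "norm (x + g n * g n) \<le> norm x + norm (g n) * norm (g n)"
      using norm_triangle_ineq[of x "g n * g n"] norm_mult_ineq[of "g n" "g n"] by linarith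
    also have "\<dots> \<le> 1 + c n * c n"
      using x(3) Suc c01 by (intro add_mono mult_mono) auto
    finally show ?case by (simp add: gS cS)
  qed (simp add: g0 c0)
  \<comment> \<open>At \<open>norm x = 1\<close> the scalar iteration creeps up to its double fixed
    point \<open>1\<close>, so no geometric rate is available. Instead each increment of
    \<open>g\<close> is dominated by that of \<open>c\<close>; the latter telescope, and
    \<open>c\<close> converges because it is monotone and bounded.\<close>
  have dg: "norm (g (Suc n) - g n) \<le> c (Suc n) - c n" for n
  proof (induction n)
    case 0 show ?case using x(3) by (simp add: gS g0 cS c0)
  next
    case (Suc n)
    have "g (Suc (Suc n)) - g (Suc n)
        = (1/2) *\<^sub>R ((g (Suc n) - g n) * g (Suc n) + g n * (g (Suc n) - g n))"
      unfolding gS[of "Suc n"] by (simp add: gS[of n] algebra_simps)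
    also have "norm \<dots> \<le> (norm (g (Suc n) - g n) * norm (g (Suc n)) + norm (g n) * norm (g (Suc n) - g n)) / 2"
      using norm_triangle_ineq[of "(g (Suc n) - g n) * g (Suc n)" "g n * (g (Suc n) - g n)"]
        norm_mult_ineq[of "g (Suc n) - g n" "g (Suc n)"] norm_mult_ineq[of "g n" "g (Suc n) - g n"]
      unfolding norm_scaleR by simp
    also have "\<dots> \<le> ((c (Suc n) - c n) * c (Suc n) + c n * (c (Suc n) - c n)) / 2"
      using Suc ng c01 order_trans[OF norm_ge_zero Suc] by (intro divide_right_mono add_mono mult_mono) auto
    also have "\<dots> = c (Suc (Suc n)) - c (Suc n)"
      unfolding cS[of "Suc n"] by (simp add: cS[of n] field_simps)
    finally show ?case .
  qed
  have "c n \<le> c (Suc n)" for n using dg[of n] norm_ge_zero[of "g (Suc n) - g n"] by linarith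
  then have "incseq c" by (rule incseq_SucI)
  then obtain l where "c \<longlonglongrightarrow> l"
    using incseq_convergent[of c 1] c01 by blast
  then have Cc: "Cauchy c" by (rule LIMSEQ_imp_Cauchy)
  have dgm: "norm (g (n + k) - g n) \<le> c (n + k) - c n" for n k
  proof (induction k)
    case (Suc k)
    have "norm (g (n + Suc k) - g n) \<le> norm (g (Suc (n + k)) - g (n + k)) + norm (g (n + k) - g n)"
      using norm_triangle_ineq[of "g (Suc (n + k)) - g (n + k)" "g (n + k) - g n"] by simp
    then show ?case using Suc dg[of "n + k"] by simp
  qed simp
  have "Cauchy g"
  proof (rule metric_CauchyI)
    fix e :: real assume "e > 0"
    then obtain M where M: "\<And>m n. m \<ge> M \<Longrightarrow> n \<ge> M \<Longrightarrow> dist (c m) (c n) < e"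
      using metric_CauchyD[OF Cc] by blast
    have *: "dist (g m) (g n) < e" if "m \<ge> n" "n \<ge> M" for m n
      using dgm[of n "m - n"] M[of m n] that by (simp add: dist_norm)
    have "dist (g m) (g n) < e" if "m \<ge> M" "n \<ge> M" for m n
      using *[of m n] *[of n m] that by (metis dist_commute linear)
    then show "\<exists>M. \<forall>m\<ge>M. \<forall>n\<ge>M. dist (g m) (g n) < e" by blast
  qed
  then obtain G where G: "g \<longlonglongrightarrow> G" using Cauchy_convergent_iff convergent_def by blast
  have gin: "g n \<in> S" and gsa: "cs_adj (g n) = g n" for n
    by (induction n) (auto simp: g0 gS x cs_adj_simps cstar_subalg_ops[OF S])
  have comm: "g n * y = y * g n" if "x * y = y * x" for y n
  proof (induction n)
    case (Suc n)
    have "g n * g n * y = y * (g n * g n)" using Suc by (metis mult.assoc)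
    then show ?case using that by (simp add: gS algebra_simps)
  qed (simp add: g0)
  have "(\<lambda>n. g (Suc n)) \<longlonglongrightarrow> (1/2) *\<^sub>R (x + G * G)"
    unfolding gS by (intro tendsto_intros G)
  \<comment> \<open>The fixed point equation of the iteration is $(1 - G)^2 = 1 - x$
    rearranged.\<close>
  then have GG: "G = (1/2) *\<^sub>R (x + G * G)"
    using LIMSEQ_unique LIMSEQ_Suc[OF G] by blast
  have "G + G = (1/2) *\<^sub>R (x + G * G) + (1/2) *\<^sub>R (x + G * G)" using GG by simp
  also have "\<dots> = x + G * G" by (simp flip: scaleR_left_distrib)
  finally have "G + G = x + G * G" .
  then have "(1 - G) * (1 - G) = 1 - x" by (simp add: algebra_simps)
  moreover have "G \<in> S" by (rule closed_limit[OF cstar_subalg_closed[OF S] sequentially_bot _ G]) (simp add: gin)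
  moreover have "cs_adj G = G" using LIMSEQ_unique[OF tendsto_cs_adj[OF G, unfolded gsa] G] .
  moreover have "norm G \<le> 1"
    using Lim_norm_ubound[OF _ G, of 1] ng c01 by (metis (no_types, lifting) eventually_sequentiallyI order_trans sequentially_bot)
  moreover have "G * y = y * G" if "x * y = y * x" for y
    using LIMSEQ_unique[OF tendsto_mult_right[OF G, of y] ] tendsto_mult_left[OF G, of y] comm[OF that]
    by simp
  ultimately show ?thesis by (intro bexI[of _ G] conjI allI impI)
qed

text \<open>Here \<open>p\<close> is the real part of the multiple \<open>p + \<i> k\<close> of a unitary.\<close>

lemma norm_le_of_sum_squares:
  fixes p k :: "'a::cstar_algebra"
  assumes sa: "cs_adj p = p" "cs_adj k = k" and comm: "p * k = k * p"
    and eq: "p * p + k * k = scaleR (t\<^sup>2) 1" and t: "0 \<le> t"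
  shows "norm p \<le> t"
proof -
  define u where "u = p + cs_scale \<i> k"
  have ua: "cs_adj u = p - cs_scale \<i> k" by (simp add: u_def cs_adj_simps sa)
  have "cs_adj u * u = p * p + k * k" by (simp add: ua) (simp add: u_def cs_ring_simps comm)
  then have "(norm u)\<^sup>2 = t\<^sup>2" using eq cstar_identity[of u] by simp
  then have nu: "norm u = t" using t by (simp add: power2_eq_iff_nonneg)
  have "p + p = u + cs_adj u" by (simp add: ua) (simp add: u_def)
  then have "2 *\<^sub>R p = u + cs_adj u" by (simp add: scaleR_2)
  then have "2 * norm p = norm (u + cs_adj u)" by (metis norm_scaleR abs_numeral)
  then show ?thesis using norm_triangle_ineq[of u "cs_adj u"] nu by simp
qed

lemma cstar_subalg_UNIV: "cstar_subalg UNIV"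
  by (auto simp: cstar_subalg_def csubspace_def)

text \<open>With $1 - p^2 = (1 - g)^2$ and \<open>g\<close> commuting with \<open>p\<close>, the
  relation $(1 - g)^2 + p^2 = 1$ makes \<open>1 - g\<close> the real part of a unitary with
  imaginary part \<open>p\<close>. The triangle inequality alone would only give the bound
  2.\<close>

lemma norm_one_minus_square:
  fixes p :: "'a::cstar_algebra"
  assumes "cs_adj p = p" "norm p \<le> 1"
  shows "norm (1 - p * p) \<le> 1"
proof -
  have n: "norm (p * p) \<le> 1"
    using norm_mult_ineq[of p p] mult_le_one[of "norm p" "norm p"] assms by simp
  have sa: "cs_adj (p * p) = p * p" using assms by (simp add: cs_adj_mult)
  obtain g where g: "cs_adj g = g" "(1 - g) * (1 - g) = 1 - p * p"
      and gc: "\<forall>y. p * p * y = y * (p * p) \<longrightarrow> g * y = y * g"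
    using exists_one_minus_sqrt[OF cstar_subalg_UNIV UNIV_I sa n] by (elim bexE conjE) (rule that, assumption+)
  note g = g gc[rule_format]
  have gp: "g * p = p * g" by (rule g(3)) (simp add: mult.assoc)
  have "norm (1 - g) \<le> 1"
    by (rule norm_le_of_sum_squares[of _ p])
      (use g(1,2) gp assms in \<open>auto simp: cs_adj_simps algebra_simps\<close>)
  then show ?thesis
    using norm_mult_ineq[of "1 - g" "1 - g"] mult_le_one[of "norm (1-g)" "norm (1-g)"] g by simp
qed

section \<open>Homomorphisms: contractivity, and isometry in the injective case\<close>

lemma star_homD:
  assumes "star_hom C \<alpha> A"
  shows star_hom_mem: "\<And>x. x \<in> C \<Longrightarrow> \<alpha> x \<in> A"
    and star_hom_add: "\<And>x y. x \<in> C \<Longrightarrow> y \<in> C \<Longrightarrow> \<alpha> (x + y) = \<alpha> x + \<alpha> y"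
    and star_hom_mult: "\<And>x y. x \<in> C \<Longrightarrow> y \<in> C \<Longrightarrow> \<alpha> (x * y) = \<alpha> x * \<alpha> y"
    and star_hom_scale: "\<And>a x. x \<in> C \<Longrightarrow> \<alpha> (cs_scale a x) = cs_scale a (\<alpha> x)"
    and star_hom_adj: "\<And>x. x \<in> C \<Longrightarrow> \<alpha> (cs_adj x) = cs_adj (\<alpha> x)"
    and star_hom_scaleR: "\<And>r x. x \<in> C \<Longrightarrow> \<alpha> (scaleR r x) = scaleR r (\<alpha> x)"
    and star_hom_minus: "\<And>x. x \<in> C \<Longrightarrow> \<alpha> (- x) = - \<alpha> x"
proof -
  show scale: "\<alpha> (cs_scale a x) = cs_scale a (\<alpha> x)" if "x \<in> C" for a x
    using assms that by (simp add: star_hom_def)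
  show "\<alpha> (scaleR r x) = scaleR r (\<alpha> x)" "\<alpha> (- x) = - \<alpha> x" if "x \<in> C" for r x
    using scale[OF that, of "complex_of_real r"] scale[OF that, of "-1"] by (simp_all add: cs_scale_real)
qed (use assms in \<open>auto simp: star_hom_def\<close>)

lemma star_hom_diff:
  "star_hom C \<alpha> A \<Longrightarrow> cstar_subalg C \<Longrightarrow> x \<in> C \<Longrightarrow> y \<in> C \<Longrightarrow> \<alpha> (x - y) = \<alpha> x - \<alpha> y"
  using star_hom_add[of C \<alpha> A x "-y"] by (simp add: star_hom_minus cstar_subalg_minus)

lemma star_hom_0: "star_hom C \<alpha> A \<Longrightarrow> cstar_subalg C \<Longrightarrow> \<alpha> 0 = 0"
  using star_hom_scale[of C \<alpha> A 0 0] cstar_subalg_0 by fastforce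

text \<open>For a self-adjoint contraction \<open>p\<close> the image \<open>\<alpha> p\<close>
  becomes the real part of a unitary with imaginary part \<open>1 - \<alpha> g\<close>, where $(1 -
  g)^2 = 1 - p^2$. Since \<open>C\<close> may lack the unit, the relation is transported in its
  unit-free form $p^2 + g^2 = 2 g$. The C*-identity reduces general \<open>x\<close> to this
  case.\<close>

lemma norm_star_hom_le:
  assumes C: "cstar_subalg C" and h: "star_hom C \<alpha> A" and x: "x \<in> C"
  shows "norm (\<alpha> x) \<le> norm x"
proof -
  note [simp] = cstar_subalg_ops[OF C] star_homD(2-)[OF h]
  have unit: "norm (\<alpha> p) \<le> 1" if p: "p \<in> C" "cs_adj p = p" "norm p \<le> 1" for p
  proof -
    have n: "norm (p * p) \<le> 1"
      using norm_mult_ineq[of p p] mult_le_one[of "norm p" "norm p"] p by simp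
    have pp: "p * p \<in> C" "cs_adj (p * p) = p * p" using p by (simp_all add: cs_adj_mult)
    obtain g where g: "g \<in> C" "cs_adj g = g" "(1 - g) * (1 - g) = 1 - p * p"
        and gc: "\<forall>y. p * p * y = y * (p * p) \<longrightarrow> g * y = y * g"
      using exists_one_minus_sqrt[OF C pp n] by (elim bexE conjE) (rule that, assumption+)
    note g = g gc[rule_format]
    have "p * p + g * g = g + g" using g(3) by (simp add: algebra_simps)
    from arg_cong[OF this, of \<alpha>] have e: "\<alpha> p * \<alpha> p + \<alpha> g * \<alpha> g = \<alpha> g + \<alpha> g"
      using p(1) g(1) by simp
    have "g * p = p * g" by (rule g(4)) (simp add: mult.assoc)
    from arg_cong[OF this, of \<alpha>] have c: "\<alpha> g * \<alpha> p = \<alpha> p * \<alpha> g" using p(1) g(1) by simp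
    have sa: "cs_adj (\<alpha> p) = \<alpha> p" "cs_adj (\<alpha> g) = \<alpha> g"
      using star_hom_adj[OF h] p g by metis+
    show ?thesis
      by (rule norm_le_of_sum_squares[of _ "1 - \<alpha> g"])
        (use e c sa in \<open>auto simp: cs_adj_simps algebra_simps\<close>)
  qed
  have sa: "norm (\<alpha> p) \<le> norm p" if p: "p \<in> C" "cs_adj p = p" for p
  proof (cases "p = 0")
    case False
    have "norm (\<alpha> (inverse (norm p) *\<^sub>R p)) \<le> 1"
      using p False by (intro unit) (auto simp: cs_adj_simps)
    then show ?thesis using p False by (simp add: field_simps)
  qed (simp add: star_hom_0[OF h C])
  have "(norm (\<alpha> x))\<^sup>2 = norm (\<alpha> (cs_adj x * x))" using x by (simp add: cstar_identity)
  also have "\<dots> \<le> norm (cs_adj x * x)" using x by (intro sa) (auto simp: cs_adj_simps)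
  finally show ?thesis using cstar_identity[of x] by (simp add: power2_le_iff_abs_le)
qed

text \<open>Modulo \<open>S\<close> the element \<open>w\<close> is a scalar \<open>l\<close> and
  its square is \<open>l * l\<close>, which has to vanish. In this way roots that were computed in
  the unitization fall back into \<open>S\<close>.\<close>

lemma mem_of_square_mem_plus_unit:
  assumes S: "cstar_subalg S" and w: "w \<in> plus_unit S" "w * w \<in> S"
  shows "w \<in> S"
proof (cases "1 \<in> S")
  case True
  then show ?thesis using w cstar_subalg_ops[OF S] by (auto simp: plus_unit_def)
next
  case False
  obtain s l where s: "s \<in> S" "w = s + cs_scale l 1" using w by (auto simp: plus_unit_def)
  have "w * w = (s * s + cs_scale l s + cs_scale l s) + cs_scale (l * l) 1"
    unfolding s(2) by (rule mult_plus_unit_of[of 1 S]) (use s in auto)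
  then have "l * l = 0"
    using plus_unit_of_mem_iff[OF cstar_subalg_csubspace[OF S] False] w s cstar_subalg_ops[OF S] by metis
  then show ?thesis using s by simp
qed

text \<open>Here \<open>w * w\<close> is the absolute value of \<open>k\<close>:
  \<open>1 - g\<close> is a root of \<open>k * k\<close>, and \<open>1 - f\<close> is a root of
  \<open>1 - g\<close>. Writing the absolute value as a square of a self-adjoint element records its
  positivity without an order relation.\<close>

lemma exists_fourth_root_of_square:
  assumes S: "cstar_subalg S" and k: "k \<in> S" "cs_adj k = k" "norm k \<le> 1"
  obtains w where "w \<in> S" "cs_adj w = w" "(w * w) * (w * w) = k * k"
    "\<And>y. k * y = y * k \<Longrightarrow> w * y = y * w"
proof -
  note S' = cstar_subalg_plus_unit[OF S]
  have 1: "1 \<in> plus_unit S" and sub: "S \<subseteq> plus_unit S"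
    unfolding plus_unit_eq using unit_in_plus_unit_of cstar_subalg_0[OF S] subset_plus_unit_of by blast+
  have "1 - k * k \<in> plus_unit S" using 1 sub k by (auto intro!: cstar_subalg_ops[OF S'])
  moreover have "cs_adj (1 - k * k) = 1 - k * k" using k by (simp add: cs_adj_simps)
  moreover have "norm (1 - k * k) \<le> 1" using norm_one_minus_square k by blast
  ultimately obtain g where g: "g \<in> plus_unit S" "cs_adj g = g" "norm g \<le> 1"
      "(1 - g) * (1 - g) = 1 - (1 - k * k)" "\<And>y. (1 - k * k) * y = y * (1 - k * k) \<Longrightarrow> g * y = y * g"
    using exists_one_minus_sqrt[OF S'] by blast
  obtain f where f: "f \<in> plus_unit S" "cs_adj f = f"
      "(1 - f) * (1 - f) = 1 - g" "\<And>y. g * y = y * g \<Longrightarrow> f * y = y * f"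
    using exists_one_minus_sqrt[OF S' g(1,2,3)] by blast
  define w where "w = 1 - f"
  have w: "w \<in> plus_unit S" "w * w \<in> plus_unit S" "w * w = 1 - g"
    using f 1 g(1) by (auto simp: w_def intro: cstar_subalg_ops[OF S'])
  have w4: "(w * w) * (w * w) = k * k" using w g by simp
  have "w \<in> S"
    using mem_of_square_mem_plus_unit[OF S w(2)] mem_of_square_mem_plus_unit[OF S w(1)] w4
      cstar_subalg_mult[OF S] k by simp
  moreover have "cs_adj w = w" using f by (simp add: w_def cs_adj_simps)
  moreover have "w * y = y * w" if "k * y = y * k" for y
  proof -
    have "k * k * y = y * (k * k)" using that by (metis mult.assoc)
    then have "f * y = y * f" by (intro f g) (simp add: algebra_simps)
    then show ?thesis by (simp add: w_def algebra_simps)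
  qed
  ultimately show ?thesis using that w4 by blast
qed

lemma sum_squares_eq_0:
  fixes x y :: "'a::cstar_algebra"
  assumes sa: "cs_adj x = x" "cs_adj y = y" and comm: "x * y = y * x" and eq: "x * x + y * y = 0"
  shows "x = 0"
  using norm_le_of_sum_squares[OF sa comm, of 0] eq by simp

text \<open>The difference \<open>d\<close> of the two squares annihilates their sum. Multiplied by
  \<open>d\<close> once more, this is a vanishing sum of the squares of the commuting self-adjoint
  elements \<open>v * d\<close> and \<open>w * d\<close>, so both are \<open>0\<close>, and with
  them \<open>d * d\<close>. This serves as uniqueness of positive square roots, with squares in
  place of positive elements.\<close>

lemma square_unique:
  fixes v w :: "'a::cstar_algebra"
  assumes sa: "cs_adj v = v" "cs_adj w = w" and comm: "v * w = w * v"
    and eq: "(v * v) * (v * v) = (w * w) * (w * w)"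
  shows "v * v = w * w"
proof -
  define d where "d = v * v - w * w"
  have "v * (w * w) = w * w * v" "w * (v * v) = v * v * w" using comm by (metis mult.assoc)+
  then have vd: "v * d = d * v" and wd: "w * d = d * w"
    unfolding d_def by (simp_all add: left_diff_distrib right_diff_distrib mult.assoc)
  have "v * v * (w * w) = w * w * (v * v)" using comm by (metis mult.assoc)
  then have 0: "d * (v * v + w * w) = 0" using eq by (simp add: d_def algebra_simps)
  have "(v * d) * (v * d) + (w * d) * (w * d) = d * (v * v + w * w) * d"
    using vd wd by (simp add: algebra_simps)
  then have 1: "(v * d) * (v * d) + (w * d) * (w * d) = 0" using 0 by simp
  have dsa: "cs_adj d = d" by (simp add: d_def cs_adj_simps sa)
  have adj: "cs_adj (v * d) = v * d" "cs_adj (w * d) = w * d"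
    using sa dsa vd wd by (simp_all add: cs_adj_simps)
  have c: "(v * d) * (w * d) = (w * d) * (v * d)"
    using vd wd comm by (metis mult.assoc)
  have "v * d = 0" by (rule sum_squares_eq_0[OF adj c 1])
  moreover have "w * d = 0"
    by (rule sum_squares_eq_0[OF adj(2,1) c[symmetric]]) (use 1 in \<open>simp add: add.commute\<close>)
  moreover have "d * d = v * (v * d) - w * (w * d)"
    by (metis d_def left_diff_distrib mult.assoc)
  ultimately have "d * d = 0" by simp
  then have "d = 0" using cs_adj_mult_eq_0[of d] dsa by simp
  then show ?thesis by (simp add: d_def)
qed

text \<open>If \<open>norm (\<alpha> p) \<le> r\<close>, then $k = p^4 - r^2 p^2$ has negative image, so $|k| + k$ is mapped to \<open>0\<close>
  and $k = -|k|$ is negative, which bounds \<open>p\<close>.\<close>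

lemma norm_star_hom:
  assumes C: "cstar_subalg C" and h: "star_hom C \<alpha> A" and inj: "inj_on \<alpha> C" and x: "x \<in> C"
  shows "norm (\<alpha> x) = norm x"
proof -
  note [simp] = cstar_subalg_ops[OF C] star_homD(2-)[OF h] star_hom_diff[OF h C]
  have unit: "norm p \<le> norm (\<alpha> p)" if p: "p \<in> C" "cs_adj p = p" "norm p \<le> 1" for p
  proof -
    define r where "r = norm (\<alpha> p)"
    have r: "0 \<le> r" "r \<le> 1" using norm_star_hom_le[OF C h p(1)] p(3) by (auto simp: r_def)
    \<comment> \<open>The factor 1/2 makes \<open>k\<close> a contraction, as the fourth root
      requires.\<close>
    define k where "k = (1/2) *\<^sub>R ((p * p) * (p * p) - r\<^sup>2 *\<^sub>R (p * p))"
    have kC: "k \<in> C" and ksa: "cs_adj k = k" using p by (auto simp: k_def cs_adj_simps)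
    have npp: "norm (p * p) \<le> 1"
      using norm_mult_ineq[of p p] mult_le_one[of "norm p" "norm p"] p by simp
    have nk: "norm k \<le> 1"
    proof -
      have "norm ((p * p) * (p * p)) \<le> 1"
        using norm_mult_ineq[of "p*p" "p*p"] mult_le_one[of "norm (p*p)" "norm (p*p)"] npp by simp
      moreover have "norm (r\<^sup>2 *\<^sub>R (p * p)) \<le> 1"
        using npp r by (simp add: mult_le_one power_le_one)
      ultimately show ?thesis
        using norm_triangle_ineq4[of "(p * p) * (p * p)" "r\<^sup>2 *\<^sub>R (p * p)"] by (simp add: k_def)
    qed
    obtain w where w: "w \<in> C" "cs_adj w = w" "(w * w) * (w * w) = k * k"
        "\<And>y. k * y = y * k \<Longrightarrow> w * y = y * w"
      using exists_fourth_root_of_square[OF C kC ksa nk] by metis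
    have wp: "w * p = p * w" by (rule w(4)) (simp add: k_def algebra_simps)
    define q where "q = \<alpha> p"
    have qsa: "cs_adj q = q" using star_hom_adj[OF h p(1)] p(2) by (simp add: q_def)
    have ak: "\<alpha> k = (1/2) *\<^sub>R ((q * q) * (q * q) - r\<^sup>2 *\<^sub>R (q * q))"
      using p by (simp add: k_def q_def)
    \<comment> \<open>A self-adjoint root \<open>v\<close> of \<open>- \<alpha> k\<close> certifies
      that \<open>\<alpha> k\<close> is negative. It is read off from $(r^2 q^2 - q^4)/2 = (r^2/2)
      q^2 (1 - q^2/r^2)$ by taking a root of the last factor; this explains the constant
      \<open>r / sqrt 2\<close> below.\<close>
    obtain v where v: "cs_adj v = v" "v * v = - \<alpha> k" "\<And>y. y * q = q * y \<Longrightarrow> v * y = y * v"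
    proof (cases "r = 0")
      case True
      then have "q = 0" by (simp add: r_def q_def)
      then show ?thesis using that[of 0] ak by simp
    next
      case False
      define q1 where "q1 = inverse r *\<^sub>R q"
      have nq: "norm (q1 * q1) \<le> 1"
        using norm_mult_ineq[of "q1" q1] False r by (simp add: q1_def r_def q_def)
      have sa: "cs_adj (q1 * q1) = q1 * q1" by (simp add: q1_def cs_adj_simps qsa)
      obtain g where g: "cs_adj g = g" "(1 - g) * (1 - g) = 1 - q1 * q1"
          and gc: "\<forall>y. q1 * q1 * y = y * (q1 * q1) \<longrightarrow> g * y = y * g"
        using exists_one_minus_sqrt[OF cstar_subalg_UNIV UNIV_I sa nq] by (elim bexE conjE) (rule that, assumption+)
      note g = g gc[rule_format]
      have gy: "g * y = y * g" if "y * q = q * y" for y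
      proof (rule g(3))
        have "q * q * y = y * (q * q)" using that by (metis mult.assoc)
        then show "q1 * q1 * y = y * (q1 * q1)" by (simp add: q1_def)
      qed
      define v where "v = (r / sqrt 2) *\<^sub>R (q * (1 - g))"
      have gq: "g * q = q * g" by (rule gy) simp
      have "v * v = (r\<^sup>2 / 2) *\<^sub>R ((q * (1 - g)) * (q * (1 - g)))"
        by (simp add: v_def power2_eq_square)
      also have "(q * (1 - g)) * (q * (1 - g)) = (q * q) * ((1 - g) * (1 - g))"
      proof -
        have "(1 - g) * q = q * (1 - g)" using gq by (simp add: algebra_simps)
        then show ?thesis by (metis mult.assoc)
      qed
      also have "\<dots> = q * q - (q * q) * (q1 * q1)" by (simp only: g(2)) (simp add: right_diff_distrib)
      also have "\<dots> = q * q - inverse (r\<^sup>2) *\<^sub>R ((q * q) * (q * q))"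
        by (simp add: q1_def power2_eq_square)
      also have "(r\<^sup>2 / 2) *\<^sub>R \<dots> = - \<alpha> k"
        unfolding ak using False by (simp add: algebra_simps)
      finally have "v * v = - \<alpha> k" .
      moreover have "cs_adj v = v" using gq by (simp add: v_def cs_adj_simps qsa g(1) algebra_simps)
      moreover have "v * y = y * v" if "y * q = q * y" for y
        using gy[OF that] that by (simp add: v_def algebra_simps) (metis mult.assoc)
      ultimately show ?thesis using that by blast
    qed
    have "v * \<alpha> w = \<alpha> w * v"
      using arg_cong[OF wp, of \<alpha>] w(1) p(1) by (intro v(3)) (simp add: q_def)
    moreover have "(v * v) * (v * v) = (\<alpha> w * \<alpha> w) * (\<alpha> w * \<alpha> w)"
      using arg_cong[OF w(3), of \<alpha>] w(1) kC by (simp add: v(2))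
    \<comment> \<open>Both \<open>v * v\<close> and the image of \<open>w * w\<close> are positive
      roots of the square of \<open>\<alpha> k\<close>, hence equal; injectivity then carries
      \<open>w * w = - k\<close> back to \<open>C\<close>.\<close>
    ultimately have "v * v = \<alpha> w * \<alpha> w"
      using square_unique[of v "\<alpha> w"] v(1) star_hom_adj[OF h w(1)] w(2) by simp
    then have "\<alpha> (w * w) = \<alpha> (- k)" using v(2) w(1) kC by simp
    then have wk: "w * w = - k" by (rule inj_onD[OF inj]) (use w(1) kC in simp_all)
    \<comment> \<open>Completing the square turns \<open>w * w = - k\<close> into $(p^2 - r^2/2)^2 +
      2 w^2 = (r^2/2)^2$, which has the shape required for the real part of a multiple of a
      unitary.\<close>
    have "norm (p * p - (r\<^sup>2 / 2) *\<^sub>R 1) \<le> r\<^sup>2 / 2"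
    proof (rule norm_le_of_sum_squares)
      show "(p * p - (r\<^sup>2 / 2) *\<^sub>R 1) * (p * p - (r\<^sup>2 / 2) *\<^sub>R 1) + (sqrt 2 *\<^sub>R w) * (sqrt 2 *\<^sub>R w)
        = ((r\<^sup>2 / 2)\<^sup>2) *\<^sub>R 1"
        by (simp add: wk k_def algebra_simps power2_eq_square flip: scaleR_left_distrib)
      show "(p * p - (r\<^sup>2 / 2) *\<^sub>R 1) * sqrt 2 *\<^sub>R w = sqrt 2 *\<^sub>R w * (p * p - (r\<^sup>2 / 2) *\<^sub>R 1)"
        using wp by (simp add: algebra_simps) (metis mult.assoc)
    qed (use p w(1,2) in \<open>auto simp: cs_adj_simps\<close>)
    then have "norm (p * p) \<le> r\<^sup>2"
      using norm_triangle_ineq[of "p * p - (r\<^sup>2 / 2) *\<^sub>R 1" "(r\<^sup>2 / 2) *\<^sub>R 1"] by simp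
    then show ?thesis
      using cstar_identity[of p] p r(1) unfolding r_def by (simp add: power2_le_iff_abs_le)
  qed
  have sa: "norm p \<le> norm (\<alpha> p)" if p: "p \<in> C" "cs_adj p = p" for p
  proof (cases "p = 0")
    case False
    have "norm (inverse (norm p) *\<^sub>R p) \<le> norm (\<alpha> (inverse (norm p) *\<^sub>R p))"
      using p False by (intro unit) (auto simp: cs_adj_simps)
    then show ?thesis using p False by (simp add: field_simps)
  qed simp
  have "(norm x)\<^sup>2 = norm (cs_adj x * x)" by (simp add: cstar_identity)
  also have "\<dots> \<le> norm (\<alpha> (cs_adj x * x))" using x by (intro sa) (auto simp: cs_adj_simps)
  also have "\<dots> = (norm (\<alpha> x))\<^sup>2" using x by (simp add: cstar_identity)
  finally show ?thesis using norm_star_hom_le[OF C h x] by (simp add: power2_le_iff_abs_le)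
qed

text \<open>An isometry pulls Cauchy sequences back. The smaller set \<open>D\<close> is allowed
  because the image of the abelian subalgebra is the one whose closedness is needed.\<close>

lemma closed_star_hom_image:
  assumes C: "cstar_subalg C" and h: "star_hom C \<alpha> A" and inj: "inj_on \<alpha> C" and D: "closed D" "D \<subseteq> C"
  shows "closed (\<alpha> ` D)"
  unfolding closed_sequential_limits
proof (intro allI impI, elim conjE)
  fix y z assume y: "\<forall>n. y n \<in> \<alpha> ` D" and lim: "y \<longlonglongrightarrow> z"
  have "\<forall>n. \<exists>x. x \<in> D \<and> y n = \<alpha> x" using y by blast
  then obtain x where x: "\<And>n. x n \<in> D" "\<And>n. y n = \<alpha> (x n)" by metis
  have xC: "x n \<in> C" for n using x D by blast
  have iso: "dist (\<alpha> a) (\<alpha> b) = dist a b" if "a \<in> C" "b \<in> C" for a b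
    using norm_star_hom[OF C h inj, of "a - b"] that
    by (simp add: dist_norm star_hom_diff[OF h C] cstar_subalg_diff[OF C])
  have "Cauchy y" using lim by (rule LIMSEQ_imp_Cauchy)
  then have "Cauchy x" unfolding Cauchy_def x(2) using iso xC by simp
  then obtain l where l: "x \<longlonglongrightarrow> l" using Cauchy_convergent_iff convergent_def by blast
  then have lD: "l \<in> D" using D x closed_sequential_limits by blast
  have "(\<lambda>n. dist (y n) (\<alpha> l)) \<longlonglongrightarrow> 0"
    using l xC lD D iso by (simp add: x(2) subset_iff tendsto_dist_iff[of x])
  then have "y \<longlonglongrightarrow> \<alpha> l" by (simp add: tendsto_dist_iff[of y])
  then show "z \<in> \<alpha> ` D" using lim lD LIMSEQ_unique by blast
qed

section \<open>Norms on the unitization\<close>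

text \<open>The series of $(1 - c)^n c$ converges in \<open>S\<close>, and its partial sums
  telescope to $1 - (1 - c)^n$, which acts as the identity on \<open>S\<close> in the limit. The
  hypothesis bounds only the action of \<open>1 - c\<close> on \<open>S\<close>, so convergence is
  measured on elements of \<open>S\<close>.\<close>

lemma exists_left_unit_of_contraction:
  fixes S :: "'a::cstar_algebra set"
  assumes S: "cstar_subalg S" and c: "c \<in> S" and r: "0 \<le> r" "r < 1"
    and b: "\<And>a. a \<in> S \<Longrightarrow> norm ((1 - c) * a) \<le> r * norm a"
  shows "unital_alg S"
proof -
  define f where "f = (\<lambda>n. (1 - c)^n * c)"
  have pow: "(1 - c)^n * a \<in> S \<and> norm ((1 - c)^n * a) \<le> r^n * norm a" if a: "a \<in> S" for n a
  proof (induction n)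
    case (Suc n)
    let ?y = "(1 - c)^n * a"
    have e: "(1 - c)^Suc n * a = (1 - c) * ?y" by (simp add: mult.assoc)
    also have "\<dots> = ?y - c * ?y" by (simp add: algebra_simps)
    finally have "(1 - c)^Suc n * a \<in> S" using Suc c cstar_subalg_ops[OF S] by metis
    moreover have "norm ((1 - c) * ?y) \<le> r * (r^n * norm a)"
      using b[of ?y] Suc r by (meson mult_left_mono order_trans)
    ultimately show ?case using e by (simp add: mult.assoc)
  qed (use a in simp)
  have sumr: "summable (\<lambda>n. r^n * norm c)"
    using r by (intro summable_mult2 summable_geometric) simp
  have sf: "summable f"
    by (rule summable_comparison_test'[OF sumr, of 0]) (use pow[OF c] in \<open>simp add: f_def\<close>)
  define e where "e = suminf f"
  have ps: "(\<Sum>i<n. f i) = 1 - (1 - c)^n" for n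
  proof (induction n)
    case (Suc n)
    have "(1 - c)^n * c = c * (1 - c)^n" by (rule power_commuting_commutes) (simp add: algebra_simps)
    then show ?case using Suc by (simp add: f_def algebra_simps)
  qed simp
  have lim: "(\<lambda>n. 1 - (1 - c)^n) \<longlonglongrightarrow> e"
    using summable_LIMSEQ[OF sf] by (simp add: ps e_def)
  have "(\<Sum>i<n. f i) \<in> S" for n
    by (induction n) (use pow[OF c] cstar_subalg_ops[OF S] in \<open>auto simp: f_def\<close>)
  then have eS: "e \<in> S"
    unfolding e_def
    by (intro closed_limit[OF cstar_subalg_closed[OF S] sequentially_bot _ summable_LIMSEQ[OF sf]]) simp
  have "e * a = a" if a: "a \<in> S" for a
  proof -
    have "(\<lambda>n. (1 - c)^n * a) \<longlonglongrightarrow> 0"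
    proof (rule Lim_null_comparison)
      show "\<forall>\<^sub>F n in sequentially. norm ((1 - c)^n * a) \<le> r^n * norm a" using pow[OF a] by simp
      show "(\<lambda>n. r^n * norm a) \<longlonglongrightarrow> 0"
        using r by (intro tendsto_mult_left_zero LIMSEQ_power_zero) simp
    qed
    then have "(\<lambda>n. a - (1 - c)^n * a) \<longlonglongrightarrow> a - 0" by (intro tendsto_intros)
    then have "(\<lambda>n. (1 - (1 - c)^n) * a) \<longlonglongrightarrow> a" by (simp add: algebra_simps)
    then show ?thesis using LIMSEQ_unique tendsto_mult_right[OF lim, of a] by blast
  qed
  then show ?thesis using unital_algI[OF S eS] by blast
qed

lemma mult_plus_unit_mem:
  assumes "cstar_subalg S" "y \<in> plus_unit S" "a \<in> S"
  shows "y * a \<in> S" "a * y \<in> S"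
  using assms by (auto simp: plus_unit_def cs_ring_simps cstar_subalg_ops)

text \<open>The C*-identity squares the norm at each doubling of the exponent.\<close>

lemma norm_self_adjoint_power2:
  fixes h :: "'a::cstar_algebra"
  assumes "cs_adj h = h"
  shows "norm (h ^ (2 ^ m)) = norm h ^ (2 ^ m)"
proof (induction m)
  case (Suc m)
  have sa: "cs_adj (h ^ n) = h ^ n" for n
    by (induction n) (simp_all add: assms cs_adj_mult power_commutes)
  have "norm (h ^ (2 ^ Suc m)) = norm (cs_adj (h ^ 2 ^ m) * h ^ 2 ^ m)"
    by (simp add: sa mult_2 power_add)
  then show ?case using Suc by (simp add: cstar_identity mult_2 power_add power2_eq_square)
qed simp

text \<open>For self-adjoint $h = c + \lambda$ with $N = \|h\| > M$, the powers of \<open>h\<close> satisfy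
  $N^n = \|h^{n-1} c + \lambda h^{n-1}\| \le M^{n-1} \|c\| + M N^{n-1}$ for arbitrarily large \<open>n\<close>.\<close>

lemma norm_plus_unit_le:
  fixes S :: "'a::cstar_algebra set"
  assumes S: "cstar_subalg S" and nu: "\<not> unital_alg S" and y: "y \<in> plus_unit S" and M: "0 \<le> M"
    and b: "\<And>a. a \<in> S \<Longrightarrow> norm (y * a) \<le> M * norm a"
  shows "norm y \<le> M"
proof -
  have sa: "norm h \<le> M"
    if h: "h \<in> plus_unit S" "cs_adj h = h" and M: "0 \<le> M"
      and b: "\<And>a. a \<in> S \<Longrightarrow> norm (h * a) \<le> M * norm a" for h M
  proof (rule ccontr)
    assume "\<not> norm h \<le> M"
    then have N: "norm h > M" by simp
    obtain c l where c: "c \<in> S" "h = c + cs_scale l 1" using h by (auto simp: plus_unit_def)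
    \<comment> \<open>If the scalar part exceeded \<open>M\<close>, then \<open>h\<close> divided by
      \<open>l\<close> would have the form \<open>1 - c'\<close> and shrink \<open>S\<close>
      strictly, which would give \<open>S\<close> a unit.\<close>
    have l: "cmod l \<le> M"
    proof (rule ccontr)
      assume "\<not> cmod l \<le> M"
      then have l: "cmod l > M" by simp
      then have l0: "l \<noteq> 0" using M by auto
      define c' where "c' = - cs_scale (inverse l) c"
      have e: "1 - c' = cs_scale (inverse l) h"
        using l0 by (simp add: c'_def c cs_ring_simps)
      have "unital_alg S"
      proof (rule exists_left_unit_of_contraction[OF S])
        show "c' \<in> S" using c by (simp add: c'_def cstar_subalg_ops[OF S])
        show "0 \<le> M / cmod l" "M / cmod l < 1" using M l by (simp_all add: divide_less_eq)
        show "norm ((1 - c') * a) \<le> M / cmod l * norm a" if "a \<in> S" for a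
          using b[OF that] by (simp add: e cs_scale_mult_left norm_cs_scale norm_inverse norm_divide divide_simps)
      qed
      then show False using nu by simp
    qed
    have pow: "h^n * c \<in> S \<and> norm (h^n * c) \<le> M^n * norm c" for n
    proof (induction n)
      case (Suc n)
      have e: "h^Suc n * c = h * (h^n * c)" by (simp add: mult.assoc)
      have "norm (h * (h^n * c)) \<le> M * (M^n * norm c)"
        using b[of "h^n * c"] Suc M by (meson mult_left_mono order_trans)
      then show ?case using e mult_plus_unit_mem[OF S h(1)] Suc by (simp add: mult.assoc)
    qed (use c in simp)
    have "(\<lambda>n. (M / norm h) ^ n * norm c) \<longlonglongrightarrow> 0"
      using N M by (intro tendsto_mult_left_zero LIMSEQ_power_zero) (auto simp: divide_simps)
    then have "\<forall>\<^sub>F n in sequentially. (M / norm h) ^ n * norm c < norm h - M"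
      using N by (intro order_tendstoD) auto
    then obtain m where m: "\<And>n. n \<ge> m \<Longrightarrow> (M / norm h) ^ n * norm c < norm h - M"
      by (auto simp: eventually_sequentially)
    \<comment> \<open>The exponent \<open>Suc n\<close> must be a power of two for the norm of the
      power to be known, while \<open>n\<close> must be at least \<open>m\<close> for the limit
      estimate.\<close>
    define n where "n = 2 ^ m - (1::nat)"
    have "m < 2 ^ m" by (rule less_exp)
    then have n: "Suc n = 2 ^ m" "n \<ge> m" unfolding n_def by linarith+
    have "h ^ Suc n = h^n * c + cs_scale l (h^n)"
      unfolding power_Suc2 c(2) by (simp add: cs_ring_simps)
    then have "norm h ^ Suc n \<le> norm (h^n * c) + cmod l * norm (h^n)"
      using norm_self_adjoint_power2[OF h(2), of m] norm_triangle_ineq[of "h^n * c" "cs_scale l (h^n)"]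
      unfolding n(1)[symmetric] by (simp add: norm_cs_scale)
    also have "\<dots> \<le> M^n * norm c + M * norm h ^ n"
      using pow l norm_power_ineq[of h n] M by (intro add_mono mult_mono) auto
    finally have "norm h ^ n * (norm h - M) \<le> M^n * norm c" by (simp add: algebra_simps)
    moreover have "0 < norm h ^ n" using N M by (intro zero_less_power) linarith
    ultimately have "norm h - M \<le> (M^n * norm c) / norm h ^ n"
      by (simp only: pos_le_divide_eq mult.commute)
    also have "\<dots> = (M / norm h) ^ n * norm c" by (simp add: power_divide)
    finally have "norm h - M \<le> (M / norm h) ^ n * norm c" .
    then show False using m[OF n(2)] by simp
  qed
  have S': "cstar_subalg (plus_unit S)" using cstar_subalg_plus_unit[OF S] .
  \<comment> \<open>The C*-identity at \<open>cs_adj y * z\<close>, an element of \<open>S\<close>,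
    gives the adjoint the same bound. Hence the self-adjoint \<open>cs_adj y * y\<close> acts with
    bound \<open>M * M\<close>, and the self-adjoint case applies to it.\<close>
  have ba: "norm (cs_adj y * z) \<le> M * norm z" if z: "z \<in> S" for z
  proof (cases "cs_adj y * z = 0")
    case False
    have yz: "cs_adj y * z \<in> S" using mult_plus_unit_mem[OF S _ z] y cstar_subalg_adj[OF S'] by blast
    have "norm (cs_adj y * z) * norm (cs_adj y * z) = norm (cs_adj z * (y * (cs_adj y * z)))"
      using cstar_identity[of "cs_adj y * z"] by (simp add: cs_adj_simps mult.assoc power2_eq_square)
    also have "\<dots> \<le> norm z * norm (y * (cs_adj y * z))"
      using norm_mult_ineq[of "cs_adj z"] by simp
    also have "\<dots> \<le> norm z * (M * norm (cs_adj y * z))"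
      using b[OF yz] by (simp add: mult_left_mono)
    finally show ?thesis using False by (simp add: algebra_simps)
  qed (simp add: M)
  have "norm (cs_adj y * y) \<le> M * M"
  proof (rule sa)
    show "norm (cs_adj y * y * a) \<le> M * M * norm a" if a: "a \<in> S" for a
    proof -
      have "norm (cs_adj y * y * a) \<le> M * norm (y * a)"
        using ba[of "y * a"] mult_plus_unit_mem[OF S y a] by (simp add: mult.assoc)
      also have "\<dots> \<le> M * (M * norm a)" using b[OF a] M by (simp add: mult_left_mono)
      finally show ?thesis by (simp add: mult.assoc)
    qed
  qed (use y M cstar_subalg_ops[OF S'] in \<open>auto simp: cs_adj_simps\<close>)
  then show ?thesis using M by (simp add: cstar_identity power2_eq_square) (meson abs_le_square_iff abs_norm_cancel mult_mono' norm_ge_zero not_le mult_strict_mono')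
qed

section \<open>Approximate units\<close>

text \<open>The recorded properties of the net pass to images under homomorphisms and to squares. In
  which subalgebra the net lies is stated separately, so that one filter can be set against several
  algebras.\<close>

definition approx_id :: "'a::cstar_algebra filter \<Rightarrow> 'a set \<Rightarrow> bool" where
  "approx_id F S \<longleftrightarrow> F \<noteq> bot \<and> eventually (\<lambda>u. norm u \<le> 1 \<and> cs_adj u = u) F
     \<and> (\<forall>c\<in>S. ((\<lambda>u. u * c) \<longlongrightarrow> c) F \<and> ((\<lambda>u. c * u) \<longlongrightarrow> c) F)"

lemma approx_idD:
  assumes "approx_id F S"
  shows approx_id_not_bot: "F \<noteq> bot"
    and approx_id_norm: "eventually (\<lambda>u. norm u \<le> 1) F"
    and approx_id_adj: "eventually (\<lambda>u. cs_adj u = u) F"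
    and approx_id_left: "\<And>c. c \<in> S \<Longrightarrow> ((\<lambda>u. u * c) \<longlongrightarrow> c) F"
    and approx_id_right: "\<And>c. c \<in> S \<Longrightarrow> ((\<lambda>u. c * u) \<longlongrightarrow> c) F"
  using assms by (auto simp: approx_id_def elim: eventually_mono)

lemma approx_unit_property_imp_approx_id:
  assumes "approx_unit_property C D"
  obtains F where "approx_id F C" "eventually (\<lambda>u. u \<in> D) F"
proof -
  from assms obtain F where F: "F \<noteq> bot"
      "eventually (\<lambda>u. u \<in> D \<and> positive_in D u \<and> norm u \<le> 1) F"
      "\<forall>c\<in>C. ((\<lambda>u. u * c) \<longlongrightarrow> c) F \<and> ((\<lambda>u. c * u) \<longlongrightarrow> c) F"
    unfolding approx_unit_property_def by blast
  have "eventually (\<lambda>u. norm u \<le> 1 \<and> cs_adj u = u) F"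
    using F(2) by eventually_elim (auto simp: positive_in_def cs_adj_simps)
  then have "approx_id F C" using F by (simp add: approx_id_def)
  moreover have "eventually (\<lambda>u. u \<in> D) F" using F(2) by eventually_elim auto
  ultimately show ?thesis using that by blast
qed

text \<open>A contraction \<open>u\<close> does not enlarge the error \<open>g u - c\<close>, so the
  net may act on a moving target. The choice \<open>g u = c * u\<close> shows that the compressions
  \<open>u * c * u\<close> converge.\<close>

lemma approx_id_tendsto:
  assumes F: "approx_id F S" and c: "c \<in> S" and g: "(g \<longlongrightarrow> c) F"
  shows "((\<lambda>u. u * g u) \<longlongrightarrow> c) F"
proof -
  have "((\<lambda>u. u * (g u - c)) \<longlongrightarrow> 0) F"
  proof (rule Lim_null_comparison)
    show "\<forall>\<^sub>F u in F. norm (u * (g u - c)) \<le> norm (g u - c)"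
      using approx_id_norm[OF F]
    proof eventually_elim
      case (elim u)
      show ?case using norm_mult_ineq[of u "g u - c"] mult_right_mono[OF elim norm_ge_zero, of "g u - c"] by simp
    qed
    show "((\<lambda>u. norm (g u - c)) \<longlongrightarrow> 0) F" using g by (simp add: LIM_zero_iff tendsto_norm_zero)
  qed
  then have "((\<lambda>u. u * (g u - c) + u * c) \<longlongrightarrow> 0 + c) F"
    by (intro tendsto_add approx_id_left[OF F c])
  then show ?thesis by (simp add: algebra_simps)
qed

text \<open>The elements with convergent left multiplication form a subspace \<open>Q\<close>,
  stable under right multiplication and closed because the net is bounded. Since the net is
  self-adjoint, right convergence at \<open>x\<close> means that \<open>cs_adj x\<close> is in
  \<open>Q\<close>; so \<open>Q\<close> intersected with its adjoint is a C*-subalgebra.\<close>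

lemma approx_id_cstar_gen:
  assumes F: "approx_id F X"
  shows "approx_id F (cstar_gen X)"
proof -
  define Q where "Q = {x. ((\<lambda>u. u * x) \<longlongrightarrow> x) F}"
  have flip: "((\<lambda>u. x * u) \<longlongrightarrow> x) F \<longleftrightarrow> cs_adj x \<in> Q" for x
  proof
    assume "((\<lambda>u. x * u) \<longlongrightarrow> x) F"
    then have "((\<lambda>u. cs_adj (x * u)) \<longlongrightarrow> cs_adj x) F" by (rule tendsto_cs_adj)
    then show "cs_adj x \<in> Q"
      unfolding Q_def mem_Collect_eq
      by (rule Lim_transform_eventually) (use approx_id_adj[OF F] in eventually_elim, simp add: cs_adj_mult)
  next
    assume "cs_adj x \<in> Q"
    then have "((\<lambda>u. cs_adj (u * cs_adj x)) \<longlongrightarrow> cs_adj (cs_adj x)) F"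
      unfolding Q_def mem_Collect_eq by (rule tendsto_cs_adj)
    then have "((\<lambda>u. cs_adj (u * cs_adj x)) \<longlongrightarrow> x) F" by (simp add: cs_adj_adj)
    then show "((\<lambda>u. x * u) \<longlongrightarrow> x) F"
      by (rule Lim_transform_eventually)
        (use approx_id_adj[OF F] in eventually_elim, simp add: cs_adj_mult cs_adj_adj)
  qed
  have Qadd: "x + y \<in> Q" if "x \<in> Q" "y \<in> Q" for x y
    using that tendsto_add[of "\<lambda>u. u * x" x F "\<lambda>u. u * y" y] by (simp add: Q_def algebra_simps)
  have Qscale: "cs_scale a x \<in> Q" if "x \<in> Q" for a x
    using that tendsto_cs_scale[of "\<lambda>u. u * x" x F a] by (simp add: Q_def cs_scale_mult_right)
  have Qmult: "x * y \<in> Q" if "x \<in> Q" for x y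
    using that tendsto_mult_right[of "\<lambda>u. u * x" x F y] by (simp add: Q_def mult.assoc)
  have "closure Q \<subseteq> Q"
  proof
    fix x assume x: "x \<in> closure Q"
    have "\<forall>\<^sub>F u in F. dist (u * x) x < e" if e: "e > 0" for e
    proof -
      obtain y where y: "y \<in> Q" "dist y x < e/3"
        using x[unfolded closure_approachable, rule_format, of "e/3"] e by auto
      have "\<forall>\<^sub>F u in F. dist (u * y) y < e/3"
        using y(1) e unfolding Q_def mem_Collect_eq by (intro tendstoD) simp_all
      then show ?thesis using approx_id_norm[OF F]
      proof eventually_elim
        case (elim u)
        have "norm (u * (x - y)) \<le> norm (x - y)"
          using norm_mult_ineq[of u "x - y"] mult_right_mono[OF elim(2) norm_ge_zero, of "x - y"] by simp
        moreover have "u * x - x = u * (x - y) + (u * y - y) + (y - x)" by (simp add: algebra_simps)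
        then have "norm (u * x - x) \<le> norm (u * (x - y)) + norm (u * y - y) + norm (y - x)"
          by (metis norm_triangle_mono norm_triangle_ineq order_refl)
        ultimately show ?case using elim(1) y(2) by (simp add: dist_norm norm_minus_commute)
      qed
    qed
    then show "x \<in> Q" unfolding Q_def mem_Collect_eq by (rule tendstoI)
  qed
  then have Qclosed: "closed Q" by (simp add: closure_subset_eq)
  have "closed (cs_adj -` Q)"
    by (rule closed_vimage[OF Qclosed bounded_linear.continuous_on[OF bounded_linear_cs_adj continuous_on_id]])
  then have "closed (Q \<inter> cs_adj -` Q)" using Qclosed by blast
  moreover have "0 \<in> Q" by (simp add: Q_def)
  ultimately have "cstar_subalg (Q \<inter> cs_adj -` Q)"
    unfolding cstar_subalg_def csubspace_def using Qadd Qscale Qmult by (simp add: cs_adj_simps)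
  moreover have "X \<subseteq> Q \<inter> cs_adj -` Q"
    using approx_id_left[OF F] approx_id_right[OF F] flip by (auto simp: Q_def)
  ultimately have "cstar_gen X \<subseteq> Q \<inter> cs_adj -` Q" by (rule cstar_gen_least)
  then show ?thesis using F flip unfolding approx_id_def by (auto simp: Q_def)
qed

lemma approx_id_unit:
  assumes F: "approx_id F S" and e: "eventually (\<lambda>u. e * u = u) F" and s: "s \<in> S"
  shows "e * s = s"
proof -
  have "((\<lambda>u. e * (u * s)) \<longlongrightarrow> e * s) F" by (intro tendsto_mult_left approx_id_left[OF F s])
  moreover have "eventually (\<lambda>u. e * (u * s) = u * s) F"
    using e by eventually_elim (simp flip: mult.assoc)
  ultimately have "((\<lambda>u. u * s) \<longlongrightarrow> e * s) F" by (rule Lim_transform_eventually)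
  then show ?thesis using tendsto_unique[OF approx_id_not_bot[OF F]] approx_id_left[OF F s] by blast
qed

lemma inclusionD:
  assumes "inclusion C D"
  shows "cstar_subalg C" "cstar_subalg D" "D \<subseteq> C"
  using assms by (auto simp: inclusion_def)

text \<open>A unit of \<open>S\<close> fixes the approximate unit, which lies in \<open>D\<close>,
  and therefore all of \<open>C\<close>. The intermediate algebras in question are the relative
  commutant and, for an envelope, the Cartan subalgebra.\<close>

lemma not_unital_subalg:
  assumes "inclusion C D" "approx_id F C" "eventually (\<lambda>u. u \<in> D) F" "\<not> unital_alg C"
    and S: "D \<subseteq> S" "S \<subseteq> C"
  shows "\<not> unital_alg S"
proof
  assume "unital_alg S"
  then obtain e where e: "e \<in> S" "\<And>x. x \<in> S \<Longrightarrow> e * x = x" by (auto simp: unital_alg_def)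
  have "eventually (\<lambda>u. e * u = u) F" using assms(3) by eventually_elim (use e S in auto)
  then have "unital_alg C"
    using unital_algI[OF inclusionD(1)[OF assms(1)]] approx_id_unit[OF assms(2)] e S by blast
  then show False using assms(4) by blast
qed

section \<open>Normalizers and regularity\<close>

lemma normalizersD:
  assumes "v \<in> normalizers C D"
  shows "v \<in> C" "\<And>d. d \<in> D \<Longrightarrow> v * d * cs_adj v \<in> D" "\<And>d. d \<in> D \<Longrightarrow> cs_adj v * d * v \<in> D"
  using assms by (auto simp: normalizers_def)

text \<open>Here the approximate unit is essential: \<open>v * cs_adj v\<close> is the limit of
  \<open>v * u * cs_adj v\<close> with \<open>u\<close> in \<open>D\<close>. This is what
  \<open>v\<close> needs in order to normalize the adjoined scalars as well.\<close>

lemma normalizer_adj_mult: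
  assumes inc: "inclusion C D" and F: "approx_id F C" "eventually (\<lambda>u. u \<in> D) F"
    and v: "v \<in> normalizers C D"
  shows "v * cs_adj v \<in> D" "cs_adj v * v \<in> D"
proof -
  note D = cstar_subalg_closed[OF inclusionD(2)[OF inc]]
  have adj: "cs_adj v \<in> C" using normalizersD(1)[OF v] cstar_subalg_adj[OF inclusionD(1)[OF inc]] by blast
  show "v * cs_adj v \<in> D"
  proof (rule closed_limit[OF D approx_id_not_bot[OF F(1)]])
    show "((\<lambda>u. v * u * cs_adj v) \<longlongrightarrow> v * cs_adj v) F"
      by (intro tendsto_mult_right approx_id_right[OF F(1)] normalizersD(1)[OF v])
    show "\<forall>\<^sub>F u in F. v * u * cs_adj v \<in> D"
      using F(2) by eventually_elim (rule normalizersD(2)[OF v])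
  qed
  show "cs_adj v * v \<in> D"
  proof (rule closed_limit[OF D approx_id_not_bot[OF F(1)]])
    show "((\<lambda>u. cs_adj v * u * v) \<longlongrightarrow> cs_adj v * v) F"
      by (intro tendsto_mult_right approx_id_right[OF F(1)] adj)
    show "\<forall>\<^sub>F u in F. cs_adj v * u * v \<in> D"
      using F(2) by eventually_elim (rule normalizersD(3)[OF v])
  qed
qed

lemma normalizers_plus_unit:
  assumes inc: "inclusion C D" and F: "approx_id F C" "eventually (\<lambda>u. u \<in> D) F"
  shows "normalizers C D \<subseteq> normalizers (plus_unit C) (plus_unit D)"
proof
  fix v assume v: "v \<in> normalizers C D"
  note D = inclusionD(2)[OF inc]
  have "v * (d + cs_scale l 1) * cs_adj v \<in> plus_unit D \<and> cs_adj v * (d + cs_scale l 1) * v \<in> plus_unit D"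
    if d: "d \<in> D" for d l
  proof -
    have "v * d * cs_adj v + cs_scale l (v * cs_adj v) \<in> D" "cs_adj v * d * v + cs_scale l (cs_adj v * v) \<in> D"
      using normalizersD(2,3)[OF v d] normalizer_adj_mult[OF inc F v] cstar_subalg_ops[OF D] by auto
    then show ?thesis
      using subset_plus_unit_of[of D 1] unfolding plus_unit_eq by (auto simp: cs_ring_simps)
  qed
  then show "v \<in> normalizers (plus_unit C) (plus_unit D)"
    using normalizersD(1)[OF v] subset_plus_unit_of[of C 1]
    by (auto simp: normalizers_def plus_unit_eq elim!: plus_unit_ofE)
qed

text \<open>Two bracketings give the two memberships:
  \<open>v * (d * c * cs_adj d) * cs_adj v\<close> is visibly in \<open>B\<close>, and the ideal
  property puts the same product in \<open>A0\<close>. Cutting by \<open>d\<close> turns normalizers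
  of a large pair into normalizers of an ideal pair; it serves \<open>C\<close> inside its
  unitization as well as \<open>C1\<close> inside \<open>A\<close>.\<close>

lemma normalizer_mult_ideal:
  assumes A: "cstar_subalg A" and B: "cstar_subalg B" "B \<subseteq> A"
    and A0: "A0 \<subseteq> A" "\<And>a x. a \<in> A0 \<Longrightarrow> x \<in> A \<Longrightarrow> x * a \<in> A0 \<and> a * x \<in> A0" and B0: "B0 = B \<inter> A0"
    and v: "v \<in> normalizers A B" and d: "d \<in> B0"
  shows "v * d \<in> normalizers A0 B0" "d * v \<in> normalizers A0 B0"
proof -
  have vA: "v \<in> A" "cs_adj v \<in> A" "d \<in> A" "cs_adj d \<in> A" "d \<in> A0" "d \<in> B" "cs_adj d \<in> B"
    using normalizersD(1)[OF v] d A0 B0 B cstar_subalg_adj[OF A] cstar_subalg_adj[OF B(1)] by auto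
  have L: "x * a \<in> A0" and R: "a * x \<in> A0" if "a \<in> A0" "x \<in> A" for a x using A0 that by auto
  have 1: "(v * d) * c * cs_adj (v * d) \<in> B0" "cs_adj (v * d) * c * (v * d) \<in> B0"
      "(d * v) * c * cs_adj (d * v) \<in> B0" "cs_adj (d * v) * c * (d * v) \<in> B0" if c: "c \<in> B0" for c
  proof -
    have cB: "c \<in> B" "c \<in> A0" "c \<in> A" using c B0 A0 by auto
    have B': "v * (d * c * cs_adj d) * cs_adj v \<in> B" "cs_adj d * (cs_adj v * c * v) * d \<in> B"
      "d * (v * c * cs_adj v) * cs_adj d \<in> B" "cs_adj v * (cs_adj d * c * d) * v \<in> B"
      using cB vA by (auto intro!: normalizersD(2,3)[OF v] cstar_subalg_mult[OF B(1)])
    note m = cstar_subalg_mult[OF A]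
    have A': "v * (d * (c * (cs_adj d * cs_adj v))) \<in> A0" "d * (v * (c * (cs_adj v * cs_adj d))) \<in> A0"
      by (intro L[OF R[OF vA(5)] vA(1)] R[OF vA(5)] m vA cB)+
    have A'': "cs_adj d * (cs_adj v * (c * (v * d))) \<in> A0" "cs_adj v * (cs_adj d * (c * (d * v))) \<in> A0"
      by (intro L[OF L[OF R[OF cB(2)] vA(2)] vA(4)] L[OF L[OF R[OF cB(2)] vA(4)] vA(2)] m vA(1,3))+
    show "(v * d) * c * cs_adj (v * d) \<in> B0" "cs_adj (v * d) * c * (v * d) \<in> B0"
      "(d * v) * c * cs_adj (d * v) \<in> B0" "cs_adj (d * v) * c * (d * v) \<in> B0"
      using A' A'' B' B0 by (auto simp: cs_adj_mult mult.assoc)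
  qed
  show "v * d \<in> normalizers A0 B0" "d * v \<in> normalizers A0 B0"
    using 1 L[OF vA(5,1)] R[OF vA(5,1)] by (auto simp: normalizers_def)
qed

lemma inter_plus_unit_of:
  assumes "csubspace C" "D \<subseteq> C" "e \<notin> C"
  shows "plus_unit_of D e \<inter> C = D"
  using plus_unit_of_mem_iff[OF assms(1,3)] assms(2) subset_plus_unit_of[of D e]
  by (auto elim!: plus_unit_ofE)

lemma inclusion_plus_unit: "inclusion C D \<Longrightarrow> inclusion (plus_unit C) (plus_unit D)"
  using cstar_subalg_plus_unit by (auto simp: inclusion_def plus_unit_def)

lemma closure_cspan_least: "cstar_subalg C \<Longrightarrow> N \<subseteq> C \<Longrightarrow> closure (cspan N) \<subseteq> C"
  using cspan_least closure_minimal cstar_subalgD(1,2) by metis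

lemma regular_inclusionI:
  assumes "inclusion C D" "C \<subseteq> closure (cspan (normalizers C D))"
  shows "regular_inclusion C D"
  unfolding regular_inclusion_def
  using assms closure_cspan_least[OF inclusionD(1)[OF assms(1)], of "normalizers C D"]
  by (auto simp: normalizers_def)

text \<open>Old normalizers stay normalizers and \<open>1\<close> is one too, so the closed span
  contains both summands.\<close>

lemma regular_inclusion_plus_unit:
  assumes reg: "regular_inclusion C D" and F: "approx_id F C" "eventually (\<lambda>u. u \<in> D) F"
  shows "regular_inclusion (plus_unit C) (plus_unit D)"
proof (rule regular_inclusionI)
  have inc: "inclusion C D" using reg by (simp add: regular_inclusion_def)
  show "inclusion (plus_unit C) (plus_unit D)" using inclusion_plus_unit[OF inc] .
  let ?N = "normalizers (plus_unit C) (plus_unit D)"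
  have sub: "csubspace (closure (cspan ?N))" using csubspace_closure csubspace_cspan by blast
  have "normalizers C D \<subseteq> cspan ?N" using normalizers_plus_unit[OF inc F] cspan_superset by blast
  then have "closure (cspan (normalizers C D)) \<subseteq> closure (cspan ?N)"
    by (intro closure_mono cspan_least csubspace_cspan)
  then have C: "C \<subseteq> closure (cspan ?N)" using reg by (simp add: regular_inclusion_def)
  have "1 \<in> plus_unit C"
    unfolding plus_unit_eq using unit_in_plus_unit_of cstar_subalg_0 inclusionD(1)[OF inc] by blast
  then have "1 \<in> ?N" by (simp add: normalizers_def)
  then have "1 \<in> closure (cspan ?N)" using cspan_superset closure_subset by blast
  then show "plus_unit C \<subseteq> closure (cspan ?N)"
    using C csubspace_add[OF sub] csubspace_scale[OF sub] by (auto simp: plus_unit_def)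
qed

text \<open>For fixed \<open>d\<close> in \<open>B0\<close>, right multiplication by
  \<open>d\<close> sends normalizers of the large pair to normalizers of the ideal pair, hence by
  density all of \<open>A\<close> into the closed span. The approximate unit then recovers each
  \<open>a\<close> in \<open>A0\<close> as a limit of \<open>a * u\<close>.\<close>

lemma regular_inclusion_ideal:
  assumes reg: "regular_inclusion A B"
    and A0: "A0 \<subseteq> A" "\<And>a x. a \<in> A0 \<Longrightarrow> x \<in> A \<Longrightarrow> x * a \<in> A0 \<and> a * x \<in> A0" and B0: "B0 = B \<inter> A0"
    and inc: "inclusion A0 B0" and F: "approx_id F A0" "eventually (\<lambda>u. u \<in> B0) F"
  shows "regular_inclusion A0 B0"
proof (rule regular_inclusionI[OF inc])
  have AB: "cstar_subalg A" "cstar_subalg B" "B \<subseteq> A" and dense: "closure (cspan (normalizers A B)) = A"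
    using reg by (auto simp: regular_inclusion_def inclusion_def)
  let ?K = "closure (cspan (normalizers A0 B0))"
  have K: "csubspace ?K" using csubspace_closure csubspace_cspan by blast
  have *: "a * d \<in> ?K" if d: "d \<in> B0" and a: "a \<in> A" for a d
  proof -
    have "csubspace ((\<lambda>a. a * d) -` ?K)"
      using K by (auto simp: csubspace_def cs_scale_mult_left distrib_right)
    moreover have "normalizers A B \<subseteq> (\<lambda>a. a * d) -` ?K"
      using normalizer_mult_ideal(1)[OF AB A0 B0 _ d] cspan_superset closure_subset by blast
    moreover have "closed ((\<lambda>a. a * d) -` ?K)"
      by (intro closed_vimage) (auto intro!: continuous_intros)
    ultimately have "closure (cspan (normalizers A B)) \<subseteq> (\<lambda>a. a * d) -` ?K"
      by (intro closure_minimal cspan_least)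
    then show ?thesis using dense a by blast
  qed
  show "A0 \<subseteq> ?K"
  proof
    fix a assume a: "a \<in> A0"
    show "a \<in> ?K"
    proof (rule closed_limit[OF closed_closure approx_id_not_bot[OF F(1)]])
      show "((\<lambda>u. a * u) \<longlongrightarrow> a) F" using approx_id_right[OF F(1) a] .
      show "\<forall>\<^sub>F u in F. a * u \<in> ?K" using F(2) by eventually_elim (use * a A0(1) in blast)
    qed
  qed
qed

section \<open>Pseudo-Cartan inclusions and unitization\<close>

lemma rel_commutant_plus_unit:
  "rel_commutant (plus_unit C) (plus_unit D) = plus_unit (rel_commutant C D)"
proof -
  have "(\<forall>y\<in>plus_unit D. (c + cs_scale l 1) * y = y * (c + cs_scale l 1)) \<longleftrightarrow> (\<forall>d\<in>D. c * d = d * c)" for c l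
  proof
    assume *: "\<forall>y\<in>plus_unit D. (c + cs_scale l 1) * y = y * (c + cs_scale l 1)"
    show "\<forall>d\<in>D. c * d = d * c"
      using * subset_plus_unit_of[of D 1] by (auto simp: plus_unit_eq cs_ring_simps subset_iff)
  qed (auto simp: plus_unit_def cs_ring_simps)
  then show ?thesis unfolding rel_commutant_def by (auto simp: plus_unit_def) blast+
qed

lemma cstar_subalg_rel_commutant:
  assumes C: "cstar_subalg C" and D: "cstar_subalg D"
  shows "cstar_subalg (rel_commutant C D)"
  unfolding cstar_subalg_def
proof (intro conjI ballI)
  note [simp] = cstar_subalg_ops[OF C]
  show "csubspace (rel_commutant C D)"
    by (auto simp: rel_commutant_def csubspace_def cs_ring_simps)
  have "rel_commutant C D = C \<inter> (\<Inter>d\<in>D. {c. c * d = d * c})" by (auto simp: rel_commutant_def)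
  moreover have "closed {c. c * d = d * c}" for d :: 'a
    by (intro closed_Collect_eq continuous_intros)
  ultimately show "closed (rel_commutant C D)"
    using cstar_subalg_closed[OF C] by (auto intro!: closed_Int closed_INT)
  show "x * y \<in> rel_commutant C D" if "x \<in> rel_commutant C D" "y \<in> rel_commutant C D" for x y
    using that unfolding rel_commutant_def by simp (metis mult.assoc)
  show "cs_adj x \<in> rel_commutant C D" if x: "x \<in> rel_commutant C D" for x
  proof -
    have "cs_adj x * d = d * cs_adj x" if d: "d \<in> D" for d
    proof -
      have "x * cs_adj d = cs_adj d * x" using x cstar_subalg_adj[OF D d] by (simp add: rel_commutant_def)
      from arg_cong[OF this, of cs_adj] show ?thesis by (simp add: cs_adj_simps)
    qed
    then show ?thesis using x by (simp add: rel_commutant_def)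
  qed
qed

section \<open>Closed ideals and the ideal intersection property under unitization\<close>

lemma closed_idealD:
  assumes "closed_ideal J C"
  shows "J \<subseteq> C" "csubspace J" "closed J" "\<And>j c. j \<in> J \<Longrightarrow> c \<in> C \<Longrightarrow> c * j \<in> J"
    "\<And>j c. j \<in> J \<Longrightarrow> c \<in> C \<Longrightarrow> j * c \<in> J"
  using assms by (auto simp: closed_ideal_def)

lemma closed_ideal_plus_unit_of:
  assumes J: "closed_ideal J S" and e: "\<And>x. x \<in> S \<Longrightarrow> e * x = x \<and> x * e = x"
  shows "closed_ideal J (plus_unit_of S e)"
proof -
  have "(c + cs_scale l e) * j \<in> J \<and> j * (c + cs_scale l e) \<in> J" if "j \<in> J" "c \<in> S" for j c l
  proof -
    have "e * j = j" "j * e = j" using e closed_idealD(1)[OF J] that by auto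
    then show ?thesis
      using that closed_idealD(4,5)[OF J] csubspaceD(2,3)[OF closed_idealD(2)[OF J]]
      by (simp add: cs_ring_simps)
  qed
  then show ?thesis
    using closed_idealD(1-3)[OF J] subset_plus_unit_of[of S e]
    unfolding closed_ideal_def by (auto elim!: plus_unit_ofE)
qed

lemma closed_ideal_inter_subalg:
  assumes J: "closed_ideal J A" and S: "cstar_subalg S" "S \<subseteq> A"
  shows "closed_ideal (J \<inter> S) S"
  unfolding closed_ideal_def
  using closed_idealD[OF J] cstar_subalg_ops[OF S(1)] cstar_subalg_closed[OF S(1)] S(2)
  by (auto simp: csubspace_def subset_iff)

lemma ideal_intersection_property_plus_unit:
  assumes S: "cstar_subalg S" and nu: "\<not> unital_alg S" and T: "csubspace T" "T \<subseteq> S"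
  shows "ideal_intersection_property (plus_unit S) (plus_unit T) \<longleftrightarrow> ideal_intersection_property S T"
proof
  have 1: "1 \<notin> S" using nu by (rule not_unital_imp_one_notin)
  note Ss = cstar_subalg_csubspace[OF S]
  have TS: "plus_unit T \<inter> S = T" unfolding plus_unit_eq using inter_plus_unit_of[OF Ss T(2) 1] .
  {
    assume *: "ideal_intersection_property (plus_unit S) (plus_unit T)"
    show "ideal_intersection_property S T"
      unfolding ideal_intersection_property_def
    proof (intro allI impI, elim conjE)
      fix J assume J: "closed_ideal J S" "J \<noteq> {0}"
      then have "closed_ideal J (plus_unit S)" unfolding plus_unit_eq by (intro closed_ideal_plus_unit_of) auto
      then have "J \<inter> plus_unit T \<noteq> {0}" using * J(2) by (auto simp: ideal_intersection_property_def)
      moreover have "J \<inter> plus_unit T = J \<inter> T" using TS closed_idealD(1)[OF J(1)] by blast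
      ultimately show "J \<inter> T \<noteq> {0}" by simp
    qed
  next
    assume *: "ideal_intersection_property S T"
    show "ideal_intersection_property (plus_unit S) (plus_unit T)"
      unfolding ideal_intersection_property_def
    proof (intro allI impI, elim conjE)
      fix J assume J: "closed_ideal J (plus_unit S)" "J \<noteq> {0}"
      have sub: "S \<subseteq> plus_unit S" "T \<subseteq> plus_unit T" unfolding plus_unit_eq by (rule subset_plus_unit_of)+
      have JS: "closed_ideal (J \<inter> S) S" using closed_ideal_inter_subalg[OF J(1) S sub(1)] .
      have "J \<inter> S \<noteq> {0}"
      proof
        assume JS0: "J \<inter> S = {0}"
        obtain y where y: "y \<in> J" "y \<noteq> 0" using J csubspace_0[OF closed_idealD(2)[OF J(1)]] by blast
        obtain c l where c: "c \<in> S" "y = c + cs_scale l 1"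
          using y closed_idealD(1)[OF J(1)] by (auto simp: plus_unit_def)
        have l: "l \<noteq> 0"
        proof
          assume "l = 0"
          then have "y \<in> J \<inter> S" using y(1) c by simp
          then show False using JS0 y(2) by blast
        qed
        \<comment> \<open>The product \<open>y * a\<close> lies both in \<open>J\<close> and in
          \<open>S\<close>, hence is \<open>0\<close>; solving this for \<open>a\<close> makes the
          indicated multiple of \<open>c\<close> a left unit.\<close>
        have "- cs_scale (inverse l) c * a = a" if a: "a \<in> S" for a
        proof -
          have "y * a \<in> J" using closed_idealD(5)[OF J(1) y(1)] sub a by blast
          moreover have "y * a = c * a + cs_scale l a" using c by (simp add: cs_ring_simps)
          moreover have "c * a + cs_scale l a \<in> S"
            using a c(1) by (intro cstar_subalg_add[OF S] cstar_subalg_mult[OF S] cstar_subalg_scale[OF S])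
          ultimately have "c * a + cs_scale l a = 0" using JS0 by auto
          then have "cs_scale (inverse l) (c * a + cs_scale l a) = 0" by simp
          then have "cs_scale (inverse l) (c * a) + a = 0"
            using l by (simp add: cs_scale_add_right cs_scale_scale)
          then show ?thesis by (simp add: cs_scale_mult_left minus_unique)
        qed
        moreover have "- cs_scale (inverse l) c \<in> S"
          using c(1) by (intro cstar_subalg_minus[OF S] cstar_subalg_scale[OF S])
        ultimately show False using nu unital_algI[OF S] by blast
      qed
      then have "J \<inter> S \<inter> T \<noteq> {0}" using * JS by (auto simp: ideal_intersection_property_def)
      moreover have "0 \<in> J \<inter> S \<inter> T"
        using csubspace_0 T(1) closed_idealD(2)[OF JS] by blast
      ultimately show "J \<inter> plus_unit T \<noteq> {0}" using sub by blast
    qed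
  }
qed

text \<open>Forming the relative commutant commutes with adjoining scalars, so the transfer of the
  ideal intersection property is applied twice: from \<open>C\<close> to the relative commutant and
  from there to \<open>D\<close>. The second application relies on the relative commutant being
  non-unital.\<close>

theorem pseudo_cartan_plus_unit_iff:
  assumes reg: "regular_inclusion C D" and abD: "abelian D" and nu: "\<not> unital_alg C"
    and F: "approx_id F C" "eventually (\<lambda>u. u \<in> D) F"
  shows "pseudo_cartan (plus_unit C) (plus_unit D) \<longleftrightarrow> pseudo_cartan C D"
proof -
  have inc: "inclusion C D" using reg by (simp add: regular_inclusion_def)
  note C = inclusionD(1)[OF inc] and D = inclusionD(2)[OF inc] and DC = inclusionD(3)[OF inc]
  let ?E = "rel_commutant C D"
  have E: "cstar_subalg ?E" using cstar_subalg_rel_commutant[OF C D] .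
  have DE: "D \<subseteq> ?E" and EC: "?E \<subseteq> C" using abD DC by (auto simp: rel_commutant_def abelian_def)
  have nuE: "\<not> unital_alg ?E" using not_unital_subalg[OF inc F nu DE EC] .
  have ab: "abelian (plus_unit S) \<longleftrightarrow> abelian S" for S :: "'a set"
  proof
    show "abelian (plus_unit S) \<Longrightarrow> abelian S"
      unfolding plus_unit_eq using subset_plus_unit_of[of S 1] by (auto simp: abelian_def)
  qed (auto simp: plus_unit_eq intro!: abelian_plus_unit_of)
  have "ideal_intersection_property (plus_unit C) (plus_unit ?E) \<longleftrightarrow> ideal_intersection_property C ?E"
    using ideal_intersection_property_plus_unit[OF C nu cstar_subalg_csubspace[OF E] EC] .
  moreover have "ideal_intersection_property (plus_unit ?E) (plus_unit D) \<longleftrightarrow> ideal_intersection_property ?E D"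
    using ideal_intersection_property_plus_unit[OF E nuE cstar_subalg_csubspace[OF D] DE] .
  ultimately show ?thesis
    using reg regular_inclusion_plus_unit[OF reg F] by (simp add: pseudo_cartan_def rel_commutant_plus_unit ab)
qed

section \<open>Conditional expectations\<close>

lemma faithful_cond_expD:
  assumes "faithful_cond_exp A B \<Delta>"
  shows cond_exp_mem: "\<And>x. x \<in> A \<Longrightarrow> \<Delta> x \<in> B"
    and cond_exp_add: "\<And>x y. x \<in> A \<Longrightarrow> y \<in> A \<Longrightarrow> \<Delta> (x + y) = \<Delta> x + \<Delta> y"
    and cond_exp_scale: "\<And>a x. x \<in> A \<Longrightarrow> \<Delta> (cs_scale a x) = cs_scale a (\<Delta> x)"
    and cond_exp_id: "\<And>b. b \<in> B \<Longrightarrow> \<Delta> b = b"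
    and cond_exp_norm: "\<And>x. x \<in> A \<Longrightarrow> norm (\<Delta> x) \<le> norm x"
    and cond_exp_positive: "\<And>x. x \<in> A \<Longrightarrow> positive_in B (\<Delta> (cs_adj x * x))"
    and cond_exp_bimodule: "\<And>x b1 b2. x \<in> A \<Longrightarrow> b1 \<in> B \<Longrightarrow> b2 \<in> B \<Longrightarrow> \<Delta> (b1 * x * b2) = b1 * \<Delta> x * b2"
    and cond_exp_faithful: "\<And>x. x \<in> A \<Longrightarrow> \<Delta> (cs_adj x * x) = 0 \<Longrightarrow> x = 0"
  using assms by (auto simp: faithful_cond_exp_def)

lemma cond_exp_diff:
  assumes "faithful_cond_exp A B \<Delta>" "cstar_subalg A" "x \<in> A" "y \<in> A"
  shows "\<Delta> (x - y) = \<Delta> x - \<Delta> y"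
  using cond_exp_add[OF assms(1,3), of "- y"] cond_exp_scale[OF assms(1,4), of "-1"]
    cstar_subalg_minus[OF assms(2,4)] by simp

lemma cond_exp_tendsto:
  assumes E: "faithful_cond_exp A B \<Delta>" and A: "cstar_subalg A"
    and f: "eventually (\<lambda>u. f u \<in> A) F" "(f \<longlongrightarrow> x) F" and x: "x \<in> A"
  shows "((\<lambda>u. \<Delta> (f u)) \<longlongrightarrow> \<Delta> x) F"
proof -
  have "((\<lambda>u. \<Delta> (f u) - \<Delta> x) \<longlongrightarrow> 0) F"
  proof (rule Lim_null_comparison)
    show "\<forall>\<^sub>F u in F. norm (\<Delta> (f u) - \<Delta> x) \<le> norm (f u - x)"
      using f(1)
    proof eventually_elim
      case (elim u)
      show ?case
        using cond_exp_norm[OF E cstar_subalg_diff[OF A elim x]] cond_exp_diff[OF E A elim x] by simp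
    qed
    show "((\<lambda>u. norm (f u - x)) \<longlongrightarrow> 0) F" using f(2) by (simp add: LIM_zero_iff tendsto_norm_zero)
  qed
  then show ?thesis by (simp add: LIM_zero_iff)
qed

lemma closed_cond_exp_eq:
  assumes E: "faithful_cond_exp A B \<Delta>" and E': "faithful_cond_exp A B \<Delta>'" and A: "cstar_subalg A"
  shows "closed {x \<in> A. \<Delta> x = \<Delta>' x}"
  unfolding closed_sequential_limits
proof (intro allI impI, elim conjE)
  fix f x assume f: "\<forall>n. f n \<in> {x \<in> A. \<Delta> x = \<Delta>' x}" and lim: "f \<longlonglongrightarrow> x"
  have fA: "\<forall>\<^sub>F n in sequentially. f n \<in> A" using f by simp
  have x: "x \<in> A" by (rule closed_limit[OF cstar_subalg_closed[OF A] _ fA lim]) simp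
  have "(\<lambda>n. \<Delta> (f n)) \<longlonglongrightarrow> \<Delta> x" "(\<lambda>n. \<Delta>' (f n)) \<longlonglongrightarrow> \<Delta>' x"
    by (rule cond_exp_tendsto[OF E A fA lim x] cond_exp_tendsto[OF E' A fA lim x])+
  moreover have "(\<lambda>n. \<Delta> (f n)) = (\<lambda>n. \<Delta>' (f n))" using f by auto
  ultimately show "x \<in> {x \<in> A. \<Delta> x = \<Delta>' x}" using x LIMSEQ_unique by auto
qed

text \<open>The module property of an expectation is stated with factors from \<open>B\<close> on
  both sides. When \<open>B\<close> has no unit, the one-sided version is obtained by inserting the
  approximate unit on the free side, which is why a net in \<open>B\<close> is part of the
  setting.\<close>

locale cond_exp_approx =
  fixes A B :: "'a::cstar_algebra set" and \<Delta> F
  assumes inc: "inclusion A B" and E: "faithful_cond_exp A B \<Delta>"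
    and F: "approx_id F A" and FB: "eventually (\<lambda>u. u \<in> B) F"
begin

lemmas A = inclusionD(1)[OF inc] and B = inclusionD(2)[OF inc] and BA = subsetD[OF inclusionD(3)[OF inc]]

lemma limit_unique:
  fixes f :: "'a \<Rightarrow> 'a"
  shows "(f \<longlongrightarrow> x) F \<Longrightarrow> (f \<longlongrightarrow> y) F \<Longrightarrow> x = y"
  by (rule tendsto_unique[OF approx_id_not_bot[OF F]])

lemma eventually_mult_mem:
  assumes "y \<in> A"
  shows "eventually (\<lambda>u. y * u \<in> A) F" "eventually (\<lambda>u. u * y \<in> A) F"
  using FB by (eventually_elim, use assms BA cstar_subalg_mult[OF A] in blast)+

lemma cond_exp_mult:
  assumes b: "b \<in> B" and x: "x \<in> A"
  shows "\<Delta> (b * x) = b * \<Delta> x" "\<Delta> (x * b) = \<Delta> x * b"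
proof -
  note m = cstar_subalg_mult[OF A]
  have bx: "b * x \<in> A" "x * b \<in> A" using m BA[OF b] x by auto
  have "((\<lambda>u. \<Delta> (b * x * u)) \<longlongrightarrow> \<Delta> (b * x)) F"
    by (intro cond_exp_tendsto[OF E A _ approx_id_right[OF F bx(1)] bx(1)] eventually_mult_mem bx)
  moreover have "eventually (\<lambda>u. \<Delta> (b * x * u) = b * \<Delta> x * u) F"
    using FB by eventually_elim (rule cond_exp_bimodule[OF E x b])
  ultimately have "((\<lambda>u. b * \<Delta> x * u) \<longlongrightarrow> \<Delta> (b * x)) F" by (rule Lim_transform_eventually)
  moreover have "((\<lambda>u. b * \<Delta> x * u) \<longlongrightarrow> b * \<Delta> x) F"
    using BA b cond_exp_mem[OF E x] by (intro approx_id_right[OF F] m) auto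
  ultimately show "\<Delta> (b * x) = b * \<Delta> x" by (rule limit_unique)
  have "((\<lambda>u. \<Delta> (u * (x * b))) \<longlongrightarrow> \<Delta> (x * b)) F"
    by (intro cond_exp_tendsto[OF E A _ approx_id_left[OF F bx(2)] bx(2)] eventually_mult_mem bx)
  moreover have "eventually (\<lambda>u. \<Delta> (u * (x * b)) = u * (\<Delta> x * b)) F"
    using FB by eventually_elim (use cond_exp_bimodule[OF E x _ b] in \<open>simp add: mult.assoc\<close>)
  ultimately have "((\<lambda>u. u * (\<Delta> x * b)) \<longlongrightarrow> \<Delta> (x * b)) F" by (rule Lim_transform_eventually)
  moreover have "((\<lambda>u. u * (\<Delta> x * b)) \<longlongrightarrow> \<Delta> x * b) F"
    using BA b cond_exp_mem[OF E x] by (intro approx_id_left[OF F] m) auto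
  ultimately show "\<Delta> (x * b) = \<Delta> x * b" by (rule limit_unique)
qed

text \<open>Polarisation against the approximate unit, since \<open>\<Delta>\<close> is only assumed to be positive.\<close>

lemma cond_exp_adj:
  assumes x: "x \<in> A"
  shows "\<Delta> (cs_adj x) = cs_adj (\<Delta> x)"
proof -
  have pos: "cs_adj (\<Delta> (cs_adj y * y)) = \<Delta> (cs_adj y * y)" if "y \<in> A" for y
    using cond_exp_positive[OF E that] by (auto simp: positive_in_def cs_adj_simps)
  have sum: "cs_adj (\<Delta> (cs_adj y) + \<Delta> y) = \<Delta> (cs_adj y) + \<Delta> y" if y: "y \<in> A" for y
  proof -
    have ya: "cs_adj y \<in> A" using cstar_subalg_adj[OF A y] .
    have "eventually (\<lambda>u. cs_adj (\<Delta> (cs_adj y) * u + u * \<Delta> y) = \<Delta> (cs_adj y) * u + u * \<Delta> y) F"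
      using FB approx_id_adj[OF F]
    proof eventually_elim
      case (elim u)
      note [simp] = cstar_subalg_ops[OF A] y ya BA[OF elim(1)]
      \<comment> \<open>Both squares and their sum have self-adjoint images, so the cross terms do
        as well; in the limit over \<open>u\<close> these become
        \<open>\<Delta> (cs_adj y) + \<Delta> y\<close>.\<close>
      have *: "\<Delta> (cs_adj (y + u) * (y + u))
          = \<Delta> (cs_adj y * y) + \<Delta> (cs_adj u * u) + (\<Delta> (cs_adj y) * u + u * \<Delta> y)"
      proof -
        have "cs_adj (y + u) * (y + u) = (cs_adj y * y + cs_adj u * u) + (cs_adj y * u + u * y)"
          using elim(2) by (simp add: cs_adj_simps algebra_simps)
        then show ?thesis
          using elim(1) by (simp add: cond_exp_add[OF E] cond_exp_mult)
      qed
      have "cs_adj (\<Delta> (cs_adj (y + u) * (y + u))) = \<Delta> (cs_adj (y + u) * (y + u))"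
        by (rule pos) simp
      then show ?case
        unfolding * using pos[of y] pos[of u] by (simp add: cs_adj_add)
    qed
    moreover have lim: "((\<lambda>u. \<Delta> (cs_adj y) * u + u * \<Delta> y) \<longlongrightarrow> \<Delta> (cs_adj y) + \<Delta> y) F"
      using BA cond_exp_mem[OF E] y ya by (intro tendsto_add approx_id_right[OF F] approx_id_left[OF F]) auto
    ultimately have "((\<lambda>u. \<Delta> (cs_adj y) * u + u * \<Delta> y) \<longlongrightarrow> cs_adj (\<Delta> (cs_adj y) + \<Delta> y)) F"
      by (intro Lim_transform_eventually[OF tendsto_cs_adj[OF lim]])
    then show ?thesis using limit_unique[OF _ lim] by blast
  qed
  have xa: "cs_adj x \<in> A" using cstar_subalg_adj[OF A x] .
  \<comment> \<open>Self-adjointness of that sum at \<open>x\<close> and at \<open>i x\<close> gives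
    two relations between \<open>a\<close>, \<open>b\<close> and their adjoints; subtracting them
    leaves \<open>cs_adj a = b\<close>.\<close>
  define a b where "a = \<Delta> x" and "b = \<Delta> (cs_adj x)"
  have 1: "cs_adj a + cs_adj b = a + b"
    using sum[OF x] by (simp add: a_def b_def cs_adj_add add.commute)
  have "cs_adj (cs_scale (-\<i>) b + cs_scale \<i> a) = cs_scale (-\<i>) b + cs_scale \<i> a"
    using sum[OF cstar_subalg_scale[OF A x, of \<i>]]
    by (simp add: a_def b_def cs_adj_scale cond_exp_scale[OF E x] cond_exp_scale[OF E xa] del: cs_scale_minus_left)
  then have "cs_scale (-\<i>) (cs_adj (cs_scale (-\<i>) b + cs_scale \<i> a)) = cs_scale (-\<i>) (cs_scale (-\<i>) b + cs_scale \<i> a)"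
    by simp
  then have 2: "cs_adj b - cs_adj a = a - b"
    by (simp add: cs_adj_simps cs_ring_simps)
  have "(cs_adj a + cs_adj b) - (cs_adj b - cs_adj a) = (a + b) - (a - b)" using 1 2 by simp
  then have "2 *\<^sub>R cs_adj a = 2 *\<^sub>R b" by (simp add: scaleR_2)
  then show ?thesis by (simp add: a_def b_def)
qed

end

text \<open>As \<open>v * b * cs_adj v\<close> is in \<open>B\<close>, it can be pulled through the
  expectation applied to \<open>v\<close>. Multiplying the result by \<open>cs_adj v\<close> gives
  \<open>x * b * h = h * b * x\<close>, with \<open>x = cs_adj v * \<Delta> v\<close> and
  \<open>h = cs_adj v * v\<close>. So \<open>h\<close> kills every commutator \<open>w\<close> of
  \<open>x\<close> with \<open>B\<close>; then so does \<open>v\<close>, even with an element of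
  \<open>B\<close> in between, and maximality of \<open>B\<close> places \<open>x\<close> in
  \<open>B\<close>.\<close>

lemma cond_exp_of_normalizer:
  assumes "cond_exp_approx A B \<Delta> F" and ab: "abelian B" and masa: "rel_commutant A B = B"
    and v: "v \<in> normalizers A B"
  shows "cs_adj v * \<Delta> v = cs_adj (\<Delta> v) * \<Delta> v" "cs_adj v * \<Delta> v \<in> B"
proof -
  interpret cond_exp_approx A B \<Delta> F by fact
  have vA: "v \<in> A" and vB: "\<Delta> v \<in> B" using normalizersD(1)[OF v] cond_exp_mem[OF E] by auto
  define h where "h = cs_adj v * v"
  have hB: "h \<in> B" unfolding h_def using normalizer_adj_mult[OF inc F FB v] by blast
  have comm: "a * b = b * a" if "a \<in> B" "b \<in> B" for a b using ab that by (auto simp: abelian_def)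
  define x where "x = cs_adj v * \<Delta> v"
  have xA: "x \<in> A" unfolding x_def using vA vB BA by (intro cstar_subalg_mult[OF A] cstar_subalg_adj[OF A])
  have key: "x * b * h = h * b * x" if b: "b \<in> B" for b
  proof -
    have "v * b * cs_adj v * \<Delta> v = \<Delta> (v * b * cs_adj v * v)"
      using cond_exp_mult(1)[OF normalizersD(2)[OF v b] vA] by simp
    also have "\<dots> = \<Delta> (v * (b * h))" by (simp add: h_def mult.assoc)
    also have "\<dots> = \<Delta> v * (b * h)"
      using cond_exp_mult(2)[OF cstar_subalg_mult[OF B b hB] vA] .
    finally have "cs_adj v * (v * b * cs_adj v * \<Delta> v) = cs_adj v * (\<Delta> v * (b * h))" by simp
    then show ?thesis by (simp add: x_def h_def mult.assoc)
  qed
  have xh: "x * h = h * x"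
  proof (rule limit_unique)
    show "((\<lambda>u. x * (u * h)) \<longlongrightarrow> x * h) F"
      using BA hB by (intro tendsto_mult_left approx_id_left[OF F]) auto
    have "((\<lambda>u. (h * u) * x) \<longlongrightarrow> h * x) F"
      using BA hB by (intro tendsto_mult_right approx_id_right[OF F]) auto
    moreover have "eventually (\<lambda>u. (h * u) * x = x * (u * h)) F"
      using FB by eventually_elim (use key in \<open>simp add: mult.assoc\<close>)
    ultimately show "((\<lambda>u. x * (u * h)) \<longlongrightarrow> h * x) F" by (rule Lim_transform_eventually)
  qed
  have "x * b = b * x" if b: "b \<in> B" for b
  proof -
    define w where "w = x * b - b * x"
    have "h * (x * b) = h * (b * x)"
      using key[OF b] xh comm[OF b hB] by (metis mult.assoc)
    then have hw: "h * w = 0" by (simp add: w_def right_diff_distrib)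
    have zero: "v * c * w = 0" if c: "c \<in> B" for c
    proof -
      have "cs_adj (v * c * w) * (v * c * w) = cs_adj w * cs_adj c * (h * c) * w"
        by (simp add: h_def cs_adj_mult mult.assoc)
      also have "\<dots> = cs_adj w * cs_adj c * c * (h * w)"
        using comm[OF hB c] by (metis mult.assoc)
      finally have "cs_adj (v * c * w) * (v * c * w) = 0" using hw by simp
      then show ?thesis by (simp only: cs_adj_mult_eq_0)
    qed
    have vw: "v * w = 0"
    proof -
      have "cs_adj (v * w) * (v * w) = cs_adj w * (h * w)" by (simp add: h_def cs_adj_mult mult.assoc)
      then have "cs_adj (v * w) * (v * w) = 0" using hw by simp
      then show ?thesis by (simp only: cs_adj_mult_eq_0)
    qed
    \<comment> \<open>Expanding only the second factor \<open>w\<close> makes each term contain the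
      adjoint of \<open>v * w\<close> or of \<open>v * cs_adj b * w\<close>, both already
      zero.\<close>
    have "cs_adj w * w = cs_adj (v * w) * \<Delta> v * b - cs_adj (v * cs_adj b * w) * \<Delta> v"
      by (simp add: cs_adj_simps mult.assoc) (simp add: w_def x_def right_diff_distrib mult.assoc)
    also have "\<dots> = 0" using vw zero[OF cstar_subalg_adj[OF B b]] by simp
    finally show ?thesis using cs_adj_mult_eq_0[of w] by (simp add: w_def)
  qed
  then have "x \<in> rel_commutant A B" using xA by (simp add: rel_commutant_def)
  then have xB: "x \<in> B" using masa by simp
  then show "cs_adj v * \<Delta> v \<in> B" by (simp add: x_def)
  have "x = \<Delta> (cs_adj v * \<Delta> v)" using cond_exp_id[OF E xB] by (simp add: x_def)
  also have "\<dots> = cs_adj (\<Delta> v) * \<Delta> v"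
    using cond_exp_mult(2)[OF vB cstar_subalg_adj[OF A vA]] cond_exp_adj[OF vA] by simp
  finally show "cs_adj v * \<Delta> v = cs_adj (\<Delta> v) * \<Delta> v" by (simp add: x_def)
qed

text \<open>For a normalizer \<open>v\<close> the element \<open>cs_adj v * \<Delta> v\<close> commutes with \<open>B\<close>, hence lies in \<open>B\<close>;
  evaluating both expectations on it gives \<open>\<Delta>' v = \<Delta> v\<close>.\<close>

lemma cond_exp_unique:
  assumes reg: "regular_inclusion A B" and ab: "abelian B" and masa: "rel_commutant A B = B"
    and F: "approx_id F A" "eventually (\<lambda>u. u \<in> B) F"
    and E: "faithful_cond_exp A B \<Delta>" and E': "faithful_cond_exp A B \<Delta>'" and x: "x \<in> A"
  shows "\<Delta> x = \<Delta>' x"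
proof -
  have inc: "inclusion A B" and dense: "closure (cspan (normalizers A B)) = A"
    using reg by (auto simp: regular_inclusion_def)
  interpret D: cond_exp_approx A B \<Delta> F using inc E F by unfold_locales
  interpret D': cond_exp_approx A B \<Delta>' F using inc E' F by unfold_locales
  note A = D.A
  have norm: "\<Delta> v = \<Delta>' v" if v: "v \<in> normalizers A B" for v
  proof -
    have vA: "v \<in> A" "cs_adj v \<in> A" using normalizersD(1)[OF v] cstar_subalg_adj[OF A] by auto
    note d = cond_exp_of_normalizer[OF D.cond_exp_approx_axioms ab masa v]
      and d' = cond_exp_of_normalizer[OF D'.cond_exp_approx_axioms ab masa v]
    have "cs_adj (\<Delta>' v) * \<Delta> v = \<Delta>' (cs_adj v * \<Delta> v)"
      using D'.cond_exp_mult(2)[OF cond_exp_mem[OF E vA(1)] vA(2)] D'.cond_exp_adj[OF vA(1)] by simp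
    then have 1: "cs_adj (\<Delta>' v) * \<Delta> v = cs_adj (\<Delta> v) * \<Delta> v" using cond_exp_id[OF E' d(2)] d(1) by simp
    have "cs_adj (\<Delta> v) * \<Delta>' v = \<Delta> (cs_adj v * \<Delta>' v)"
      using D.cond_exp_mult(2)[OF cond_exp_mem[OF E' vA(1)] vA(2)] D.cond_exp_adj[OF vA(1)] by simp
    then have 2: "cs_adj (\<Delta> v) * \<Delta>' v = cs_adj (\<Delta>' v) * \<Delta>' v" using cond_exp_id[OF E d'(2)] d'(1) by simp
    have "cs_adj (\<Delta> v - \<Delta>' v) * (\<Delta> v - \<Delta>' v) = 0"
      by (simp add: cs_adj_diff algebra_simps 1 2)
    then show ?thesis using cs_adj_mult_eq_0[of "\<Delta> v - \<Delta>' v"] by simp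
  qed
  have "csubspace {x \<in> A. \<Delta> x = \<Delta>' x}"
    using cstar_subalg_ops[OF A] cond_exp_add[OF E] cond_exp_add[OF E'] cond_exp_scale[OF E] cond_exp_scale[OF E']
      cond_exp_id[OF E cstar_subalg_0[OF D.B]] cond_exp_id[OF E' cstar_subalg_0[OF D.B]]
    by (auto simp: csubspace_def)
  moreover have "normalizers A B \<subseteq> {x \<in> A. \<Delta> x = \<Delta>' x}" using norm by (auto simp: normalizers_def)
  ultimately have "closure (cspan (normalizers A B)) \<subseteq> {x \<in> A. \<Delta> x = \<Delta>' x}"
    using closed_cond_exp_eq[OF E E' A] by (intro closure_minimal cspan_least)
  then show ?thesis using dense x by blast
qed

section \<open>Extending a conditional expectation to the unitization\<close>

lemma norm_diff_square_le:
  fixes p :: "'a::cstar_algebra"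
  assumes "cs_adj p = p" "norm p \<le> t"
  shows "norm ((t\<^sup>2) *\<^sub>R 1 - p * p) \<le> t\<^sup>2"
proof (cases "t = 0")
  case False
  then have t: "t > 0" using assms(2) norm_ge_zero[of p] by linarith
  define q where "q = inverse t *\<^sub>R p"
  have "norm (1 - q * q) \<le> 1"
    using assms t by (intro norm_one_minus_square) (auto simp: q_def cs_adj_scaleR field_simps)
  then have "norm ((t\<^sup>2) *\<^sub>R (1 - q * q)) \<le> t\<^sup>2" by (simp add: mult_left_le)
  moreover have "(t\<^sup>2) *\<^sub>R (q * q) = p * p" 
  proof -
    have "t\<^sup>2 * (inverse t * inverse t) = 1" using t by (simp add: power2_eq_square field_simps)
    then show ?thesis by (simp add: q_def)
  qed
  ultimately show ?thesis by (simp add: scaleR_diff_right)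
qed (use assms in simp)

text \<open>For normal \<open>p\<close> the real part \<open>a\<close> and imaginary part
  \<open>b\<close> satisfy $a^2 + b^2 = p^* p$. Each square contributes an estimate with constant
  $t^2$, whence the factor 2.\<close>

lemma norm_diff_adj_mult_le:
  fixes p :: "'a::cstar_algebra"
  assumes comm: "p * cs_adj p = cs_adj p * p" and n: "norm p \<le> t"
  shows "norm ((2 * t\<^sup>2) *\<^sub>R 1 - cs_adj p * p) \<le> 2 * t\<^sup>2"
proof -
  define a b where "a = (1/2) *\<^sub>R (p + cs_adj p)" and "b = cs_scale (- \<i> / 2) (p - cs_adj p)"
  have sa: "cs_adj a = a" "cs_adj b = b"
    by (simp_all add: a_def b_def cs_adj_simps cs_ring_simps)
  have "norm a \<le> t" "norm b \<le> t"
    using norm_triangle_ineq[of p "cs_adj p"] norm_triangle_ineq4[of p "cs_adj p"] n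
    by (simp_all add: a_def b_def norm_cs_scale norm_divide)
  then have *: "norm ((t\<^sup>2) *\<^sub>R 1 - a * a) \<le> t\<^sup>2" "norm ((t\<^sup>2) *\<^sub>R 1 - b * b) \<le> t\<^sup>2"
    using norm_diff_square_le sa by blast+
  have a2: "a * a = (1/4) *\<^sub>R ((p + cs_adj p) * (p + cs_adj p))" by (simp add: a_def)
  have "(- \<i> / 2) * (- \<i> / 2) = complex_of_real (-1/4)" by simp
  then have "b * b = cs_scale (complex_of_real (-1/4)) ((p - cs_adj p) * (p - cs_adj p))"
    unfolding b_def by (simp only: cs_scale_mult_left cs_scale_mult_right cs_scale_scale)
  then have b2: "b * b = (-1/4) *\<^sub>R ((p - cs_adj p) * (p - cs_adj p))"
    by (simp only: cs_scale_real)
  have "a * a + b * b = (1/4) *\<^sub>R ((p + cs_adj p) * (p + cs_adj p) - (p - cs_adj p) * (p - cs_adj p))"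
    unfolding a2 b2 by (simp add: scaleR_diff_right)
  also have "(p + cs_adj p) * (p + cs_adj p) - (p - cs_adj p) * (p - cs_adj p) = 4 *\<^sub>R (cs_adj p * p)"
  proof -
    have "4 *\<^sub>R y = (y + y) + (y + y)" for y :: 'a
      using scaleR_left_distrib[of 2 2 y] by (simp add: scaleR_2)
    then show ?thesis using comm by (simp add: algebra_simps)
  qed
  finally have "a * a + b * b = cs_adj p * p" by simp
  then have "(2 * t\<^sup>2) *\<^sub>R 1 - cs_adj p * p = ((t\<^sup>2) *\<^sub>R 1 - a * a) + ((t\<^sup>2) *\<^sub>R 1 - b * b)"
    by (simp add: algebra_simps scaleR_2 flip: scaleR_scaleR)
  then show ?thesis using norm_triangle_ineq[of "(t\<^sup>2) *\<^sub>R 1 - a * a" "(t\<^sup>2) *\<^sub>R 1 - b * b"] * by simp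
qed

text \<open>The estimate says that \<open>z = s (1 - x)\<close> with a self-adjoint contraction
  \<open>x\<close>, and \<open>1 - x\<close> has a self-adjoint root. This leads back from the norm
  form of positivity to an actual factorization.\<close>

lemma positive_in_of_norm_le:
  fixes S :: "'a::cstar_algebra set"
  assumes S: "cstar_subalg S" "1 \<in> S" and z: "z \<in> S" "cs_adj z = z"
    and n: "norm (s *\<^sub>R 1 - z) \<le> s"
  shows "positive_in S z"
proof (cases "s = 0")
  case True
  then have "z = 0" using n by simp
  then show ?thesis unfolding positive_in_def using cstar_subalg_0[OF S(1)] by (intro bexI[of _ 0]) auto
next
  case False
  then have s: "s > 0" using n norm_ge_zero[of "s *\<^sub>R 1 - z"] by linarith
  define x where "x = inverse s *\<^sub>R (s *\<^sub>R 1 - z)"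
  have x: "x \<in> S" "cs_adj x = x"
    using S z cstar_subalg_ops[OF S(1)] by (auto simp: x_def cs_adj_simps)
  have "norm x = inverse s * norm (s *\<^sub>R 1 - z)" using s by (simp only: x_def norm_scaleR) simp
  also have "\<dots> \<le> inverse s * s" using n s by (intro mult_left_mono) auto
  finally have nx: "norm x \<le> 1" using s by simp
  obtain g where g: "g \<in> S" "cs_adj g = g" "(1 - g) * (1 - g) = 1 - x"
    using exists_one_minus_sqrt[OF S(1) x nx] by blast
  define w where "w = sqrt s *\<^sub>R (1 - g)"
  have "w \<in> S" using S g cstar_subalg_ops[OF S(1)] by (auto simp: w_def)
  moreover have "cs_adj w * w = s *\<^sub>R ((1 - g) * (1 - g))"
    using s g(2) by (simp add: w_def cs_adj_simps)
  then have "cs_adj w * w = z" using s unfolding g(3) by (simp add: x_def scaleR_diff_right)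
  ultimately show ?thesis unfolding positive_in_def by blast
qed

lemma (in cond_exp_approx) faithful_cond_exp_plus_unit:
  assumes ab: "abelian B" and nu: "\<not> unital_alg A"
  obtains \<Delta>' where "faithful_cond_exp (plus_unit A) (plus_unit B) \<Delta>'"
    "\<And>a l. a \<in> A \<Longrightarrow> \<Delta>' (a + cs_scale l 1) = \<Delta> a + cs_scale l 1"
proof -
  have 1: "1 \<notin> A" using nu by (rule not_unital_imp_one_notin)
  have nuB: "\<not> unital_alg B" using not_unital_subalg[OF inc F FB nu] inclusionD(3)[OF inc] by blast
  note A' = cstar_subalg_plus_unit[OF A] and B' = cstar_subalg_plus_unit[OF B]
  have abB': "abelian (plus_unit B)" unfolding plus_unit_eq by (rule abelian_plus_unit_of[OF ab]) auto
  \<comment> \<open>As \<open>1\<close> is outside \<open>A\<close>, the decomposition is unique and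
    the choice merely names the component in \<open>A\<close>; the scalar remainder is left
    untouched by the extension.\<close>
  define c where "c = (\<lambda>x. SOME a. a \<in> A \<and> (\<exists>l. x = a + cs_scale l 1))"
  have c: "c (a + cs_scale l 1) = a" if a: "a \<in> A" for a l
  proof -
    have "c (a + cs_scale l 1) \<in> A \<and> (\<exists>m. a + cs_scale l 1 = c (a + cs_scale l 1) + cs_scale m 1)"
      unfolding c_def by (rule someI[of _ a]) (use a in blast)
    then show ?thesis using plus_unit_of_unique[OF cstar_subalg_csubspace[OF A] 1 a] by metis
  qed
  define \<Delta>' where "\<Delta>' = (\<lambda>x. \<Delta> (c x) + (x - c x))"
  have D': "\<Delta>' (a + cs_scale l 1) = \<Delta> a + cs_scale l 1" if "a \<in> A" for a l
    by (simp add: \<Delta>'_def c[OF that])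
  have A'E: "\<exists>a l. a \<in> A \<and> x = a + cs_scale l 1" if "x \<in> plus_unit A" for x
    using that by (auto simp: plus_unit_def)
  have B'E: "\<exists>a l. a \<in> B \<and> x = a + cs_scale l 1" if "x \<in> plus_unit B" for x
    using that by (auto simp: plus_unit_def)
  have A'm: "a + cs_scale l 1 \<in> plus_unit A" if "a \<in> A" for a l using that by (auto simp: plus_unit_def)
  have B'm: "a + cs_scale l 1 \<in> plus_unit B" if "a \<in> B" for a l using that by (auto simp: plus_unit_def)
  have one: "1 \<in> plus_unit B" using B'm[OF cstar_subalg_0[OF B], of 1] by simp
  have mem: "\<Delta>' x \<in> plus_unit B" if "x \<in> plus_unit A" for x
    using A'E[OF that] D' B'm cond_exp_mem[OF E] by metis
  have multB: "\<Delta>' x * b = \<Delta> (x * b)" "b * \<Delta>' x = \<Delta> (b * x)" if x: "x \<in> plus_unit A" and b: "b \<in> B" for x b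
  proof -
    obtain a l where a: "a \<in> A" "x = a + cs_scale l 1" using A'E[OF x] by blast
    have ab: "a * b \<in> A" "b * a \<in> A" "cs_scale l b \<in> A" "cs_scale l b \<in> B"
      using a(1) b BA cstar_subalg_ops[OF A] cstar_subalg_ops[OF B] by auto
    have "x * b = a * b + cs_scale l b" "b * x = b * a + cs_scale l b" using a by (simp_all add: cs_ring_simps)
    then show "\<Delta>' x * b = \<Delta> (x * b)" "b * \<Delta>' x = \<Delta> (b * x)"
      using a D' ab cond_exp_mult[OF b a(1)] cond_exp_id[OF E ab(4)] by (simp_all add: cond_exp_add[OF E] cs_ring_simps)
  qed
  have adj: "\<Delta>' (cs_adj x) = cs_adj (\<Delta>' x)" if x: "x \<in> plus_unit A" for x
  proof -
    obtain a l where a: "a \<in> A" "x = a + cs_scale l 1" using A'E[OF x] by blast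
    then have "cs_adj x = cs_adj a + cs_scale (cnj l) 1" by (simp add: cs_adj_simps)
    then show ?thesis using a D' cstar_subalg_adj[OF A] cond_exp_adj[OF a(1)] by (simp add: cs_adj_simps)
  qed
  have add: "\<Delta>' (x + y) = \<Delta>' x + \<Delta>' y" if xy: "x \<in> plus_unit A" "y \<in> plus_unit A" for x y
  proof -
    obtain a l b m where a: "a \<in> A" "x = a + cs_scale l 1" "b \<in> A" "y = b + cs_scale m 1"
      using A'E xy by meson
    then have "x + y = (a + b) + cs_scale (l + m) 1" by (simp add: cs_ring_simps)
    then have "\<Delta>' (x + y) = \<Delta> (a + b) + cs_scale (l + m) 1" using a D' cstar_subalg_add[OF A] by metis
    then show ?thesis using a D' by (simp add: cond_exp_add[OF E] cs_ring_simps)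
  qed
  have scale: "\<Delta>' (cs_scale k x) = cs_scale k (\<Delta>' x)" if x: "x \<in> plus_unit A" for k x
  proof -
    obtain a l where a: "a \<in> A" "x = a + cs_scale l 1" using A'E[OF x] by blast
    then have "cs_scale k x = cs_scale k a + cs_scale (k * l) 1" by (simp add: cs_ring_simps)
    then have "\<Delta>' (cs_scale k x) = \<Delta> (cs_scale k a) + cs_scale (k * l) 1" using a D' cstar_subalg_scale[OF A] by metis
    then show ?thesis using a D' by (simp add: cond_exp_scale[OF E] cs_ring_simps)
  qed
  have norm: "norm (\<Delta>' x) \<le> norm x" if x: "x \<in> plus_unit A" for x
  proof (rule norm_plus_unit_le[OF B nuB mem[OF x]])
    fix b assume b: "b \<in> B"
    have "norm (\<Delta>' x * b) \<le> norm (x * b)"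
      unfolding multB(1)[OF x b] using cond_exp_norm[OF E] mult_plus_unit_mem[OF A x BA[OF b]] by blast
    then show "norm (\<Delta>' x * b) \<le> norm x * norm b" using norm_mult_ineq[of x b] by linarith
  qed simp
  have bimod: "\<Delta>' (b1 * x * b2) = b1 * \<Delta>' x * b2"
    if x: "x \<in> plus_unit A" and b: "b1 \<in> plus_unit B" "b2 \<in> plus_unit B" for x b1 b2
  proof -
    have B'A': "plus_unit B \<subseteq> plus_unit A" using inclusionD(3)[OF inclusion_plus_unit[OF inc]] .
    have L: "\<Delta>' (b * y) = b * \<Delta>' y" if y: "y \<in> plus_unit A" and b: "b \<in> plus_unit B" for b y
    proof -
      obtain d m where d: "d \<in> B" "b = d + cs_scale m 1" using B'E[OF b] by blast
      have "d * y \<in> A" using mult_plus_unit_mem[OF A y BA[OF d(1)]] by blast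
      moreover have "b * y = d * y + cs_scale m y" using d by (simp add: cs_ring_simps)
      moreover have "\<Delta>' (d * y) = d * \<Delta>' y"
        using D'[OF \<open>d * y \<in> A\<close>, of 0] multB(2)[OF y d(1)] by simp
      ultimately show ?thesis
        using add[of "d * y" "cs_scale m y"] scale[OF y] A'm[of "d * y" 0] cstar_subalg_scale[OF A' y] d
        by (simp add: cs_ring_simps)
    qed
    have R: "\<Delta>' (y * b) = \<Delta>' y * b" if y: "y \<in> plus_unit A" and b: "b \<in> plus_unit B" for b y
    proof -
      have "\<Delta>' (cs_adj b * cs_adj y) = cs_adj b * \<Delta>' (cs_adj y)"
        by (intro L cstar_subalg_adj[OF A' y] cstar_subalg_adj[OF B' b])
      then have "cs_adj (\<Delta>' (cs_adj (y * b))) = cs_adj (cs_adj b * cs_adj (\<Delta>' y))"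
        using adj[OF y] by (simp add: cs_adj_mult)
      then show ?thesis
        using adj[of "y * b"] cstar_subalg_mult[OF A' y] B'A' b by (simp add: cs_adj_mult cs_adj_adj subset_iff)
    qed
    have "\<Delta>' (b1 * x * b2) = \<Delta>' (b1 * x) * b2"
      using B'A' b x by (intro R cstar_subalg_mult[OF A']) auto
    then show ?thesis using L[OF x b(1)] by simp
  qed
  have sq: "cs_adj x * x \<in> plus_unit A" if "x \<in> plus_unit A" for x
    using that cstar_subalg_mult[OF A'] cstar_subalg_adj[OF A'] by blast
  \<comment> \<open>Compression by \<open>b\<close> moves the square into \<open>A\<close>, where
    positivity and faithfulness of the original expectation apply.\<close>
  have sandwich: "cs_adj b * \<Delta>' (cs_adj x * x) * b = \<Delta> (cs_adj (x * b) * (x * b))"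
    if x: "x \<in> plus_unit A" and b: "b \<in> B" for x b
  proof -
    have "cs_adj b * (\<Delta>' (cs_adj x * x) * b) = cs_adj b * \<Delta> (cs_adj x * x * b)"
      using multB(1)[OF sq[OF x] b] by simp
    also have "\<dots> = \<Delta> (cs_adj b * (cs_adj x * x * b))"
      using cond_exp_mult(1)[OF cstar_subalg_adj[OF B b]] mult_plus_unit_mem[OF A sq[OF x] BA[OF b]] by simp
    finally show ?thesis by (simp add: cs_adj_mult mult.assoc)
  qed
  \<comment> \<open>The compressions \<open>u * z * u\<close> are expectations of squares from
    \<open>A\<close>, hence of the form \<open>cs_adj p * p\<close> with \<open>p\<close> in the
    abelian \<open>B\<close>, and \<open>norm_diff_adj_mult_le\<close> bounds them uniformly in
    \<open>u\<close>. Tested on \<open>B\<close>, the bound passes to the limit \<open>z\<close>,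
    and a square root in the unitization of \<open>B\<close> gives the factorization.\<close>
  have positive: "positive_in (plus_unit B) (\<Delta>' (cs_adj x * x))" if x: "x \<in> plus_unit A" for x
  proof -
    define z where "z = \<Delta>' (cs_adj x * x)"
    define t where "t = sqrt (norm z)"
    have z: "z \<in> plus_unit B" "cs_adj z = z"
      using mem[OF sq[OF x]] adj[OF sq[OF x]] by (simp_all add: z_def cs_adj_simps)
    have t: "t\<^sup>2 = norm z" "0 \<le> t" by (simp_all add: t_def)
    have "norm ((2 * t\<^sup>2) *\<^sub>R 1 - z) \<le> 2 * t\<^sup>2"
    proof (rule norm_plus_unit_le[OF B nuB])
      show "(2 * t\<^sup>2) *\<^sub>R 1 - z \<in> plus_unit B"
        using one z by (intro cstar_subalg_diff[OF B'] cstar_subalg_scaleR[OF B'])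
      fix b assume b: "b \<in> B"
      have zb: "z * b \<in> B" using mult_plus_unit_mem[OF B z(1) b] by blast
      have "((\<lambda>u. (2 * t\<^sup>2) *\<^sub>R b - u * (z * (u * b))) \<longlongrightarrow> (2 * t\<^sup>2) *\<^sub>R b - z * b) F"
        by (intro tendsto_diff tendsto_const approx_id_tendsto[OF F BA[OF zb]] tendsto_mult_left
            approx_id_left[OF F BA[OF b]])
      moreover have "eventually (\<lambda>u. norm ((2 * t\<^sup>2) *\<^sub>R b - u * (z * (u * b))) \<le> 2 * t\<^sup>2 * norm b) F"
        using FB approx_id_adj[OF F] approx_id_norm[OF F]
      proof eventually_elim
        case (elim u)
        have "x * u \<in> A" using mult_plus_unit_mem[OF A x BA[OF elim(1)]] by blast
        then obtain p where p: "p \<in> B" "u * z * u = cs_adj p * p"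
          using cond_exp_positive[OF E] sandwich[OF x elim(1)] elim(2) unfolding positive_in_def z_def by metis
        have "norm (u * z * u) \<le> norm u * norm z * norm u"
          using norm_mult_ineq[of "u * z" u] mult_right_mono[OF norm_mult_ineq[of u z] norm_ge_zero[of u]] by linarith
        also have "\<dots> \<le> 1 * norm z * 1" using elim(3) by (intro mult_mono) auto
        finally have "(norm p)\<^sup>2 \<le> t\<^sup>2" using p(2) t(1) cstar_identity[of p] by simp
        then have "norm p \<le> t" using t(2) power2_le_imp_le by blast
        moreover have "p * cs_adj p = cs_adj p * p"
          using ab p(1) cstar_subalg_adj[OF B] by (auto simp: abelian_def)
        ultimately have "norm ((2 * t\<^sup>2) *\<^sub>R 1 - u * z * u) \<le> 2 * t\<^sup>2"
          unfolding p(2) by (intro norm_diff_adj_mult_le)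
        then have "norm ((2 * t\<^sup>2) *\<^sub>R 1 - u * z * u) * norm b \<le> 2 * t\<^sup>2 * norm b"
          by (simp add: mult_right_mono)
        moreover have "(2 * t\<^sup>2) *\<^sub>R b - u * (z * (u * b)) = ((2 * t\<^sup>2) *\<^sub>R 1 - u * z * u) * b"
          by (simp add: left_diff_distrib mult.assoc)
        ultimately show ?case using norm_mult_ineq[of "(2 * t\<^sup>2) *\<^sub>R 1 - u * z * u" b] by simp
      qed
      ultimately have "norm ((2 * t\<^sup>2) *\<^sub>R b - z * b) \<le> 2 * t\<^sup>2 * norm b"
        using Lim_norm_ubound[OF approx_id_not_bot[OF F]] by blast
      then show "norm (((2 * t\<^sup>2) *\<^sub>R 1 - z) * b) \<le> 2 * t\<^sup>2 * norm b" by (simp add: left_diff_distrib)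
    qed simp
    then show ?thesis using positive_in_of_norm_le[OF B' one z] by (simp add: z_def)
  qed
  \<comment> \<open>If the expectation of the square vanishes, then \<open>x\<close> kills
    \<open>B\<close>, by the approximate unit all of \<open>A\<close>, and so has norm
    \<open>0\<close>, because the norm is determined by the action on the non-unital
    \<open>A\<close>.\<close>
  have faithful: "x = 0" if x: "x \<in> plus_unit A" and 0: "\<Delta>' (cs_adj x * x) = 0" for x
  proof -
    have xb: "x * b = 0" if b: "b \<in> B" for b
      using cond_exp_faithful[OF E] mult_plus_unit_mem[OF A x BA[OF b]] sandwich[OF x b] 0 by simp
    have xA: "x * a = 0" if a: "a \<in> A" for a
    proof (rule limit_unique)
      show "((\<lambda>u. x * (u * a)) \<longlongrightarrow> x * a) F" by (intro tendsto_mult_left approx_id_left[OF F a])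
      have "eventually (\<lambda>u. x * (u * a) = 0) F"
        using FB by eventually_elim (use xb in \<open>simp flip: mult.assoc\<close>)
      then show "((\<lambda>u. x * (u * a)) \<longlongrightarrow> 0) F" by (simp add: tendsto_eventually)
    qed
    have "norm x \<le> 0" by (rule norm_plus_unit_le[OF A nu x]) (simp_all add: xA)
    then show ?thesis by simp
  qed
  have "faithful_cond_exp (plus_unit A) (plus_unit B) \<Delta>'"
    unfolding faithful_cond_exp_def
    using mem add scale norm positive bimod faithful
    by (auto simp: cond_exp_id[OF E] D'[OF BA] dest!: B'E)
  then show ?thesis using D' that by blast
qed

lemma cartan_plus_unit:
  assumes car: "cartan A B" and E: "faithful_cond_exp A B \<Delta>" and nu: "\<not> unital_alg A"
    and F: "approx_id F A" "eventually (\<lambda>u. u \<in> B) F"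
  shows "cartan (plus_unit A) (plus_unit B)"
proof -
  have reg: "regular_inclusion A B" and ab: "abelian B" and masa: "rel_commutant A B = B"
    using car by (auto simp: cartan_def)
  have inc: "inclusion A B" using reg by (simp add: regular_inclusion_def)
  interpret cond_exp_approx A B \<Delta> F using inc E F by unfold_locales
  have "\<exists>\<Delta>'. faithful_cond_exp (plus_unit A) (plus_unit B) \<Delta>'"
    by (rule faithful_cond_exp_plus_unit[OF ab nu]) (rule exI)
  moreover have "abelian (plus_unit B)" unfolding plus_unit_eq by (rule abelian_plus_unit_of[OF ab]) auto
  ultimately show ?thesis
    unfolding cartan_def using regular_inclusion_plus_unit[OF reg F FB] masa rel_commutant_plus_unit[of A B] by auto
qed

section \<open>Cartan envelopes\<close>

lemma star_hom_mono: "star_hom C \<alpha> A \<Longrightarrow> C' \<subseteq> C \<Longrightarrow> \<alpha> ` C' \<subseteq> A' \<Longrightarrow> star_hom C' \<alpha> A'"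
  unfolding star_hom_def by (intro conjI) (blast | simp add: subset_iff)+

lemma star_hom_tendsto:
  assumes h: "star_hom C \<alpha> A" and C: "cstar_subalg C"
    and f: "eventually (\<lambda>u. f u \<in> C) F" "(f \<longlongrightarrow> x) F" and x: "x \<in> C"
  shows "((\<lambda>u. \<alpha> (f u)) \<longlongrightarrow> \<alpha> x) F"
proof -
  have "((\<lambda>u. \<alpha> (f u) - \<alpha> x) \<longlongrightarrow> 0) F"
  proof (rule Lim_null_comparison)
    show "\<forall>\<^sub>F u in F. norm (\<alpha> (f u) - \<alpha> x) \<le> norm (f u - x)"
      using f(1)
    proof eventually_elim
      case (elim u)
      show ?case
        using norm_star_hom_le[OF C h cstar_subalg_diff[OF C elim x]] star_hom_diff[OF h C elim x] by simp
    qed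
    show "((\<lambda>u. norm (f u - x)) \<longlongrightarrow> 0) F" using f(2) by (simp add: LIM_zero_iff tendsto_norm_zero)
  qed
  then show ?thesis by (simp add: LIM_zero_iff)
qed

lemma approx_id_star_hom:
  assumes h: "star_hom C \<alpha> A" and C: "cstar_subalg C"
    and F: "approx_id F C" "eventually (\<lambda>u. u \<in> C) F"
  shows "approx_id (filtermap \<alpha> F) (\<alpha> ` C)"
proof -
  have "eventually (\<lambda>u. norm (\<alpha> u) \<le> 1 \<and> cs_adj (\<alpha> u) = \<alpha> u) F"
    using F(2) approx_id_norm[OF F(1)] approx_id_adj[OF F(1)]
  proof eventually_elim
    case (elim u)
    then show ?case using norm_star_hom_le[OF C h elim(1)] star_hom_adj[OF h elim(1)] by simp
  qed
  moreover have "((\<lambda>u. \<alpha> u * \<alpha> c) \<longlongrightarrow> \<alpha> c) F \<and> ((\<lambda>u. \<alpha> c * \<alpha> u) \<longlongrightarrow> \<alpha> c) F" if c: "c \<in> C" for c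
  proof
    have ev: "eventually (\<lambda>u. u * c \<in> C) F" "eventually (\<lambda>u. c * u \<in> C) F"
      using F(2) by (eventually_elim, use c cstar_subalg_mult[OF C] in blast)+
    show "((\<lambda>u. \<alpha> u * \<alpha> c) \<longlongrightarrow> \<alpha> c) F"
      by (rule Lim_transform_eventually[OF star_hom_tendsto[OF h C ev(1) approx_id_left[OF F(1) c] c]])
        (use F(2) in eventually_elim, simp add: star_hom_mult[OF h] c)
    show "((\<lambda>u. \<alpha> c * \<alpha> u) \<longlongrightarrow> \<alpha> c) F"
      by (rule Lim_transform_eventually[OF star_hom_tendsto[OF h C ev(2) approx_id_right[OF F(1) c] c]])
        (use F(2) in eventually_elim, simp add: star_hom_mult[OF h] c)
  qed
  ultimately show ?thesis
    using approx_id_not_bot[OF F(1)]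
    by (auto simp: approx_id_def eventually_filtermap filterlim_filtermap filtermap_bot_iff)
qed

text \<open>Squaring the approximate unit turns the two-sided module property of \<open>\<Delta>\<close>
  into a one-sided statement, as \<open>B\<close> is abelian.\<close>

lemma approx_id_square:
  assumes E: "faithful_cond_exp A B \<Delta>" and inc: "inclusion A B" and ab: "abelian B"
    and F: "approx_id F X" "eventually (\<lambda>u. u \<in> B) F" and X: "X \<subseteq> A"
  shows "approx_id (filtermap (\<lambda>u. u * u) F) (cstar_gen (X \<union> cstar_gen (\<Delta> ` X)))"
proof -
  let ?G = "filtermap (\<lambda>u. u * u) F"
  note A = inclusionD(1)[OF inc] and BA = subsetD[OF inclusionD(3)[OF inc]]
  have base: "?G \<noteq> bot" "eventually (\<lambda>u. norm (u * u) \<le> 1 \<and> cs_adj (u * u) = u * u) F"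
  proof -
    show "eventually (\<lambda>u. norm (u * u) \<le> 1 \<and> cs_adj (u * u) = u * u) F"
      using approx_id_norm[OF F(1)] approx_id_adj[OF F(1)]
    proof eventually_elim
      case (elim u)
      then show ?case
        using norm_mult_ineq[of u u] mult_le_one[of "norm u" "norm u"] by (simp add: cs_adj_mult)
    qed
  qed (use approx_id_not_bot[OF F(1)] in \<open>simp add: filtermap_bot_iff\<close>)
  have 1: "approx_id ?G X"
  proof -
    have "((\<lambda>u. u * u * c) \<longlongrightarrow> c) F \<and> ((\<lambda>u. c * (u * u)) \<longlongrightarrow> c) F" if c: "c \<in> X" for c
    proof
      show "((\<lambda>u. u * u * c) \<longlongrightarrow> c) F"
        using approx_id_tendsto[OF F(1) c approx_id_left[OF F(1) c]] by (simp add: mult.assoc)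
      have *: "((\<lambda>u. c * u - c) \<longlongrightarrow> 0) F" using approx_id_right[OF F(1) c] by (simp add: LIM_zero_iff)
      have "((\<lambda>u. (c * u - c) * u) \<longlongrightarrow> 0) F"
      proof (rule Lim_null_comparison)
        show "\<forall>\<^sub>F u in F. norm ((c * u - c) * u) \<le> norm (c * u - c)"
          using approx_id_norm[OF F(1)]
        proof eventually_elim
          case (elim u)
          show ?case
            using norm_mult_ineq[of "c * u - c" u] mult_left_mono[OF elim norm_ge_zero, of "c * u - c"] by simp
        qed
        show "((\<lambda>u. norm (c * u - c)) \<longlongrightarrow> 0) F" using * by (rule tendsto_norm_zero)
      qed
      then have "((\<lambda>u. (c * u - c) * u + c * u) \<longlongrightarrow> 0 + c) F"
        by (intro tendsto_add approx_id_right[OF F(1) c])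
      then show "((\<lambda>u. c * (u * u)) \<longlongrightarrow> c) F" by (simp add: algebra_simps)
    qed
    then show ?thesis using base by (simp add: approx_id_def eventually_filtermap filterlim_filtermap)
  qed
  have 2: "approx_id ?G (\<Delta> ` X)"
  proof -
    have "((\<lambda>u. u * u * \<Delta> c) \<longlongrightarrow> \<Delta> c) F \<and> ((\<lambda>u. \<Delta> c * (u * u)) \<longlongrightarrow> \<Delta> c) F" if c: "c \<in> X" for c
    proof -
      have cA: "c \<in> A" using c X by blast
      have ev: "eventually (\<lambda>u. u * (c * u) \<in> A) F"
        using F(2) by eventually_elim (use cA BA cstar_subalg_mult[OF A] in blast)
      have lim: "((\<lambda>u. \<Delta> (u * (c * u))) \<longlongrightarrow> \<Delta> c) F"
        by (rule cond_exp_tendsto[OF E A ev _ cA])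
          (rule approx_id_tendsto[OF F(1) c approx_id_right[OF F(1) c]])
      have "eventually (\<lambda>u. \<Delta> (u * (c * u)) = u * u * \<Delta> c \<and> \<Delta> (u * (c * u)) = \<Delta> c * (u * u)) F"
        using F(2)
      proof eventually_elim
        case (elim u)
        have "\<Delta> (u * (c * u)) = u * \<Delta> c * u"
          using cond_exp_bimodule[OF E cA elim elim] by (simp add: mult.assoc)
        moreover have "u * \<Delta> c = \<Delta> c * u"
          using ab elim cond_exp_mem[OF E cA] by (auto simp: abelian_def)
        ultimately show ?case by (metis mult.assoc)
      qed
      then have "eventually (\<lambda>u. \<Delta> (u * (c * u)) = u * u * \<Delta> c) F"
        "eventually (\<lambda>u. \<Delta> (u * (c * u)) = \<Delta> c * (u * u)) F"
        by (auto elim: eventually_mono)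
      then show ?thesis by (intro conjI Lim_transform_eventually[OF lim])
    qed
    then show ?thesis using base by (simp add: approx_id_def eventually_filtermap filterlim_filtermap)
  qed
  have "approx_id ?G (X \<union> cstar_gen (\<Delta> ` X))"
    using 1 approx_id_cstar_gen[OF 2] by (auto simp: approx_id_def)
  then show ?thesis by (rule approx_id_cstar_gen)
qed

lemma ext_hom_plus_unit:
  assumes C: "csubspace C" and nC: "1 \<notin> C" and nu: "\<not> unital_alg A" and A: "0 \<in> A" and c: "c \<in> C"
  shows "ext_hom C \<alpha> A (c + cs_scale l 1) = \<alpha> c + cs_scale l 1"
proof -
  have "(THE p. fst p \<in> C \<and> c + cs_scale l 1 = fst p + cs_scale (snd p) 1) = (c, l)"
  proof (rule the_equality)
    fix p assume "fst p \<in> C \<and> c + cs_scale l 1 = fst p + cs_scale (snd p) 1"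
    then show "p = (c, l)" using plus_unit_of_unique[OF C nC c, of "fst p" l "snd p"] by (simp add: prod_eq_iff)
  qed (use c in simp)
  then show ?thesis using nu unit_of_plus_unit[OF A] by (simp add: ext_hom_def unitization_def)
qed

lemma csubspace_star_hom_image:
  assumes h: "star_hom C \<alpha> A" and C: "cstar_subalg C" and D: "csubspace D" "D \<subseteq> C"
  shows "csubspace (\<alpha> ` D)"
proof -
  have "0 \<in> \<alpha> ` D" using csubspace_0[OF D(1)] star_hom_0[OF h C] by force
  moreover have "\<alpha> x + \<alpha> y \<in> \<alpha> ` D" if "x \<in> D" "y \<in> D" for x y
    using that D star_hom_add[OF h] csubspace_add[OF D(1)] by (metis imageI subsetD)
  moreover have "cs_scale a (\<alpha> x) \<in> \<alpha> ` D" if "x \<in> D" for a x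
    using that D star_hom_scale[OF h] csubspace_scale[OF D(1)] by (metis imageI subsetD)
  ultimately show ?thesis by (auto simp: csubspace_def)
qed

lemma cartan_envelopeD:
  assumes "cartan_envelope C D A B \<alpha>"
  obtains \<Delta> where "regular_inclusion A B" "abelian B" "rel_commutant A B = B"
    "star_hom C \<alpha> A" "inj_on \<alpha> C" "regular_hom C D \<alpha> A B" "\<alpha> ` D \<subseteq> B"
    "ideal_intersection_property B (\<alpha> ` D)" "faithful_cond_exp A B \<Delta>"
    "B = cstar_gen (\<Delta> ` \<alpha> ` C)" "A = cstar_gen (\<alpha> ` C \<union> B)"
  using assms unfolding cartan_envelope_def cartan_def by blast

text \<open>Two points go beyond extending by scalars. \<open>A\<close> must be non-unital, so that
  its unitization really adds the ambient \<open>1\<close>. And a normalizer of the unitized pair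
  need not lie in \<open>C\<close>, so regularity of \<open>\<alpha>\<close> does not apply to it
  directly.\<close>

theorem cartan_envelope_unitization:
  fixes C D :: "'a::cstar_algebra set" and A B :: "'b::cstar_algebra set"
  assumes reg: "regular_inclusion C D" and nu: "\<not> unital_alg C"
    and F: "approx_id F C" "eventually (\<lambda>u. u \<in> D) F" and env: "cartan_envelope C D A B \<alpha>"
  shows "cartan_envelope (plus_unit C) (plus_unit D) (unitization A)
    (plus_unit_of B (unit_of (unitization A))) (ext_hom C \<alpha> A)"
proof -
  from env obtain \<Delta> where regA: "regular_inclusion A B" and ab: "abelian B"
    and h: "star_hom C \<alpha> A" and inj: "inj_on \<alpha> C" and rh: "regular_hom C D \<alpha> A B" and DB: "\<alpha> ` D \<subseteq> B"
    and iip: "ideal_intersection_property B (\<alpha> ` D)" and E: "faithful_cond_exp A B \<Delta>"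
    and Bgen: "B = cstar_gen (\<Delta> ` \<alpha> ` C)" and Agen: "A = cstar_gen (\<alpha> ` C \<union> B)"
    by (rule cartan_envelopeD)
  have inc: "inclusion C D" and incA: "inclusion A B"
    using reg regA by (auto simp: regular_inclusion_def)
  note C = inclusionD(1)[OF inc] and D = inclusionD(2)[OF inc] and DC = inclusionD(3)[OF inc]
  note A = inclusionD(1)[OF incA] and B = inclusionD(2)[OF incA] and BA = inclusionD(3)[OF incA]
  have nC: "1 \<notin> C" using nu by (rule not_unital_imp_one_notin)
  have FC: "eventually (\<lambda>u. u \<in> C) F" using F(2) by (rule eventually_mono) (use DC in blast)
  define G where "G = filtermap (\<lambda>u. u * u) (filtermap \<alpha> F)"
  have "approx_id G (cstar_gen (\<alpha> ` C \<union> cstar_gen (\<Delta> ` \<alpha> ` C)))"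
    unfolding G_def
  proof (rule approx_id_square[OF E incA ab approx_id_star_hom[OF h C F(1) FC]])
    show "\<forall>\<^sub>F u in filtermap \<alpha> F. u \<in> B"
      using F(2) unfolding eventually_filtermap by (rule eventually_mono) (use DB in blast)
    show "\<alpha> ` C \<subseteq> A" using star_hom_mem[OF h] by blast
  qed
  then have G: "approx_id G A" using Bgen Agen by simp
  have GD: "eventually (\<lambda>u. u \<in> \<alpha> ` D) G"
    unfolding G_def eventually_filtermap using F(2)
  proof eventually_elim
    case (elim u)
    have "\<alpha> u * \<alpha> u = \<alpha> (u * u)" using star_hom_mult[OF h] DC elim by (metis subsetD)
    then show ?case using cstar_subalg_mult[OF D elim elim] by blast
  qed
  have GB: "eventually (\<lambda>u. u \<in> B) G" using GD by (rule eventually_mono) (use DB in blast)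
  \<comment> \<open>A unit \<open>e\<close> is the limit of \<open>u * e = u\<close> with
    \<open>u\<close> in the closed image of \<open>D\<close>; so it has a preimage there, which
    injectivity makes a left unit of \<open>C\<close>.\<close>
  have nuA: "\<not> unital_alg A"
  proof
    assume "unital_alg A"
    then obtain e where e: "e \<in> A" "\<And>x. x \<in> A \<Longrightarrow> x * e = x" "\<And>x. x \<in> A \<Longrightarrow> e * x = x"
      by (auto simp: unital_alg_def)
    have "closed (\<alpha> ` D)" using closed_star_hom_image[OF C h inj cstar_subalg_closed[OF D] DC] .
    moreover have "eventually (\<lambda>u. u * e \<in> \<alpha> ` D) G"
      using GD GB by eventually_elim (use e(2) BA in \<open>simp add: subset_iff\<close>)
    ultimately have "e \<in> \<alpha> ` D"
      using closed_limit[OF _ approx_id_not_bot[OF G] _ approx_id_left[OF G e(1)]] by blast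
    then obtain d where d: "d \<in> D" "e = \<alpha> d" by blast
    have dC: "d \<in> C" using d DC by blast
    have "d * c = c" if c: "c \<in> C" for c
    proof (rule inj_onD[OF inj _ cstar_subalg_mult[OF C dC c] c])
      show "\<alpha> (d * c) = \<alpha> c"
        using star_hom_mult[OF h dC c] e(3)[OF star_hom_mem[OF h c]] d(2) by simp
    qed
    then show False using nu unital_algI[OF C dC] by blast
  qed
  have nuB: "\<not> unital_alg B" using not_unital_subalg[OF incA G GB nuA order_refl BA] .
  have 1: "1 \<notin> A" using nuA by (rule not_unital_imp_one_notin)
  define \<beta> where "\<beta> = ext_hom C \<alpha> A"
  have \<beta>: "\<beta> (c + cs_scale l 1) = \<alpha> c + cs_scale l 1" if "c \<in> C" for c l
    unfolding \<beta>_def using ext_hom_plus_unit[OF cstar_subalg_csubspace[OF C] nC nuA cstar_subalg_0[OF A] that] .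
  have \<beta>C: "\<beta> c = \<alpha> c" if "c \<in> C" for c using \<beta>[OF that, of 0] by simp
  have \<beta>1: "\<beta> 1 = 1" using \<beta>[OF cstar_subalg_0[OF C], of 1] star_hom_0[OF h C] by simp
  note C' = cstar_subalg_plus_unit[OF C] and D' = cstar_subalg_plus_unit[OF D]
  note A' = cstar_subalg_plus_unit[OF A] and B' = cstar_subalg_plus_unit[OF B]
  have PE: "\<exists>c l. c \<in> S \<and> x = c + cs_scale l 1" if "x \<in> plus_unit S" for x and S :: "'z::cstar_algebra set"
    using that by (auto simp: plus_unit_def)
  have PI: "c + cs_scale l 1 \<in> plus_unit S" if "c \<in> S" for c l and S :: "'z::cstar_algebra set"
    using that by (auto simp: plus_unit_def)
  have sub: "S \<subseteq> plus_unit S" for S :: "'z::cstar_algebra set"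
    unfolding plus_unit_eq by (rule subset_plus_unit_of)
  have one: "1 \<in> plus_unit S" if "cstar_subalg S" for S :: "'z::cstar_algebra set"
    unfolding plus_unit_eq by (rule unit_in_plus_unit_of[OF cstar_subalg_0[OF that]])
  have h': "star_hom (plus_unit C) \<beta> (plus_unit A)"
    unfolding star_hom_def
  proof (intro conjI ballI allI subsetI)
    fix y assume "y \<in> \<beta> ` plus_unit C"
    then obtain x where x: "x \<in> plus_unit C" "y = \<beta> x" by blast
    obtain c l where "c \<in> C" "x = c + cs_scale l 1" using PE[OF x(1)] by blast
    with x(2) show "y \<in> plus_unit A" using PI[OF star_hom_mem[OF h]] by (simp add: \<beta>)
  next
    fix x y assume "x \<in> plus_unit C" "y \<in> plus_unit C"
    then obtain a l b m where x: "a \<in> C" "x = a + cs_scale l 1" and y: "b \<in> C" "y = b + cs_scale m 1"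
      using PE by meson
    have "x + y = (a + b) + cs_scale (l + m) 1" by (simp add: x y cs_ring_simps)
    then show "\<beta> (x + y) = \<beta> x + \<beta> y"
      using \<beta>[OF cstar_subalg_add[OF C x(1) y(1)], of "l + m"] \<beta>[OF x(1), of l] \<beta>[OF y(1), of m]
        star_hom_add[OF h x(1) y(1)] x(2) y(2) by (simp add: cs_ring_simps)
    have xy: "x * y = (a * b + cs_scale m a + cs_scale l b) + cs_scale (l * m) 1"
      unfolding x y by (rule mult_plus_unit_of[of 1 C]) (use x y in auto)
    note [simp] = cstar_subalg_ops[OF C] x(1) y(1)
    have "\<beta> (x * y) = (\<alpha> a * \<alpha> b + cs_scale m (\<alpha> a) + cs_scale l (\<alpha> b)) + cs_scale (l * m) 1"
      unfolding xy by (subst \<beta>) (simp_all add: star_homD(2-4)[OF h])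
    also have "\<dots> = (\<alpha> a + cs_scale l 1) * (\<alpha> b + cs_scale m 1)"
      by (rule mult_plus_unit_of[of 1 A, symmetric]) (simp_all add: star_hom_mem[OF h])
    finally show "\<beta> (x * y) = \<beta> x * \<beta> y" using \<beta>[OF x(1), of l] \<beta>[OF y(1), of m] x(2) y(2) by simp
  next
    fix k x assume "x \<in> plus_unit C"
    then obtain a l where x: "a \<in> C" "x = a + cs_scale l 1" using PE by meson
    have "cs_scale k x = cs_scale k a + cs_scale (k * l) 1" by (simp add: x cs_ring_simps)
    then show "\<beta> (cs_scale k x) = cs_scale k (\<beta> x)"
      using \<beta>[OF cstar_subalg_scale[OF C x(1)], of k "k * l"] \<beta>[OF x(1), of l] star_hom_scale[OF h x(1)] x(2)
      by (simp add: cs_ring_simps)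
  next
    fix x assume "x \<in> plus_unit C"
    then obtain a l where x: "a \<in> C" "x = a + cs_scale l 1" using PE by meson
    have "cs_adj x = cs_adj a + cs_scale (cnj l) 1" by (simp add: x cs_adj_simps)
    then show "\<beta> (cs_adj x) = cs_adj (\<beta> x)"
      using \<beta>[OF cstar_subalg_adj[OF C x(1)], of "cnj l"] \<beta>[OF x(1), of l] star_hom_adj[OF h x(1)] x(2)
      by (simp add: cs_adj_simps)
  qed
  have inj': "inj_on \<beta> (plus_unit C)"
  proof (rule inj_onI)
    fix x y assume "x \<in> plus_unit C" "y \<in> plus_unit C" and eq: "\<beta> x = \<beta> y"
    then obtain a l b m where x: "a \<in> C" "x = a + cs_scale l 1" and y: "b \<in> C" "y = b + cs_scale m 1"
      using PE by meson
    have "\<alpha> a + cs_scale l 1 = \<alpha> b + cs_scale m 1" using eq x y \<beta> by simp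
    then have "\<alpha> a = \<alpha> b \<and> l = m"
      using plus_unit_of_unique[OF cstar_subalg_csubspace[OF A] 1] star_hom_mem[OF h] x(1) y(1) by blast
    then show "x = y" using inj_onD[OF inj] x y by blast
  qed
  have imD: "\<beta> ` plus_unit D = plus_unit (\<alpha> ` D)"
  proof
    show "\<beta> ` plus_unit D \<subseteq> plus_unit (\<alpha> ` D)"
      using \<beta> DC PI by (auto simp: plus_unit_def) (metis imageI subsetD)
    show "plus_unit (\<alpha> ` D) \<subseteq> \<beta> ` plus_unit D"
    proof
      fix y assume "y \<in> plus_unit (\<alpha> ` D)"
      then obtain d l where d: "d \<in> D" "y = \<alpha> d + cs_scale l 1" by (auto simp: plus_unit_def)
      then have "y = \<beta> (d + cs_scale l 1)" using \<beta> DC by auto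
      then show "y \<in> \<beta> ` plus_unit D" using PI[OF d(1)] by blast
    qed
  qed
  have imDB: "\<beta> ` plus_unit D \<subseteq> plus_unit B"
    unfolding imD using DB by (auto simp: plus_unit_def)
  \<comment> \<open>The cuts \<open>v * d\<close> and \<open>d * v\<close> with \<open>d\<close> in
    \<open>D\<close> are normalizers of the original pair, so their images normalize
    \<open>B\<close>. Since \<open>b\<close> in \<open>B\<close> is the limit of
    \<open>u * b * u\<close> with \<open>u\<close> in the image of \<open>D\<close>, conjugation of
    \<open>b\<close> by \<open>w\<close> is a limit of conjugations by images of cuts.\<close>
  have rh': "regular_hom (plus_unit C) (plus_unit D) \<beta> (plus_unit A) (plus_unit B)"
    unfolding regular_hom_def
  proof (intro subsetI, elim imageE)
    fix w v assume v: "v \<in> normalizers (plus_unit C) (plus_unit D)" and w: "w = \<beta> v"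
    have vC: "v \<in> plus_unit C" using normalizersD(1)[OF v] .
    have Dinter: "D = plus_unit D \<inter> C"
      unfolding plus_unit_eq using inter_plus_unit_of[OF cstar_subalg_csubspace[OF C] DC nC] by simp
    have ideal: "x * a \<in> C \<and> a * x \<in> C" if "a \<in> C" "x \<in> plus_unit C" for a x
      using mult_plus_unit_mem[OF C that(2,1)] by blast
    have DC': "plus_unit D \<subseteq> plus_unit C" using inclusionD(3)[OF inclusion_plus_unit[OF inc]] .
    have N: "\<alpha> (v * d) \<in> normalizers A B" "\<alpha> (d * v) \<in> normalizers A B" if d: "d \<in> D" for d
      using normalizer_mult_ideal[OF C' D' DC' sub ideal Dinter v d] rh by (auto simp: regular_hom_def)
    have \<alpha>v: "\<alpha> (v * d) = w * \<alpha> d" "\<alpha> (d * v) = \<alpha> d * w" if d: "d \<in> D" for d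
    proof -
      have dC: "d \<in> C" "d \<in> plus_unit C" using d DC sub by auto
      show "\<alpha> (v * d) = w * \<alpha> d" "\<alpha> (d * v) = \<alpha> d * w"
        using star_hom_mult[OF h' vC dC(2)] star_hom_mult[OF h' dC(2) vC] \<beta>C mult_plus_unit_mem[OF C vC dC(1)] dC(1)
        unfolding w by metis+
    qed
    have wb: "w * b * cs_adj w \<in> B" "cs_adj w * b * w \<in> B" if b: "b \<in> B" for b
    proof -
      have lim: "((\<lambda>u. u * (b * u)) \<longlongrightarrow> b) G"
        using b BA by (intro approx_id_tendsto[OF G] approx_id_right[OF G]) auto
      show "w * b * cs_adj w \<in> B"
      proof (rule closed_limit[OF cstar_subalg_closed[OF B] approx_id_not_bot[OF G]])
        show "((\<lambda>u. w * (u * (b * u)) * cs_adj w) \<longlongrightarrow> w * b * cs_adj w) G"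
          by (intro tendsto_mult_right tendsto_mult_left lim)
        show "\<forall>\<^sub>F u in G. w * (u * (b * u)) * cs_adj w \<in> B"
          using GD approx_id_adj[OF G]
        proof eventually_elim
          case (elim u)
          then obtain d where d: "d \<in> D" "u = \<alpha> d" by blast
          have "\<alpha> (v * d) * b * cs_adj (\<alpha> (v * d)) \<in> B" using normalizersD(2)[OF N(1)[OF d(1)] b] .
          then show ?case using \<alpha>v(1)[OF d(1)] d(2) elim(2) by (simp add: cs_adj_mult mult.assoc)
        qed
      qed
      show "cs_adj w * b * w \<in> B"
      proof (rule closed_limit[OF cstar_subalg_closed[OF B] approx_id_not_bot[OF G]])
        show "((\<lambda>u. cs_adj w * (u * (b * u)) * w) \<longlongrightarrow> cs_adj w * b * w) G"
          by (intro tendsto_mult_right tendsto_mult_left lim)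
        show "\<forall>\<^sub>F u in G. cs_adj w * (u * (b * u)) * w \<in> B"
          using GD approx_id_adj[OF G]
        proof eventually_elim
          case (elim u)
          then obtain d where d: "d \<in> D" "u = \<alpha> d" by blast
          have "cs_adj (\<alpha> (d * v)) * b * \<alpha> (d * v) \<in> B" using normalizersD(3)[OF N(2)[OF d(1)] b] .
          then show ?case using \<alpha>v(2)[OF d(1)] d(2) elim(2) by (simp add: cs_adj_mult mult.assoc)
        qed
      qed
    qed
    \<comment> \<open>The scalar part of an element of the enlarged \<open>B\<close> contributes
      multiples of \<open>w * cs_adj w\<close> and \<open>cs_adj w * w\<close>; these are controlled
      because \<open>1\<close> belongs to \<open>plus_unit D\<close>.\<close>
    have "v * 1 * cs_adj v \<in> plus_unit D" "cs_adj v * 1 * v \<in> plus_unit D"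
      using normalizersD(2,3)[OF v one[OF D]] by auto
    then have "\<beta> (v * cs_adj v) \<in> plus_unit B" "\<beta> (cs_adj v * v) \<in> plus_unit B" using imDB by auto
    then have ww: "w * cs_adj w \<in> plus_unit B" "cs_adj w * w \<in> plus_unit B"
      using star_hom_mult[OF h'] star_hom_adj[OF h' vC] vC cstar_subalg_adj[OF C' vC] w by auto
    have "w * b * cs_adj w \<in> plus_unit B \<and> cs_adj w * b * w \<in> plus_unit B" if b: "b \<in> plus_unit B" for b
    proof -
      obtain b0 m where b0: "b0 \<in> B" "b = b0 + cs_scale m 1" using PE[OF b] by blast
      have "w * b0 * cs_adj w + cs_scale m (w * cs_adj w) \<in> plus_unit B"
        "cs_adj w * b0 * w + cs_scale m (cs_adj w * w) \<in> plus_unit B"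
        using wb[OF b0(1)] ww sub by (auto intro!: cstar_subalg_add[OF B'] cstar_subalg_scale[OF B'])
      then show ?thesis using b0(2) by (simp add: cs_ring_simps)
    qed
    then show "w \<in> normalizers (plus_unit A) (plus_unit B)"
      using star_hom_mem[OF h' vC] w by (auto simp: normalizers_def)
  qed
  have iip': "ideal_intersection_property (plus_unit B) (\<beta> ` plus_unit D)"
    unfolding imD
    using ideal_intersection_property_plus_unit[OF B nuB
        csubspace_star_hom_image[OF h C cstar_subalg_csubspace[OF D] DC] DB] iip by blast
  interpret cond: cond_exp_approx A B \<Delta> G using incA E G GB by unfold_locales
  obtain \<Delta>' where E': "faithful_cond_exp (plus_unit A) (plus_unit B) \<Delta>'"
    and \<Delta>': "\<And>a l. a \<in> A \<Longrightarrow> \<Delta>' (a + cs_scale l 1) = \<Delta> a + cs_scale l 1"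
    by (rule cond.faithful_cond_exp_plus_unit[OF ab nuA]) blast
  have Bgen': "plus_unit B = cstar_gen (\<Delta>' ` \<beta> ` plus_unit C)"
  proof
    let ?K = "cstar_gen (\<Delta>' ` \<beta> ` plus_unit C)"
    have "\<Delta> (\<alpha> c) \<in> ?K" if c: "c \<in> C" for c
    proof -
      have "\<Delta> (\<alpha> c) = \<Delta>' (\<beta> c)" using \<Delta>'[OF star_hom_mem[OF h c], of 0] \<beta>C[OF c] by simp
      moreover have "\<Delta>' (\<beta> c) \<in> \<Delta>' ` \<beta> ` plus_unit C" using c sub by blast
      ultimately show ?thesis using cstar_gen_superset by (metis subsetD)
    qed
    then have "B \<subseteq> ?K" by (subst Bgen) (intro cstar_gen_least[OF cstar_subalg_gen], auto)
    moreover have "1 \<in> ?K"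
    proof -
      have "1 = \<Delta>' (\<beta> 1)" using cond_exp_id[OF E' one[OF B]] \<beta>1 by simp
      moreover have "\<Delta>' (\<beta> 1) \<in> \<Delta>' ` \<beta> ` plus_unit C" using one[OF C] by blast
      ultimately show ?thesis using cstar_gen_superset by (metis subsetD)
    qed
    ultimately show "plus_unit B \<subseteq> ?K"
      unfolding plus_unit_eq by (intro plus_unit_of_subset[OF cstar_subalg_csubspace[OF cstar_subalg_gen]])
    show "?K \<subseteq> plus_unit B"
      using cond_exp_mem[OF E'] star_hom_mem[OF h'] by (intro cstar_gen_least[OF B']) auto
  qed
  have Agen': "plus_unit A = cstar_gen (\<beta> ` plus_unit C \<union> plus_unit B)"
  proof
    let ?K = "cstar_gen (\<beta> ` plus_unit C \<union> plus_unit B)"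
    have K: "\<beta> ` plus_unit C \<subseteq> ?K" "plus_unit B \<subseteq> ?K"
      using cstar_gen_superset[of "\<beta> ` plus_unit C \<union> plus_unit B"] by simp_all
    have "\<alpha> c \<in> ?K" if c: "c \<in> C" for c
    proof -
      have "\<beta> c \<in> \<beta> ` plus_unit C" using c sub by blast
      then show ?thesis using K(1) \<beta>C[OF c] by auto
    qed
    moreover note K(2)
    ultimately have "A \<subseteq> ?K"
      using sub[of B] by (subst Agen) (intro cstar_gen_least[OF cstar_subalg_gen], auto)
    moreover have "1 \<in> ?K" using \<open>plus_unit B \<subseteq> ?K\<close> one[OF B] by blast
    ultimately show "plus_unit A \<subseteq> ?K"
      unfolding plus_unit_eq by (intro plus_unit_of_subset[OF cstar_subalg_csubspace[OF cstar_subalg_gen]])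
    show "?K \<subseteq> plus_unit A"
      using star_hom_mem[OF h'] inclusionD(3)[OF inclusion_plus_unit[OF incA]]
      by (intro cstar_gen_least[OF A']) auto
  qed
  have car: "cartan A B" using env unfolding cartan_envelope_def by (rule conjunct1)
  have "unit_of (unitization A) = 1" "unitization A = plus_unit A"
    using nuA unit_of_plus_unit[OF cstar_subalg_0[OF A]] by (simp_all add: unitization_def)
  then show ?thesis
    unfolding cartan_envelope_def plus_unit_eq[symmetric] \<beta>_def[symmetric]
    using cartan_plus_unit[OF car E nuA G GB] h' inj' rh' imDB iip' E' Bgen' Agen'
    by (simp flip: plus_unit_eq) blast
qed

lemma closed_ideal_self: "cstar_subalg S \<Longrightarrow> closed_ideal S S"
  by (auto simp: closed_ideal_def cstar_subalg_def)

text \<open>The structure is read off from two decompositions: \<open>B\<close> is \<open>D1\<close>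
  and \<open>A\<close> is \<open>C1\<close> plus the complex multiples of
  \<open>f = \<pi> 1\<close>, where \<open>f\<close> is the unit of \<open>A\<close> and lies
  outside \<open>C1\<close>. An element known to lie in \<open>D1\<close> or \<open>C1\<close> then
  has no scalar part.\<close>

theorem cartan_envelope_of_unitization:
  fixes C D :: "'a::cstar_algebra set" and A B :: "'b::cstar_algebra set"
  assumes reg: "regular_inclusion C D" and nu: "\<not> unital_alg C"
    and F: "approx_id F C" "eventually (\<lambda>u. u \<in> D) F"
    and env: "cartan_envelope (plus_unit C) (plus_unit D) A B \<pi>" and E: "faithful_cond_exp A B \<Delta>"
  defines "D1 \<equiv> cstar_gen (\<Delta> ` \<pi> ` C)"
  defines "C1 \<equiv> cstar_gen (\<pi> ` C \<union> D1)"
  shows "closed_ideal D1 B" "codim_one D1 B" "closed_ideal C1 A" "codim_one C1 A"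
    "cartan_envelope C D C1 D1 \<pi>"
proof -
  from env obtain \<Delta>0 where regA: "regular_inclusion A B" and ab: "abelian B" and masa: "rel_commutant A B = B"
    and h': "star_hom (plus_unit C) \<pi> A" and inj: "inj_on \<pi> (plus_unit C)"
    and rh: "regular_hom (plus_unit C) (plus_unit D) \<pi> A B" and DB: "\<pi> ` plus_unit D \<subseteq> B"
    and iip: "ideal_intersection_property B (\<pi> ` plus_unit D)" and E0: "faithful_cond_exp A B \<Delta>0"
    and Bgen: "B = cstar_gen (\<Delta>0 ` \<pi> ` plus_unit C)" and Agen: "A = cstar_gen (\<pi> ` plus_unit C \<union> B)"
    by (rule cartan_envelopeD)
  have inc: "inclusion C D" and incA: "inclusion A B"
    using reg regA by (auto simp: regular_inclusion_def)
  note C = inclusionD(1)[OF inc] and D = inclusionD(2)[OF inc] and DC = inclusionD(3)[OF inc]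
  note A = inclusionD(1)[OF incA] and B = inclusionD(2)[OF incA] and BA = inclusionD(3)[OF incA]
  note C' = cstar_subalg_plus_unit[OF C] and D' = cstar_subalg_plus_unit[OF D]
  have sub: "C \<subseteq> plus_unit C" "D \<subseteq> plus_unit D" unfolding plus_unit_eq by (rule subset_plus_unit_of)+
  have one: "1 \<in> plus_unit C" "1 \<in> plus_unit D"
    unfolding plus_unit_eq by (rule unit_in_plus_unit_of cstar_subalg_0 C D)+
  have nC: "1 \<notin> C" using nu by (rule not_unital_imp_one_notin)
  have CA: "\<pi> ` plus_unit C \<subseteq> A" "\<pi> ` C \<subseteq> A" using star_hom_mem[OF h'] sub by auto
  have h: "star_hom C \<pi> A" using star_hom_mono[OF h' sub(1) CA(2)] .
  define f where "f = \<pi> 1"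
  have fB: "f \<in> B" using DB one by (auto simp: f_def)
  have ff: "f * f = f" "cs_adj f = f" "norm f \<le> 1"
    using star_hom_mult[OF h' one(1) one(1)] star_hom_adj[OF h' one(1)] norm_star_hom_le[OF C' h' one(1)]
    by (simp_all add: f_def)
  have \<pi>: "\<pi> (c + cs_scale l 1) = \<pi> c + cs_scale l f" if "c \<in> C" for c l
    using star_hom_add[OF h', of c "cs_scale l 1"] star_hom_scale[OF h' one(1)] that sub cstar_subalg_scale[OF C' one(1)]
    by (auto simp: f_def)

  have f\<pi>: "f * \<pi> c = \<pi> c" "\<pi> c * f = \<pi> c" if "c \<in> plus_unit C" for c
    using star_hom_mult[OF h' one(1) that] star_hom_mult[OF h' that one(1)] by (simp_all add: f_def)
  \<comment> \<open>The filter concentrated at \<open>f\<close> is an approximate unit of the image,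
    so the general results show that \<open>f\<close> is a unit for all of \<open>A\<close> and also
    provide the setting for the expectation.\<close>
  have P0: "approx_id (principal {f}) (\<pi> ` plus_unit C)"
    using ff f\<pi> by (auto simp: approx_id_def eventually_principal principal_eq_bot_iff
        intro!: tendsto_eventually)
  have "approx_id (filtermap (\<lambda>u. u * u) (principal {f})) (cstar_gen (\<pi> ` plus_unit C \<union> cstar_gen (\<Delta>0 ` \<pi> ` plus_unit C)))"
    by (rule approx_id_square[OF E0 incA ab P0 _ CA(1)]) (simp add: eventually_principal fB)
  then have P: "approx_id (principal {f}) A"
    using Bgen Agen by (simp add: ff)
  have PB: "eventually (\<lambda>u. u \<in> B) (principal {f})" using fB by (simp add: eventually_principal)
  have fx: "f * x = x" if x: "x \<in> A" for x
    by (rule approx_id_unit[OF P _ x]) (simp add: eventually_principal ff)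
  have fA: "f * x = x \<and> x * f = x" if x: "x \<in> A" for x
    using arg_cong[OF fx[OF cstar_subalg_adj[OF A x]], of cs_adj] fx[OF x] by (simp add: cs_adj_simps ff)
  interpret cond: cond_exp_approx A B \<Delta> "principal {f}" using incA E P PB by unfold_locales

  \<comment> \<open>The expectation that generates \<open>B\<close> is replaced by the given
    one.\<close>
  have "\<Delta>0 ` \<pi> ` plus_unit C = \<Delta> ` \<pi> ` plus_unit C"
    using cond_exp_unique[OF regA ab masa P PB E0 E] CA(1) by (intro image_cong refl) auto
  then have Bgen: "B = cstar_gen (\<Delta> ` \<pi> ` plus_unit C)" using Bgen by simp

  have C1: "cstar_subalg C1" and D1: "cstar_subalg D1" unfolding C1_def D1_def by (rule cstar_subalg_gen)+
  have D1B: "D1 \<subseteq> B" unfolding D1_def using cond_exp_mem[OF E] CA by (intro cstar_gen_least[OF B]) auto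
  have D1C1: "D1 \<subseteq> C1" and \<pi>C1: "\<pi> ` C \<subseteq> C1"
    using cstar_gen_superset[of "\<pi> ` C \<union> D1"] unfolding C1_def by simp_all
  have C1A: "C1 \<subseteq> A" unfolding C1_def using D1B BA CA by (intro cstar_gen_least[OF A]) auto
  have \<pi>D1: "\<pi> ` D \<subseteq> D1"
  proof (rule image_subsetI)
    fix d assume d: "d \<in> D"
    have "\<pi> d \<in> B" using DB d sub by blast
    then have "\<pi> d = \<Delta> (\<pi> d)" using cond_exp_id[OF E] by simp
    moreover have "\<Delta> (\<pi> d) \<in> \<Delta> ` \<pi> ` C" using d DC by blast
    ultimately show "\<pi> d \<in> D1" unfolding D1_def using cstar_gen_superset by (metis subsetD)
  qed
  define G where "G = filtermap (\<lambda>u. u * u) (filtermap \<pi> F)"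
  have FC: "eventually (\<lambda>u. u \<in> C) F" using F(2) by (rule eventually_mono) (use DC in blast)
  have G: "approx_id G C1"
    unfolding G_def C1_def D1_def
  proof (rule approx_id_square[OF E incA ab approx_id_star_hom[OF h C F(1) FC] _ CA(2)])
    show "\<forall>\<^sub>F u in filtermap \<pi> F. u \<in> B"
      using F(2) unfolding eventually_filtermap by (rule eventually_mono) (use DB sub in blast)
  qed
  have GD: "eventually (\<lambda>u. u \<in> \<pi> ` D) G"
    unfolding G_def eventually_filtermap using F(2)
  proof eventually_elim
    case (elim u)
    have "\<pi> u * \<pi> u = \<pi> (u * u)" using star_hom_mult[OF h] DC elim by (metis subsetD)
    then show ?case using cstar_subalg_mult[OF D elim elim] by blast
  qed
  have GD1: "eventually (\<lambda>u. u \<in> D1) G" using GD by (rule eventually_mono) (use \<pi>D1 in blast)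
  \<comment> \<open>If \<open>f\<close> were in \<open>C1\<close>, it would be the limit of
    \<open>u * f = u\<close> in the closed image of \<open>D\<close>, so \<open>f = \<pi> d\<close>
    and injectivity would give \<open>1 = d\<close> in \<open>C\<close>.\<close>
  have fC1: "f \<notin> C1"
  proof
    assume f: "f \<in> C1"
    have "closed (\<pi> ` D)"
      using closed_star_hom_image[OF C' h' inj cstar_subalg_closed[OF D]] DC sub by blast
    moreover have "eventually (\<lambda>u. u * f \<in> \<pi> ` D) G"
      using GD GD1 by eventually_elim (use fA D1B BA in \<open>simp add: subset_iff\<close>)
    ultimately have "f \<in> \<pi> ` D"
      using closed_limit[OF _ approx_id_not_bot[OF G] _ approx_id_left[OF G f]] by blast
    then obtain d where d: "d \<in> D" "\<pi> 1 = \<pi> d" by (auto simp: f_def)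
    then have "1 = d" using inj_onD[OF inj d(2) one(1)] DC sub by blast
    then show False using d DC nC by blast
  qed
  have fD1: "f \<notin> D1" using fC1 D1C1 by blast
  have uC1: "f * x = x \<and> x * f = x" if "x \<in> C1" for x using fA C1A that by blast
  have uD1: "f * x = x \<and> x * f = x" if "x \<in> D1" for x using uC1 D1C1 that by blast
  have Beq: "B = plus_unit_of D1 f"
  proof
    have "\<Delta> (\<pi> y) \<in> plus_unit_of D1 f" if y: "y \<in> plus_unit C" for y
    proof -
      obtain c l where c: "c \<in> C" "y = c + cs_scale l 1" using y by (auto simp: plus_unit_def)
      have "\<Delta> (\<pi> y) = \<Delta> (\<pi> c) + cs_scale l f"
      proof -
        have "\<pi> c \<in> A" "f \<in> A" using c CA fB BA by auto
        then show ?thesis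
          using \<pi>[OF c(1)] c(2) cstar_subalg_scale[OF A, of f]
          by (simp add: cond_exp_add[OF E] cond_exp_scale[OF E] cond_exp_id[OF E fB])
      qed
      moreover have "\<Delta> (\<pi> c) \<in> D1" unfolding D1_def using c by (intro subsetD[OF cstar_gen_superset]) simp
      ultimately show ?thesis using plus_unit_ofI by metis
    qed
    then show "B \<subseteq> plus_unit_of D1 f"
      by (subst Bgen) (intro cstar_gen_least[OF cstar_subalg_plus_unit_of[OF D1 ff(1,2) uD1]], auto)
    show "plus_unit_of D1 f \<subseteq> B"
      by (rule plus_unit_of_subset[OF cstar_subalg_csubspace[OF B] D1B fB])
  qed
  have Aeq: "A = plus_unit_of C1 f"
  proof
    have "\<pi> y \<in> plus_unit_of C1 f" if y: "y \<in> plus_unit C" for y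
    proof -
      obtain c l where c: "c \<in> C" "y = c + cs_scale l 1" using y by (auto simp: plus_unit_def)
      then show ?thesis using \<pi>[OF c(1)] \<pi>C1 plus_unit_ofI by (metis imageI subsetD)
    qed
    moreover have "B \<subseteq> plus_unit_of C1 f" unfolding Beq using D1C1 by (auto simp: plus_unit_of_def)
    ultimately show "A \<subseteq> plus_unit_of C1 f"
      by (subst Agen) (intro cstar_gen_least[OF cstar_subalg_plus_unit_of[OF C1 ff(1,2) uC1]], auto)
    show "plus_unit_of C1 f \<subseteq> A"
      by (rule plus_unit_of_subset[OF cstar_subalg_csubspace[OF A] C1A subsetD[OF BA fB]])
  qed
  show idD: "closed_ideal D1 B" unfolding Beq by (rule closed_ideal_plus_unit_of[OF closed_ideal_self[OF D1] uD1])
  show idC: "closed_ideal C1 A" unfolding Aeq by (rule closed_ideal_plus_unit_of[OF closed_ideal_self[OF C1] uC1])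
  show "codim_one D1 B"
    unfolding codim_one_def by (rule bexI[of _ f]) (use fD1 fB Beq in \<open>simp_all add: plus_unit_of_def\<close>)
  show "codim_one C1 A"
    unfolding codim_one_def by (rule bexI[of _ f]) (use fC1 fB BA Aeq in \<open>auto simp: plus_unit_of_def\<close>)

  \<comment> \<open>Membership in \<open>D1\<close> thus splits into membership in \<open>B\<close>,
    known from the large inclusion, and membership in the ideal \<open>C1\<close>.\<close>
  have D1eq: "D1 = B \<inter> C1"
    using inter_plus_unit_of[OF cstar_subalg_csubspace[OF C1] D1C1 fC1] Beq by simp
  have incl: "inclusion C1 D1" using C1 D1 D1C1 by (simp add: inclusion_def)
  have reg1: "regular_inclusion C1 D1"
    by (rule regular_inclusion_ideal[OF regA C1A _ D1eq incl G GD1]) (use closed_idealD(4,5)[OF idC] in blast)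
  have ab1: "abelian D1" using ab D1B by (auto simp: abelian_def)
  have masa1: "rel_commutant C1 D1 = D1"
  proof
    show "D1 \<subseteq> rel_commutant C1 D1" using ab1 D1C1 by (auto simp: rel_commutant_def abelian_def)
    show "rel_commutant C1 D1 \<subseteq> D1"
    proof
      fix c assume c: "c \<in> rel_commutant C1 D1"
      then have cC: "c \<in> C1" "c \<in> A" using C1A by (auto simp: rel_commutant_def)
      have "c * b = b * c" if "b \<in> B" for b
      proof -
        obtain d l where "d \<in> D1" "b = d + cs_scale l f" using \<open>b \<in> B\<close> Beq by (auto elim: plus_unit_ofE)
        then show ?thesis using c uC1[OF cC(1)] by (simp add: rel_commutant_def cs_ring_simps)
      qed
      then have "c \<in> rel_commutant A B" using cC by (simp add: rel_commutant_def)
      then show "c \<in> D1" using masa D1eq cC by blast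
    qed
  qed
  have E1: "faithful_cond_exp C1 D1 \<Delta>"
  proof -
    \<comment> \<open>By construction \<open>\<Delta>\<close> maps the generators
      \<open>\<pi> c\<close> into \<open>D1\<close>. For general \<open>x\<close> in
      \<open>C1\<close> the values \<open>\<Delta> (u * x) = u * \<Delta> x\<close> lie in the ideal
      \<open>D1\<close>, which is closed.\<close>
    have mem: "\<Delta> x \<in> D1" if x: "x \<in> C1" for x
    proof (rule closed_limit[OF cstar_subalg_closed[OF D1] approx_id_not_bot[OF G]])
      have xA: "x \<in> A" using x C1A by blast
      show "((\<lambda>u. \<Delta> (u * x)) \<longlongrightarrow> \<Delta> x) G"
      proof (rule cond_exp_tendsto[OF E A _ approx_id_left[OF G x] xA])
        show "\<forall>\<^sub>F u in G. u * x \<in> A"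
          using GD1 by eventually_elim (use xA D1B BA cstar_subalg_mult[OF A] in blast)
      qed
      show "\<forall>\<^sub>F u in G. \<Delta> (u * x) \<in> D1"
        using GD1
      proof eventually_elim
        case (elim u)
        have "\<Delta> (u * x) = u * \<Delta> x" using cond.cond_exp_mult(1)[OF _ xA] elim D1B by blast
        then show ?case using closed_idealD(5)[OF idD elim cond_exp_mem[OF E xA]] by simp
      qed
    qed
    have pos: "positive_in D1 (\<Delta> (cs_adj x * x))" if x: "x \<in> C1" for x
    proof -
      have y: "\<Delta> (cs_adj x * x) \<in> D1" using x mem cstar_subalg_mult[OF C1] cstar_subalg_adj[OF C1] by blast
      obtain b where b: "b \<in> B" "\<Delta> (cs_adj x * x) = cs_adj b * b"
        using cond_exp_positive[OF E] x C1A unfolding positive_in_def by blast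
      obtain d l where d: "d \<in> D1" "b = d + cs_scale l f" using b(1) Beq by (auto elim: plus_unit_ofE)
      have "cs_adj b * b = (cs_adj d + cs_scale (cnj l) f) * (d + cs_scale l f)" using d ff by (simp add: cs_adj_simps)
      also have "\<dots> = (cs_adj d * d + cs_scale l (cs_adj d) + cs_scale (cnj l) d) + cs_scale (cnj l * l) f"
        by (rule mult_plus_unit_of[of f D1]) (use ff uD1 d cstar_subalg_adj[OF D1] in auto)
      finally have eq: "cs_adj b * b = (cs_adj d * d + cs_scale l (cs_adj d) + cs_scale (cnj l) d) + cs_scale (cnj l * l) f" .
      have "cs_adj d * d + cs_scale l (cs_adj d) + cs_scale (cnj l) d \<in> D1"
        using d(1) by (intro cstar_subalg_ops[OF D1])
      \<comment> \<open>The factor \<open>b\<close> is only known to lie in \<open>B\<close>. The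
        scalar part of \<open>cs_adj b * b\<close> is the squared modulus of that of
        \<open>b\<close>; it vanishes because the product is in \<open>D1\<close>, so
        \<open>b\<close> itself is in \<open>D1\<close>.\<close>
      then have "cnj l * l = 0"
        using plus_unit_of_mem_iff[OF cstar_subalg_csubspace[OF D1] fD1] y unfolding b(2) eq by blast
      then have "b = d" using d by simp
      then show ?thesis using b d unfolding positive_in_def by blast
    qed
    note [simp] = subsetD[OF C1A] subsetD[OF D1B]
    show ?thesis
      unfolding faithful_cond_exp_def
      by (auto simp: mem pos cond_exp_add[OF E] cond_exp_scale[OF E] cond_exp_id[OF E] cond_exp_norm[OF E]
        cond_exp_bimodule[OF E] intro: cond_exp_faithful[OF E])
  qed
  have car: "cartan C1 D1" unfolding cartan_def using reg1 ab1 masa1 E1 by blast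
  have rh1: "regular_hom C D \<pi> C1 D1"
    unfolding regular_hom_def
  proof (rule image_subsetI)
    fix v assume v: "v \<in> normalizers C D"
    have N: "\<pi> v \<in> normalizers A B"
      using normalizers_plus_unit[OF inc F] v rh by (auto simp: regular_hom_def)
    have vC1: "\<pi> v \<in> C1" "cs_adj (\<pi> v) \<in> C1"
      using normalizersD(1)[OF v] \<pi>C1 cstar_subalg_adj[OF C1] by auto
    have "\<pi> v * d * cs_adj (\<pi> v) \<in> D1 \<and> cs_adj (\<pi> v) * d * \<pi> v \<in> D1" if d: "d \<in> D1" for d
      using normalizersD(2,3)[OF N, of d] d D1eq vC1 cstar_subalg_mult[OF C1] by auto
    then show "\<pi> v \<in> normalizers C1 D1" using vC1 by (simp add: normalizers_def)
  qed
  have iip1: "ideal_intersection_property D1 (\<pi> ` D)"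
    unfolding ideal_intersection_property_def
  proof (intro allI impI, elim conjE)
    fix J assume J: "closed_ideal J D1" "J \<noteq> {0}"
    then have "closed_ideal J B" unfolding Beq by (intro closed_ideal_plus_unit_of uD1)
    then have "J \<inter> \<pi> ` plus_unit D \<noteq> {0}" using iip J by (auto simp: ideal_intersection_property_def)
    \<comment> \<open>The ideal lies in \<open>D1\<close>, so any of its elements coming from the
      unitized \<open>D\<close> has zero scalar part.\<close>
    moreover have "J \<inter> \<pi> ` plus_unit D = J \<inter> \<pi> ` D"
    proof
      show "J \<inter> \<pi> ` plus_unit D \<subseteq> J \<inter> \<pi> ` D"
      proof
        fix y assume "y \<in> J \<inter> \<pi> ` plus_unit D"
        then obtain d l where d: "d \<in> D" "y = \<pi> (d + cs_scale l 1)" "y \<in> J" by (auto simp: plus_unit_def)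
        have "y = \<pi> d + cs_scale l f" using \<pi> d DC by auto
        moreover have "y \<in> D1" "\<pi> d \<in> D1" using closed_idealD(1)[OF J(1)] d \<pi>D1 by auto
        ultimately have "l = 0" using plus_unit_of_mem_iff[OF cstar_subalg_csubspace[OF D1] fD1] by blast
        then show "y \<in> J \<inter> \<pi> ` D" using d by simp
      qed
    qed (use sub in auto)
    ultimately show "J \<inter> \<pi> ` D \<noteq> {0}" by simp
  qed
  show "cartan_envelope C D C1 D1 \<pi>"
    unfolding cartan_envelope_def
  proof (intro conjI)
    show "star_hom C \<pi> C1" using star_hom_mono[OF h order_refl \<pi>C1] .
    show "inj_on \<pi> C" using inj_on_subset[OF inj sub(1)] .
    show "\<exists>\<Delta>. faithful_cond_exp C1 D1 \<Delta> \<and> D1 = cstar_gen (\<Delta> ` \<pi> ` C)" using E1 D1_def by blast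
    show "C1 = cstar_gen (\<pi> ` C \<union> D1)" by (simp add: C1_def)
  qed (fact car rh1 \<pi>D1 iip1)+
qed

theorem theorem4p2p8:
  fixes C D :: "'a::cstar_algebra set"
  assumes reg: "regular_inclusion C D"
    and abD: "abelian D"
    and aup: "approx_unit_property C D"
    and nonunital: "\<not> unital_alg C"
  shows "(pseudo_cartan C D \<longleftrightarrow> pseudo_cartan (unitization C) (plus_unit D))
    \<and> (\<forall>(A::'b::cstar_algebra set) B \<alpha>. cartan_envelope C D A B \<alpha> \<longrightarrow>
          cartan_envelope (unitization C) (plus_unit D) (unitization A) (plus_unit_of B (unit_of (unitization A))) (ext_hom C \<alpha> A))
    \<and> (\<forall>(A::'c::cstar_algebra set) B \<pi> \<Delta>.
          cartan_envelope (unitization C) (plus_unit D) A B \<pi> \<and> faithful_cond_exp A B \<Delta> \<longrightarrow>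
          (let D1 = cstar_gen (\<Delta> ` \<pi> ` C); C1 = cstar_gen (\<pi> ` C \<union> D1) in
             closed_ideal D1 B \<and> codim_one D1 B \<and> closed_ideal C1 A \<and> codim_one C1 A
             \<and> cartan_envelope C D C1 D1 \<pi>))"
proof -
  obtain F where F: "approx_id F C" "eventually (\<lambda>u. u \<in> D) F"
    using approx_unit_property_imp_approx_id[OF aup] by blast
  have "unitization C = plus_unit C" using nonunital by (simp add: unitization_def)
  then show ?thesis
    unfolding Let_def
    using pseudo_cartan_plus_unit_iff[OF reg abD nonunital F]
    by (intro conjI allI impI; (elim conjE)?)
      (simp_all add: cartan_envelope_unitization[OF reg nonunital F]
        cartan_envelope_of_unitization[OF reg nonunital F])
qed

end
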